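(* Let $X$ be a conservative CBI-process with functional characteristics $(F,R)$, where $F$ has parameters $(b,m)$ and $R$ has parameters $(\alpha,\beta,\mu)$, and assume that $X$ converges to a limit distribution $L$. Let $W$ be the scale function associated to the dual $\widehat X^R=-X^R$ of the spectrally positive Lévy process $X^R$ with Laplace exponent $R$. (So $b$ and $m$ are the drift and the Lévy measure of the subordinator $X^F$ with Laplace exponent $F$.) Then $L$ is infinitely divisible, and its Laplace exponent has the Lévy–Khintchine decomposition $$-\log\int_{[0,\infty)} e^{-ux}\,L(\mathrm{d}x)=u\gamma-\int_{(0,\infty)}\left(e^{-xu}-1\right)\frac{k(x)}{x}\,\mathrm{d}x,\qquad u\ge 0,$$ where $\gamma\ge 0$ and $k:(0,\infty)\to[0,\infty)$ are given by $$\gamma=b\,W(0),\qquad k(x)=b\,W'_+(x)+\int_{(0,\infty)}\left[W(x)-W(x-\xi)\right]m(\mathrm{d}\xi),\quad x>0.$$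
   Context: A conservative CBI-process (continuous-state branching process with immigration) is a stochastically continuous Markov process $X=(X_t)_{t\ge0}$ with state space $[0,\infty)$ such that $-\log\mathbb{E}^x[e^{-uX_t}]=\phi(t,u)+x\psi(t,u)$ for all $t,u,x\ge 0$ and some functions $\phi,\psi$. By Kawazu–Watanabe, the derivatives $F(u)=\partial_t\phi(t,u)|_{t=0}$, $R(u)=\partial_t\psi(t,u)|_{t=0}$ exist and have the form $$F(u)=bu-\int_{(0,\infty)}(e^{-u\xi}-1)\,m(\mathrm{d}\xi),\qquad R(u)=-\alpha u^2+\beta u-\int_{(0,\infty)}\left(e^{-u\xi}-1+u\xi\mathbf 1_{(0,1]}(\xi)\right)\mu(\mathrm{d}\xi),$$ with $\alpha,b\ge0$, $\beta\in\mathbb{R}$, $m,\mu$ Lévy measures on $(0,\infty)$, $\int(\xi\wedge1)\,m(\mathrm{d}\xi)<\infty$, $\int(\xi^2\wedge 1)\,\mu(\mathrm{d}\xi)<\infty$, and $\int_{0+}\frac{\mathrm{d}s}{\max(R(s),0)}=\infty$ (the integral over an arbitrarily small right neighbourhood of $0$). Moreover $\partial_t\phi=F(\psi)$, $\phi(0,u)=0$, $\partial_t\psi=R(\psi)$, $\psi(0,u)=u$. Conversely, any such pair $(F,R)$ determines a unique conservative CBI-process. $(F,R)$ are its functional characteristics. $X^F$ denotes the Lévy subordinator with $\mathbb{E}[e^{-uX^F_t}]=e^{-tF(u)}$, and $X^R$ the Lévy process without negative jumps with $\mathbb{E}[e^{-uX^R_t}]=e^{-tR(u)}$. A probability measure $L$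 on $[0,\infty)$ is the limit distribution of $X$ if $X_t\to L$ in distribution as $t\to\infty$ under $\mathbb{P}^x$ for every $x\ge0$. Known fact (Pinsky, Li): such an $L$ exists iff $R'_+(0)\le0$, $R\not\equiv0$ and $-\int_0^u F(s)/R(s)\,\mathrm{d}s<\infty$ for some $u>0$; then $-\log\int e^{-ux}L(\mathrm{d}x)=-\int_0^uF(s)/R(s)\,\mathrm{d}s$ for $u\ge 0$, and $R(u)<0$ for all $u>0$. The scale function of $\widehat X^R$ is the unique function $W:\mathbb{R}\to[0,\infty)$ that vanishes on $(-\infty,0)$, is continuous and increasing (non-decreasing) on $[0,\infty)$, and satisfies $\int_0^\infty e^{-ux}W(x)\,\mathrm{d}x=-1/R(u)$ for $u>0$. It is known that on $(0,\infty)$ $W$ is strictly positive, absolutely continuous and log-concave; $W'_+$ denotes its right derivative. *)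

theory Defs
  imports "HOL-Probability.Probability"
begin

section \<open>Markov processes on the half line\<close>

text \<open>
  A process is given by a measurable space \<open>\<Omega>\<close> (only its space and its sets matter),
  probability measures \<open>P x\<close> on it for every starting point \<open>x \<ge> 0\<close>, and random variables
  \<open>X t\<close> for \<open>t \<ge> 0\<close>. The values of \<open>P\<close> and \<open>X\<close> at negative arguments are irrelevant.
\<close>

definition law :: "(real \<Rightarrow> 'w measure) \<Rightarrow> (real \<Rightarrow> 'w \<Rightarrow> real) \<Rightarrow> real \<Rightarrow> real \<Rightarrow> real measure" where
  "law P X t x = distr (P x) borel (X t)"

definition natural_filtration :: "'w measure \<Rightarrow> (real \<Rightarrow> 'w \<Rightarrow> real) \<Rightarrow> real \<Rightarrow> 'w measure" where
  "natural_filtration \<Omega> X s =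
     sigma (space \<Omega>) {X r -` A \<inter> space \<Omega> | r A. 0 \<le> r \<and> r \<le> s \<and> A \<in> sets borel}"

definition markov_process ::
  "'w measure \<Rightarrow> (real \<Rightarrow> 'w measure) \<Rightarrow> (real \<Rightarrow> 'w \<Rightarrow> real) \<Rightarrow> bool" where
  "markov_process \<Omega> P X \<longleftrightarrow>
     (\<forall>x\<ge>0. prob_space (P x) \<and> sets (P x) = sets \<Omega>) \<and>
     (\<forall>t\<ge>0. X t \<in> borel_measurable \<Omega> \<and> (\<forall>\<omega>\<in>space \<Omega>. 0 \<le> X t \<omega>)) \<and>
     (\<forall>x\<ge>0. AE \<omega> in P x. X 0 \<omega> = x) \<and>
     (\<forall>t\<ge>0. law P X t \<in> restrict_space borel {0..} \<rightarrow>\<^sub>M prob_algebra borel) \<and>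
     (\<forall>x\<ge>0. \<forall>s\<ge>0. \<forall>t\<ge>0. \<forall>A\<in>sets borel.
        AE \<omega> in P x.
          real_cond_exp (P x) (natural_filtration \<Omega> X s) (\<lambda>\<omega>'. indicator A (X (s + t) \<omega>')) \<omega>
          = measure (law P X t (X s \<omega>)) A)"

definition stochastically_continuous ::
  "'w measure \<Rightarrow> (real \<Rightarrow> 'w measure) \<Rightarrow> (real \<Rightarrow> 'w \<Rightarrow> real) \<Rightarrow> bool" where
  "stochastically_continuous \<Omega> P X \<longleftrightarrow>
     (\<forall>x\<ge>0. \<forall>s\<ge>0. \<forall>\<epsilon>>0.
        ((\<lambda>t. measure (P x) {\<omega>\<in>space \<Omega>. \<bar>X t \<omega> - X s \<omega>\<bar> > \<epsilon>}) \<longlongrightarrow> 0) (at s within {0..}))"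

section \<open>Conservative CBI-processes\<close>

definition affine_exponents ::
  "(real \<Rightarrow> 'w measure) \<Rightarrow> (real \<Rightarrow> 'w \<Rightarrow> real) \<Rightarrow>
     (real \<Rightarrow> real \<Rightarrow> real) \<Rightarrow> (real \<Rightarrow> real \<Rightarrow> real) \<Rightarrow> bool" where
  "affine_exponents P X \<phi> \<psi> \<longleftrightarrow>
     (\<forall>t\<ge>0. \<forall>u\<ge>0. \<forall>x\<ge>0. - ln (\<integral>\<omega>. exp (- u * X t \<omega>) \<partial>P x) = \<phi> t u + x * \<psi> t u)"

definition conservative_CBI_process ::
  "'w measure \<Rightarrow> (real \<Rightarrow> 'w measure) \<Rightarrow> (real \<Rightarrow> 'w \<Rightarrow> real) \<Rightarrow> bool" where
  "conservative_CBI_process \<Omega> P X \<longleftrightarrow>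
     markov_process \<Omega> P X \<and> stochastically_continuous \<Omega> P X \<and> (\<exists>\<phi> \<psi>. affine_exponents P X \<phi> \<psi>)"

definition functional_characteristics ::
  "(real \<Rightarrow> 'w measure) \<Rightarrow> (real \<Rightarrow> 'w \<Rightarrow> real) \<Rightarrow> (real \<Rightarrow> real) \<Rightarrow> (real \<Rightarrow> real) \<Rightarrow> bool" where
  "functional_characteristics P X F R \<longleftrightarrow>
     (\<exists>\<phi> \<psi>. affine_exponents P X \<phi> \<psi> \<and>
        (\<forall>u\<ge>0. ((\<lambda>t. \<phi> t u) has_real_derivative F u) (at 0 within {0..}) \<and>
               ((\<lambda>t. \<psi> t u) has_real_derivative R u) (at 0 within {0..})))"

text \<open>
  Measures on \<open>(0,\<infinity>)\<close> are represented as Borel measures on the real line that do not charge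
  \<open>(-\<infinity>,0]\<close>.
\<close>

definition measure_on_pos :: "real measure \<Rightarrow> bool" where
  "measure_on_pos m \<longleftrightarrow> sets m = sets borel \<and> emeasure m {..0} = 0"

definition F_parameters :: "(real \<Rightarrow> real) \<Rightarrow> real \<Rightarrow> real measure \<Rightarrow> bool" where
  "F_parameters F b m \<longleftrightarrow>
     0 \<le> b \<and> measure_on_pos m \<and> (\<integral>\<^sup>+\<xi>. ennreal (min \<xi> 1) \<partial>m) < \<infinity> \<and>
     (\<forall>u\<ge>0. F u = b * u - (LINT \<xi>:{0<..}|m. exp (- u * \<xi>) - 1))"

text \<open>
  The last condition excludes explosion; in \<open>ennreal\<close> the inverse of \<open>0\<close> is \<open>\<infinity>\<close>.
\<close>

definition R_parameters ::
  "(real \<Rightarrow> real) \<Rightarrow> real \<Rightarrow> real \<Rightarrow> real measure \<Rightarrow> bool" where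
  "R_parameters R \<alpha> \<beta> \<mu> \<longleftrightarrow>
     0 \<le> \<alpha> \<and> measure_on_pos \<mu> \<and> (\<integral>\<^sup>+\<xi>. ennreal (min (\<xi>\<^sup>2) 1) \<partial>\<mu>) < \<infinity> \<and>
     (\<forall>u\<ge>0. R u = - \<alpha> * u\<^sup>2 + \<beta> * u
        - (LINT \<xi>:{0<..}|\<mu>. exp (- u * \<xi>) - 1 + u * \<xi> * indicator {0<..1} \<xi>)) \<and>
     (\<forall>\<epsilon>>0. (\<integral>\<^sup>+s\<in>{0<..\<epsilon>}. inverse (ennreal (max (R s) 0)) \<partial>lborel) = \<infinity>)"

section \<open>Limit distributions and infinite divisibility\<close>

text \<open>
  Convergence in distribution is \<^const>\<open>weak_conv_m\<close> with the index \<open>t \<rightarrow> \<infinity>\<close> running through the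
  reals instead of the naturals.
\<close>

definition limit_distribution ::
  "(real \<Rightarrow> 'w measure) \<Rightarrow> (real \<Rightarrow> 'w \<Rightarrow> real) \<Rightarrow> real measure \<Rightarrow> bool" where
  "limit_distribution P X L \<longleftrightarrow>
     prob_space L \<and> sets L = sets borel \<and> emeasure L {..<0} = 0 \<and>
     (\<forall>x\<ge>0. \<forall>y. isCont (cdf L) y \<longrightarrow> ((\<lambda>t. cdf (law P X t x) y) \<longlongrightarrow> cdf L y) at_top)"

definition convolution_power :: "nat \<Rightarrow> real measure \<Rightarrow> real measure" where
  "convolution_power n \<nu> = ((\<lambda>\<rho>. \<nu> \<star> \<rho>) ^^ n) (return borel 0)"

definition infinitely_divisible :: "real measure \<Rightarrow> bool" where
  "infinitely_divisible L \<longleftrightarrow>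
     (\<forall>n\<ge>1. \<exists>\<nu>. prob_space \<nu> \<and> sets \<nu> = sets borel \<and> L = convolution_power n \<nu>)"

section \<open>Scale functions\<close>

text \<open>
  \<open>R\<close> is the Laplace exponent of the spectrally positive Levy process \<open>X\<^sup>R\<close>, and \<open>W\<close> is the scale
  function of its dual.
\<close>

definition dual_scale_function :: "(real \<Rightarrow> real) \<Rightarrow> (real \<Rightarrow> real) \<Rightarrow> bool" where
  "dual_scale_function R W \<longleftrightarrow>
     (\<forall>x. 0 \<le> W x) \<and> (\<forall>x<0. W x = 0) \<and> continuous_on {0..} W \<and> mono_on {0..} W \<and>
     (\<forall>u>0. set_integrable lborel {0..} (\<lambda>x. exp (- u * x) * W x) \<and>
            (LINT x:{0..}|lborel. exp (- u * x) * W x) = - 1 / R u)"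

end

theory Submission
  imports Defs "HOL-Real_Asymp.Real_Asymp"
begin

text \<open>
  The limit law \<open>L\<close> is stationary, so its Laplace exponent satisfies \<open>l u = \<phi> t u + l (\<psi> t u)\<close>.
  Differentiating at \<open>t = 0\<close> gives \<open>F = - l' R\<close>, that is \<open>l u = \<integral>\<^sub>0\<^sup>u F / (- R)\<close>. Since \<open>-1 / R\<close> is the
  Laplace transform of \<open>W\<close>, the function \<open>F / (- R) - b W(0)\<close> is the Laplace transform of \<open>k\<close>, and
  integrating it over \<open>(0,u)\<close> turns \<open>exp (- v x)\<close> into \<open>(1 - exp (- u x)) / x\<close>.

  The regularity of \<open>W\<close> comes from its log-concavity. With
  \<open>w\<^sub>n = \<integral> x\<^sup>n / n! exp (- u x) W(x) dx\<close> and the scaled derivatives \<open>p\<^sub>n\<close> of \<open>- R\<close>, the Leibniz rule for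
  \<open>(-1 / R) (- R) = 1\<close> reads \<open>\<Sum>\<^sub>k w\<^sub>n\<^sub>-\<^sub>k p\<^sub>k = 0\<close>, where \<open>p\<^sub>k \<ge> 0\<close> for \<open>k \<ge> 2\<close>. This renewal equation
  makes \<open>n \<mapsto> w\<^sub>n\<close> log-concave for each \<open>u\<close>, and the Post-Widder inversion formula transports this to \<open>W\<close>.
\<close>

section \<open>Laplace transforms of probability measures on the half line\<close>

text \<open>The process is linked to \<open>F\<close> and \<open>R\<close> only by right derivatives
  at \<open>t = 0\<close>, and \<open>W\<close> is given only by continuity, monotonicity and its
  Laplace transform. Negativity of \<open>R\<close>, positivity of \<open>W\<close> and its right
  derivative \<open>D\<close> with \<open>W y - W x\<close> as integral are therefore all derived.
  Stationarity makes the derivative at \<open>t = 0\<close> sufficient: no differential equation for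
  \<open>\<psi>\<close> has to be solved. Log-concavity of \<open>W\<close> is usually read off from
  excursions. The route here stays with Laplace transforms: \<open>j ^ Suc n * w n j\<close> is the
  mean of \<open>W\<close> under an Erlang law concentrated near \<open>n / j\<close>, and a factor
  geometric in \<open>n\<close> does not disturb log-concavity in \<open>n\<close>. Concavity of
  \<open>ln W\<close> makes difference quotients monotone, hence convergent, and bounds them
  locally. Infinite divisibility asks for actual roots. Drift and Levy measure are divided by
  \<open>n\<close>, and a law with these data is built: Bernoulli mixtures approximate compound
  Poisson laws, which approximate the law wanted. Transforms involving \<open>D\<close> and
  \<open>k\<close> are computed with nonnegative integrals, so that integrability is an outcome and
  not a premise.\<close>

lemma has_real_derivative_integral:
  fixes f f' :: "real \<Rightarrow> 'a \<Rightarrow> real"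
  assumes u: "u \<in> {a<..<b}"
    and int: "\<And>v. v \<in> {a<..<b} \<Longrightarrow> integrable M (f v)"
    and f'_meas: "f' u \<in> borel_measurable M"
    and deriv: "AE x in M. \<forall>v\<in>{a<..<b}. ((\<lambda>v. f v x) has_real_derivative f' v x) (at v) \<and> \<bar>f' v x\<bar> \<le> g x"
    and g: "integrable M g"
  shows "((\<lambda>v. \<integral>x. f v x \<partial>M) has_real_derivative (\<integral>x. f' u x \<partial>M)) (at u)"
  unfolding has_field_derivative_iff tendsto_at_iff_sequentially comp_def
proof (intro allI impI)
  fix X :: "nat \<Rightarrow> real"
  assume X: "\<forall>i. X i \<in> UNIV - {u}" "X \<longlonglongrightarrow> u"
  have "eventually (\<lambda>n. X n \<in> {a<..<b}) sequentially"
    using X(2) u by (intro topological_tendstoD) auto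
  then obtain N where N: "\<And>n. n \<ge> N \<Longrightarrow> X n \<in> {a<..<b}"
    by (auto simp: eventually_sequentially)
  have "(\<lambda>n. \<integral>x. (f (X (n + N)) x - f u x) / (X (n + N) - u) \<partial>M) \<longlonglongrightarrow> (\<integral>x. f' u x \<partial>M)"
  proof (rule integral_dominated_convergence[where w = g])
    show "f' u \<in> borel_measurable M" "integrable M g" by fact+
    show "(\<lambda>x. (f (X (n + N)) x - f u x) / (X (n + N) - u)) \<in> borel_measurable M" for n
      using int[OF u] int[OF N[of "n + N"]] by auto
    show "AE x in M. (\<lambda>n. (f (X (n + N)) x - f u x) / (X (n + N) - u)) \<longlonglongrightarrow> f' u x"
      using deriv
    proof eventually_elim
      fix x assume "\<forall>v\<in>{a<..<b}. ((\<lambda>v. f v x) has_real_derivative f' v x) (at v) \<and> \<bar>f' v x\<bar> \<le> g x"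
      with u have "((\<lambda>v. (f v x - f u x) / (v - u)) \<longlongrightarrow> f' u x) (at u)"
        by (simp add: has_field_derivative_iff)
      then show "(\<lambda>n. (f (X (n + N)) x - f u x) / (X (n + N) - u)) \<longlonglongrightarrow> f' u x"
        unfolding tendsto_at_iff_sequentially comp_def using X LIMSEQ_ignore_initial_segment[OF X(2)]
        by (elim allE[of _ "\<lambda>n. X (n + N)"]) auto
    qed
    show "AE x in M. norm ((f (X (n + N)) x - f u x) / (X (n + N) - u)) \<le> g x" for n
      using deriv
    proof eventually_elim
      fix x assume x: "\<forall>v\<in>{a<..<b}. ((\<lambda>v. f v x) has_real_derivative f' v x) (at v) \<and> \<bar>f' v x\<bar> \<le> g x"
      \<comment> \<open>Mean value bound: the derivative is dominated by \<open>g x\<close> on the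
        whole interval, so the difference quotient inherits the dominator.\<close>
      have "norm (f (X (n + N)) x - f u x) \<le> g x * norm (X (n + N) - u)"
        by (rule field_differentiable_bound[of "{a<..<b}" "\<lambda>v. f v x" "\<lambda>v. f' v x"])
           (use N[of "n + N"] u x in \<open>auto intro: has_field_derivative_at_within\<close>)
      moreover have "X (n + N) \<noteq> u" using X by auto
      ultimately show "norm ((f (X (n + N)) x - f u x) / (X (n + N) - u)) \<le> g x"
        by (simp add: field_simps abs_divide)
    qed
  qed
  also have "(\<lambda>n. \<integral>x. (f (X (n + N)) x - f u x) / (X (n + N) - u) \<partial>M) =
     (\<lambda>n. ((\<integral>x. f (X (n + N)) x \<partial>M) - (\<integral>x. f u x \<partial>M)) / (X (n + N) - u))"
    using int[OF u] int[OF N] by (auto simp: Bochner_Integration.integral_diff)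
  finally show "(\<lambda>n. ((\<integral>x. f (X n) x \<partial>M) - (\<integral>x. f u x \<partial>M)) / (X n - u)) \<longlonglongrightarrow> (\<integral>x. f' u x \<partial>M)"
    by (rule LIMSEQ_offset)
qed

section \<open>Laplace transforms determine laws on the half line\<close>

definition prob_on_nonneg :: "real measure \<Rightarrow> bool" where
  "prob_on_nonneg M \<longleftrightarrow> prob_space M \<and> sets M = sets borel \<and> (AE x in M. 0 \<le> x)"

definition laplace :: "real measure \<Rightarrow> real \<Rightarrow> real" where
  "laplace M u = (\<integral>x. exp (- u * x) \<partial>M)"

lemma prob_on_nonneg_real_distribution:
  "prob_on_nonneg M \<Longrightarrow> real_distribution M"
  by (auto simp: prob_on_nonneg_def real_distribution_def real_distribution_axioms_def)

lemma prob_on_nonneg_integrable: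
  assumes M: "prob_on_nonneg M" and "f \<in> borel_measurable borel" and B: "\<And>x. 0 \<le> x \<Longrightarrow> \<bar>f x\<bar> \<le> B"
  shows "integrable M (f :: real \<Rightarrow> real)"
proof -
  interpret prob_space M using M by (simp add: prob_on_nonneg_def)
  have "f \<in> borel_measurable M" using assms by (simp add: prob_on_nonneg_def cong: measurable_cong_sets)
  then show ?thesis
    using M B by (intro integrable_const_bound[where B = B]) (auto simp: prob_on_nonneg_def elim!: eventually_mono)
qed

lemma prob_on_nonneg_integrable_exp:
  "prob_on_nonneg M \<Longrightarrow> 0 \<le> u \<Longrightarrow> integrable M (\<lambda>x. exp (- u * x))"
  by (rule prob_on_nonneg_integrable[where B = 1]) auto

lemma laplace_0: "prob_on_nonneg M \<Longrightarrow> laplace M 0 = 1"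
  by (simp add: laplace_def prob_on_nonneg_def prob_space.prob_space)

lemma laplace_pos:
  assumes M: "prob_on_nonneg M" and u: "0 \<le> u" shows "0 < laplace M u"
proof -
  interpret prob_space M using M by (simp add: prob_on_nonneg_def)
  show ?thesis unfolding laplace_def
    using prob_on_nonneg_integrable_exp[OF M u] expectation_greater[of "\<lambda>x. exp (- u * x)" 0] by simp
qed

lemma laplace_le_1:
  assumes M: "prob_on_nonneg M" and u: "0 \<le> u" shows "laplace M u \<le> 1"
proof -
  interpret prob_space M using M by (simp add: prob_on_nonneg_def)
  show ?thesis unfolding laplace_def
    using prob_on_nonneg_integrable_exp[OF M u] M u
    by (intro integral_le_const) (auto simp: prob_on_nonneg_def elim!: eventually_mono)
qed

text \<open>The substitution \<open>z = exp (- x)\<close> turns the Laplace transform at integers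
  into moments on \<open>[0,1]\<close>. Weierstrass approximation recovers the integrals of
  continuous step functions from these, and the steps squeeze the distribution functions.\<close>

lemma laplace_unique:
  assumes M: "prob_on_nonneg M" and N: "prob_on_nonneg N"
    and eq: "\<And>u. 0 < u \<Longrightarrow> laplace M u = laplace N u"
  shows "M = N"
proof -
  have cts_eq: "(\<integral>x. cts_step a b x \<partial>M) = (\<integral>x. cts_step a b x \<partial>N)" if ab: "a < b" for a b
  proof (rule ccontr)
    assume neq: "\<not> ?thesis"
    define e where "e = \<bar>(\<integral>x. cts_step a b x \<partial>M) - (\<integral>x. cts_step a b x \<partial>N)\<bar> / 2"
    have e: "e > 0" using neq by (simp add: e_def)
    have cc: "continuous_on S (cts_step a b)" for S
      using uniformly_continuous_imp_continuous[OF cts_step_uniformly_continuous[OF ab]]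
      by (rule continuous_on_subset) auto
    \<comment> \<open>The step function in the variable \<open>z = exp (- x)\<close>. As
      \<open>cts_step a b\<close> vanishes beyond \<open>b\<close>, cutting \<open>z\<close> off at
      \<open>exp (- (b + 1))\<close> changes no value and keeps the logarithm continuous down to
      \<open>z = 0\<close>.\<close>
    define g where "g z = cts_step a b (- ln (max z (exp (- (b + 1)))))" for z :: real
    have "continuous_on {0..1} g" unfolding g_def
      by (intro continuous_on_compose2[OF cc[of UNIV]] continuous_intros) 
         (auto simp: max_def not_le dest: order.trans[OF exp_ge_zero])
    then obtain p where p: "real_polynomial_function p" "\<And>z. z \<in> {0..1} \<Longrightarrow> \<bar>g z - p z\<bar> < e"
      using Stone_Weierstrass_real_polynomial_function[of "{0..1}" g e] e by auto
    from p(1) obtain c n where p_eq: "p = (\<lambda>x. \<Sum>i\<le>n. c i * x ^ i)"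
      unfolding real_polynomial_function_iff_sum by auto
    have g_eq: "g (exp (- x)) = cts_step a b x" for x
      using ab by (cases "x \<le> b + 1") (auto simp: g_def max_def cts_step_def)
    have approx: "\<bar>(\<integral>x. cts_step a b x \<partial>K) - (\<Sum>i\<le>n. c i * laplace K i)\<bar> < e"
      if K: "prob_on_nonneg K" for K
    proof -
      interpret K: real_distribution K using K by (rule prob_on_nonneg_real_distribution)
      have int1: "integrable K (cts_step a b)" using ab by (rule K.integrable_cts_step)
      have int2: "integrable K (\<lambda>x. \<Sum>i\<le>n. c i * exp (- real i * x))"
        using prob_on_nonneg_integrable_exp[OF K] by auto
      have "(\<Sum>i\<le>n. c i * laplace K i) = (\<integral>x. (\<Sum>i\<le>n. c i * exp (- real i * x)) \<partial>K)"
        unfolding laplace_def using prob_on_nonneg_integrable_exp[OF K]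
        by (subst Bochner_Integration.integral_sum) auto
      then have "\<bar>(\<integral>x. cts_step a b x \<partial>K) - (\<Sum>i\<le>n. c i * laplace K i)\<bar>
         = \<bar>\<integral>x. cts_step a b x - (\<Sum>i\<le>n. c i * exp (- real i * x)) \<partial>K\<bar>"
        using int1 int2 by (simp add: Bochner_Integration.integral_diff)
      also have "\<dots> \<le> (\<integral>x. \<bar>cts_step a b x - (\<Sum>i\<le>n. c i * exp (- real i * x))\<bar> \<partial>K)"
        by (rule integral_abs_bound)
      also have "\<dots> < (\<integral>x. e \<partial>K)"
      proof (rule K.integral_less_AE_space)
        show "AE x in K. \<bar>cts_step a b x - (\<Sum>i\<le>n. c i * exp (- real i * x))\<bar> < e"
          using K unfolding prob_on_nonneg_def
        proof (elim conjE eventually_mono)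
          fix x :: real assume "0 \<le> x"
          then show "\<bar>cts_step a b x - (\<Sum>i\<le>n. c i * exp (- real i * x))\<bar> < e"
            using p(2)[of "exp (- x)"] by (simp add: p_eq g_eq exp_of_nat_mult[symmetric])
        qed
      qed (use int1 int2 K.emeasure_space_1 in auto)
      finally show ?thesis using K.prob_space by simp
    qed
    \<comment> \<open>The hypothesis covers only positive arguments; the term \<open>i = 0\<close>
      is the total mass 1.\<close>
    have "(\<Sum>i\<le>n. c i * laplace M i) = (\<Sum>i\<le>n. c i * laplace N i)"
    proof (rule sum.cong)
      fix i :: nat show "c i * laplace M i = c i * laplace N i"
        using eq[of "real i"] laplace_0[OF M] laplace_0[OF N] by (cases i) auto
    qed auto
    with approx[OF M] approx[OF N] show False unfolding e_def by (auto simp: abs_if split: if_splits)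
  qed
  interpret M: real_distribution M using M by (rule prob_on_nonneg_real_distribution)
  interpret N: real_distribution N using N by (rule prob_on_nonneg_real_distribution)
  \<comment> \<open>For \<open>y > x\<close> the step from \<open>x\<close> to \<open>y\<close> lies
    between the indicators of \<open>{..x}\<close> and \<open>{..y}\<close>, so
    \<open>cdf M x \<le> cdf N y\<close>; then \<open>y\<close> decreases to
    \<open>x\<close>.\<close>
  have "cdf M x \<le> cdf N x" for x
  proof (rule tendsto_lowerbound)
    show "(cdf N \<longlongrightarrow> cdf N x) (at_right x)"
      using N.cdf_is_right_cont[of x] by (simp add: continuous_within)
    show "\<forall>\<^sub>F y in at_right x. cdf M x \<le> cdf N y"
      using M.cdf_cts_step(1)[of x] N.cdf_cts_step(2)[of x] cts_eq[of x]
      by (intro eventually_at_rightI[of x "x + 1"]) (auto intro: order.trans)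
  qed auto
  moreover have "cdf N x \<le> cdf M x" for x
  proof (rule tendsto_lowerbound)
    show "(cdf M \<longlongrightarrow> cdf M x) (at_right x)"
      using M.cdf_is_right_cont[of x] by (simp add: continuous_within)
    show "\<forall>\<^sub>F y in at_right x. cdf N x \<le> cdf M y"
      using N.cdf_cts_step(1)[of x] M.cdf_cts_step(2)[of x] cts_eq[of x]
      by (intro eventually_at_rightI[of x "x + 1"]) (auto intro: order.trans)
  qed auto
  ultimately have "cdf M = cdf N" by (auto intro!: ext antisym)
  then show ?thesis
    using cdf_unique M.real_distribution_axioms N.real_distribution_axioms by blast
qed

section \<open>Continuity theorem for Laplace transforms\<close>

lemma tendsto_at_right_of_nat_inverse:
  assumes "(g \<longlongrightarrow> l) (at_right (0::real))"
  shows "(\<lambda>n. g (1 / Suc n)) \<longlonglongrightarrow> l"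
proof -
  have "filterlim (\<lambda>n. 1 / real (Suc n)) (at_right 0) sequentially"
    unfolding filterlim_at using LIMSEQ_Suc[OF lim_1_over_n] by auto
  from filterlim_compose[OF assms this] show ?thesis .
qed

lemma continuous_on_laplace:
  assumes M: "prob_on_nonneg M" shows "continuous_on {0..} (laplace M)"
  unfolding continuous_on_sequentially comp_def
proof (intro allI ballI impI, elim conjE)
  fix X :: "nat \<Rightarrow> real" and u :: real
  assume X: "\<forall>n. X n \<in> {0..}" "X \<longlonglongrightarrow> u"
  interpret real_distribution M using M by (rule prob_on_nonneg_real_distribution)
  show "(\<lambda>n. laplace M (X n)) \<longlonglongrightarrow> laplace M u"
    unfolding laplace_def
  proof (rule integral_dominated_convergence[where w = "\<lambda>_. 1"])
    show "AE x in M. (\<lambda>n. exp (- X n * x)) \<longlonglongrightarrow> exp (- u * x)"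
      by (intro AE_I2 tendsto_intros X(2))
    have "AE x in M. 0 \<le> x" using M by (simp add: prob_on_nonneg_def)
    then show "AE x in M. norm (exp (- X n * x)) \<le> 1" for n
      by eventually_elim (use X(1) in simp)
  qed auto
qed

text \<open>Beyond \<open>r\<close> the function \<open>1 - exp (- x / r)\<close> is at least
  \<open>1 - exp (- 1) \<ge> 1 / 2\<close>, whence the factor 2. The half-open interval starts at
  \<open>-1\<close> so that a point mass at 0 lies inside.\<close>

lemma laplace_tail_bound:
  assumes M: "prob_on_nonneg M" and r: "0 < r"
  shows "1 - measure M {-1<..r} \<le> (1 - laplace M (1 / r)) * 2"
proof -
  interpret M: real_distribution M using M by (rule prob_on_nonneg_real_distribution)
  have "1 - measure M {-1<..r} = (\<integral>x. 1 - indicator {-1<..r} x \<partial>M)"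
    using M.prob_space by (subst Bochner_Integration.integral_diff)
      (auto intro!: M.integrable_const_bound[where B = 1])
  also have "\<dots> \<le> (\<integral>x. (1 - exp (- (1 / r) * x)) * 2 \<partial>M)"
  proof (rule integral_mono_AE)
    show "AE x in M. 1 - indicator {-1<..r} x \<le> (1 - exp (- (1 / r) * x)) * 2"
      using M unfolding prob_on_nonneg_def
    proof (elim conjE eventually_mono)
      fix x :: real assume x: "0 \<le> x"
      have half: "exp (- 1) \<le> (1 / 2 :: real)"
        using exp_ge_add_one_self[of 1] by (simp add: exp_minus field_simps)
      show "1 - indicator {-1<..r} x \<le> (1 - exp (- (1 / r) * x)) * 2"
      proof (cases "x \<le> r")
        case True then show ?thesis using x r by (auto simp: indicator_def)
      next
        case False
        then have "exp (- (1 / r) * x) \<le> exp (- 1)" using r by (simp add: field_simps)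
        with half have "exp (- (1 / r) * x) * 2 \<le> 1" by linarith
        then show ?thesis using False by (auto simp: indicator_def)
      qed
    qed
  qed (use prob_on_nonneg_integrable_exp[OF M, of "1 / r"] r in \<open>auto intro!: Bochner_Integration.integrable_diff M.integrable_const_bound[of "indicator {-1<..r}" 1]\<close>)
  also have "\<dots> = (1 - laplace M (1 / r)) * 2"
    using prob_on_nonneg_integrable_exp[OF M, of "1 / r"] r M.prob_space
    by (simp add: laplace_def Bochner_Integration.integral_diff)
  finally show ?thesis .
qed

text \<open>Only existence is claimed, so one convergent subsequence is enough: \<open>g\<close>
  tending to 1 at 0 makes the family tight, and bounded continuous test functions identify the
  transform of the subsequential limit.\<close>

lemma laplace_continuity:
  fixes M :: "nat \<Rightarrow> real measure"
  assumes M: "\<And>n. prob_on_nonneg (M n)"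
    and lim: "\<And>u. 0 < u \<Longrightarrow> (\<lambda>n. laplace (M n) u) \<longlonglongrightarrow> g u"
    and g: "(g \<longlongrightarrow> 1) (at_right 0)"
  shows "\<exists>\<nu>. prob_on_nonneg \<nu> \<and> (\<forall>u>0. laplace \<nu> u = g u)"
proof -
  have rd: "real_distribution (M n)" for n using M by (rule prob_on_nonneg_real_distribution)
  have "tight M" unfolding tight_def
  proof (intro conjI allI impI)
    fix e :: real assume e: "e > 0"
    \<comment> \<open>The radius is read off from \<open>g\<close> near 0; \<open>e / 2\<close>
      compensates for the factor 2 in the tail bound.\<close>
    have "eventually (\<lambda>n. g (1 / Suc n) > 1 - e / 2) sequentially"
      using order_tendstoD(1)[OF tendsto_at_right_of_nat_inverse[OF g], of "1 - e / 2"] e by simp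
    then obtain m where m: "g (1 / Suc m) > 1 - e / 2" by (auto simp: eventually_sequentially)
    define r where "r = real (Suc m)"
    have r: "r > 0" by (simp add: r_def)
    have "eventually (\<lambda>n. laplace (M n) (1 / r) > 1 - e / 2) sequentially"
      using order_tendstoD(1)[OF lim[of "1 / r"] , of "1 - e / 2"] m r by (auto simp: r_def)
    then obtain N where N: "\<And>n. n \<ge> N \<Longrightarrow> laplace (M n) (1 / r) > 1 - e / 2"
      by (auto simp: eventually_sequentially)
    have ev: "eventually (\<lambda>k. measure (M n) {-1<..real k} > 1 - e) sequentially" for n
    proof -
      interpret real_distribution "M n" by (rule rd)
      have "(\<lambda>k. measure (M n) {-1<..real k}) \<longlonglongrightarrow> measure (M n) (\<Union>k. {-1<..real k})"
        by (intro finite_Lim_measure_incseq) (auto simp: incseq_def)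
      also have "measure (M n) (\<Union>k. {-1<..real k}) = measure (M n) {-1<..}"
        by (rule arg_cong[where f = "measure (M n)"]) (auto intro: real_arch_simple)
      also have "measure (M n) {-1<..} = 1"
        using M[of n] by (intro prob_eq_1[THEN iffD2]) (auto simp: prob_on_nonneg_def elim!: eventually_mono)
      finally show ?thesis using order_tendstoD(1)[of _ 1 sequentially "1 - e"] e by auto
    qed
    \<comment> \<open>The finitely many laws before \<open>N\<close> escape the uniform estimate and
      are treated one by one.\<close>
    have "eventually (\<lambda>k. \<forall>n\<in>{..<N}. measure (M n) {-1<..real k} > 1 - e) sequentially"
      by (intro eventually_ball_finite) (use ev in auto)
    moreover have "eventually (\<lambda>k. real k \<ge> r) sequentially"
      using filterlim_real_sequentially by (simp add: filterlim_at_top)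
    ultimately have "eventually (\<lambda>k. (\<forall>n\<in>{..<N}. measure (M n) {-1<..real k} > 1 - e) \<and> real k \<ge> r) sequentially"
      by eventually_elim auto
    then obtain k where k: "\<And>n. n < N \<Longrightarrow> measure (M n) {-1<..real k} > 1 - e" "real k \<ge> r"
      by (auto simp: eventually_sequentially)
    have "measure (M n) {-1<..real k} > 1 - e" for n
    proof (cases "n < N")
      case False
      interpret real_distribution "M n" by (rule rd)
      have "1 - measure (M n) {-1<..r} < e"
        using laplace_tail_bound[OF M[of n] r] N[of n] False by simp
      moreover have "measure (M n) {-1<..r} \<le> measure (M n) {-1<..real k}"
        using k(2) by (intro finite_measure_mono) auto
      ultimately show ?thesis by linarith
    qed (use k in auto)
    then show "\<exists>a b. a < b \<and> (\<forall>n. measure (M n) {a<..b} > 1 - e)"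
      by (intro exI[of _ "-1"] exI[of _ "real k"]) auto
  qed (rule rd)
  from tight_imp_convergent_subsubsequence[OF this, of id] obtain s \<nu> where
    s: "strict_mono s" and \<nu>: "real_distribution \<nu>" "weak_conv_m (M \<circ> id \<circ> s) \<nu>"
    by (auto simp: strict_mono_def)
  have conv: "(\<lambda>n. integral\<^sup>L (M (s n)) f) \<longlonglongrightarrow> integral\<^sup>L \<nu> f"
    if "\<And>x. isCont f x" "\<And>x. norm (f x) \<le> 1" for f :: "real \<Rightarrow> real"
    using weak_conv_imp_integral_bdd_continuous_conv[of "\<lambda>n. M (s n)" \<nu> f 1] \<nu> rd that by (simp add: comp_def)
  have nonneg: "AE x in \<nu>. 0 \<le> x"
  proof -
    interpret real_distribution \<nu> by fact
    \<comment> \<open>Bounded, continuous and positive exactly on the negative half line, so that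
      carrying no mass there passes to the limit.\<close>
    define f :: "real \<Rightarrow> real" where "f x = max 0 (min 1 (- x))" for x
    have "(\<lambda>n. integral\<^sup>L (M (s n)) f) \<longlonglongrightarrow> integral\<^sup>L \<nu> f"
      by (rule conv) (auto simp: f_def[abs_def] intro!: continuous_intros)
    moreover have "integral\<^sup>L (M (s n)) f = 0" for n
      using M[of "s n"] by (intro integral_eq_zero_AE) (auto simp: f_def prob_on_nonneg_def elim!: eventually_mono)
    ultimately have "integral\<^sup>L \<nu> f = 0" by (simp add: LIMSEQ_const_iff)
    moreover have "integrable \<nu> f"
      by (rule integrable_const_bound[where B = 1]) (auto simp: f_def[abs_def])
    ultimately have "AE x in \<nu>. f x = 0"
      by (subst (asm) integral_nonneg_eq_0_iff_AE) (auto simp: f_def)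
    then show ?thesis by eventually_elim (auto simp: f_def max_def min_def split: if_splits)
  qed
  have \<nu>': "prob_on_nonneg \<nu>"
    using nonneg \<nu>(1) by (auto simp: prob_on_nonneg_def real_distribution_def real_distribution_axioms_def)
  moreover have "laplace \<nu> u = g u" if u: "0 < u" for u
  proof -
    \<comment> \<open>\<open>exp (- u * x)\<close> is unbounded on the negative half line; freezing
      it there gives an admissible test function with the same integral.\<close>
    have eq: "integral\<^sup>L K (\<lambda>x. exp (- u * max x 0)) = laplace K u" if K: "prob_on_nonneg K" for K
    proof -
      interpret real_distribution K using K by (rule prob_on_nonneg_real_distribution)
      have "AE x in K. 0 \<le> x" using K by (simp add: prob_on_nonneg_def)
      then have "AE x in K. exp (- u * max x 0) = exp (- u * x)"
        by eventually_elim auto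
      then show ?thesis unfolding laplace_def by (intro integral_cong_AE) auto
    qed
    have "(\<lambda>n. laplace (M (s n)) u) \<longlonglongrightarrow> laplace \<nu> u"
    proof -
      have "isCont (\<lambda>x. exp (- u * max x 0)) x" for x by (intro continuous_intros)
      from conv[OF this] u show ?thesis unfolding eq[OF M] eq[OF \<nu>'] by simp
    qed
    moreover have "(\<lambda>n. laplace (M (s n)) u) \<longlonglongrightarrow> g u"
      using LIMSEQ_subseq_LIMSEQ[OF lim[OF u] s] by (simp add: comp_def)
    ultimately show ?thesis by (rule LIMSEQ_unique)
  qed
  ultimately show ?thesis by auto
qed

section \<open>Point masses, convolutions and convolution powers\<close>

lemma prob_on_nonneg_return: "0 \<le> x \<Longrightarrow> prob_on_nonneg (return borel x)"
  by (auto simp: prob_on_nonneg_def intro!: prob_space_return AE_return[THEN iffD2])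

lemma laplace_return: "laplace (return borel x) u = exp (- u * x)"
  by (simp add: laplace_def integral_return)

lemma
  assumes M: "prob_on_nonneg M" and N: "prob_on_nonneg N"
  shows prob_on_nonneg_convolution: "prob_on_nonneg (M \<star> N)"
    and laplace_convolution: "0 \<le> u \<Longrightarrow> laplace (M \<star> N) u = laplace M u * laplace N u"
proof -
  interpret M: real_distribution M using M by (rule prob_on_nonneg_real_distribution)
  interpret N: real_distribution N using N by (rule prob_on_nonneg_real_distribution)
  interpret MN: pair_prob_space M N ..
  have AE_pair: "AE p in M \<Otimes>\<^sub>M N. 0 \<le> fst p \<and> 0 \<le> snd p"
  proof (rule MN.AE_pair_measure)
    show "{x \<in> space (M \<Otimes>\<^sub>M N). 0 \<le> fst x \<and> 0 \<le> snd x} \<in> sets (M \<Otimes>\<^sub>M N)" by measurable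
    have "AE x in M. 0 \<le> x" "AE y in N. 0 \<le> y" using M N by (auto simp: prob_on_nonneg_def)
    then show "AE x in M. AE y in N. 0 \<le> fst (x, y) \<and> 0 \<le> snd (x, y)"
      by (auto elim!: eventually_mono)
  qed
  then have "AE p in M \<Otimes>\<^sub>M N. 0 \<le> fst p + snd p" by eventually_elim auto
  moreover have plus: "(\<lambda>(x, y). x + y) \<in> M \<Otimes>\<^sub>M N \<rightarrow>\<^sub>M (borel :: real measure)"
    by (subst measurable_cong_sets[OF sets_pair_measure_cong[of M borel N borel] refl]) (simp_all add: case_prod_beta)
  ultimately have "AE x in M \<star> N. 0 \<le> x" unfolding convolution_def
    by (subst AE_distr_iff[OF plus]) (auto simp: case_prod_beta)
  moreover have "prob_space (M \<star> N)" unfolding convolution_def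
    by (rule MN.prob_space_distr[OF plus])
  ultimately show "prob_on_nonneg (M \<star> N)" by (simp add: prob_on_nonneg_def)
  assume u: "0 \<le> u"
  have I: "integrable M (\<lambda>x. exp (- u * x))" "integrable N (\<lambda>x. exp (- u * x))"
    using prob_on_nonneg_integrable_exp u M N by auto
  have "laplace (M \<star> N) u = (\<integral>p. exp (- u * fst p) * exp (- u * snd p) \<partial>(M \<Otimes>\<^sub>M N))"
    unfolding laplace_def convolution_def
    by (subst integral_distr[OF plus]) (auto simp: case_prod_beta exp_add[symmetric] algebra_simps)
  also have "\<dots> = (\<integral>x. \<integral>y. exp (- u * x) * exp (- u * y) \<partial>N \<partial>M)"
  proof (rule MN.integral_fst'[symmetric, of "\<lambda>p. exp (- u * fst p) * exp (- u * snd p)", simplified fst_conv snd_conv])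
    show "integrable (M \<Otimes>\<^sub>M N) (\<lambda>p. exp (- u * fst p) * exp (- u * snd p))"
    proof (rule MN.integrable_const_bound[where B = 1])
      show "AE p in M \<Otimes>\<^sub>M N. norm (exp (- u * fst p) * exp (- u * snd p)) \<le> 1"
        using AE_pair by eventually_elim (use u in \<open>auto intro!: mult_le_one\<close>)
      show "(\<lambda>p. exp (- u * fst p) * exp (- u * snd p)) \<in> borel_measurable (M \<Otimes>\<^sub>M N)"
        by (subst measurable_cong_sets[OF sets_pair_measure_cong[of M borel N borel] refl]) simp_all
    qed
  qed
  also have "\<dots> = laplace M u * laplace N u" using I by (simp add: laplace_def)
  finally show "laplace (M \<star> N) u = laplace M u * laplace N u" .
qed

lemma
  assumes M: "prob_on_nonneg M"
  shows prob_on_nonneg_convolution_power: "prob_on_nonneg (convolution_power n M)"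
    and laplace_convolution_power: "0 \<le> u \<Longrightarrow> laplace (convolution_power n M) u = laplace M u ^ n"
proof -
  have "prob_on_nonneg (convolution_power n M) \<and> (0 \<le> u \<longrightarrow> laplace (convolution_power n M) u = laplace M u ^ n)"
    using M by (induction n)
      (auto simp: convolution_power_def prob_on_nonneg_return laplace_return
         intro: prob_on_nonneg_convolution laplace_convolution[THEN trans])
  then show "prob_on_nonneg (convolution_power n M)"
    "0 \<le> u \<Longrightarrow> laplace (convolution_power n M) u = laplace M u ^ n" by auto
qed

section \<open>Infinitely divisible laws on the half line\<close>

text \<open>The law of \<open>B * Y\<close> with \<open>Y\<close> distributed as
  \<open>\<rho>\<close> and an independent Bernoulli variable \<open>B\<close>: mass
  \<open>1 - p\<close> is moved to 0. Powers of such laws approximate compound Poisson laws.\<close>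

lemma laplace_mixture:
  assumes \<rho>: "prob_on_nonneg \<rho>" and p: "0 \<le> p" "p \<le> 1"
  shows "\<exists>\<nu>. prob_on_nonneg \<nu> \<and> (\<forall>u\<ge>0. laplace \<nu> u = 1 - p * (1 - laplace \<rho> u))"
proof -
  interpret \<rho>: real_distribution \<rho> using \<rho> by (rule prob_on_nonneg_real_distribution)
  define B where "B = measure_pmf (bernoulli_pmf p)"
  interpret B: prob_space B unfolding B_def by (rule measure_pmf.prob_space_axioms)
  interpret pair_prob_space B \<rho> ..
  have sets_eq: "sets (B \<Otimes>\<^sub>M \<rho>) = sets (count_space UNIV \<Otimes>\<^sub>M borel)"
    by (rule sets_pair_measure_cong) (simp_all add: B_def)
  define h :: "bool \<times> real \<Rightarrow> real" where "h = (\<lambda>q. if fst q then snd q else 0)"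
  have h: "h \<in> borel_measurable (B \<Otimes>\<^sub>M \<rho>)"
    unfolding h_def by (subst measurable_cong_sets[OF sets_eq refl]) measurable
  have AE_pair: "AE q in B \<Otimes>\<^sub>M \<rho>. 0 \<le> h q"
  proof (rule AE_pair_measure)
    show "{q \<in> space (B \<Otimes>\<^sub>M \<rho>). 0 \<le> h q} \<in> sets (B \<Otimes>\<^sub>M \<rho>)" using h by measurable
    have "AE x in \<rho>. 0 \<le> x" using \<rho> by (simp add: prob_on_nonneg_def)
    then have "AE y in \<rho>. 0 \<le> h (b, y)" for b
      by eventually_elim (simp add: h_def)
    then show "AE b in B. AE y in \<rho>. 0 \<le> h (b, y)" by simp
  qed
  define \<nu> where "\<nu> = distr (B \<Otimes>\<^sub>M \<rho>) borel h"
  have "prob_on_nonneg \<nu>" unfolding prob_on_nonneg_def \<nu>_def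
    using AE_pair prob_space_distr[OF h] by (simp add: AE_distr_iff[OF h])
  moreover have "laplace \<nu> u = 1 - p * (1 - laplace \<rho> u)" if u: "0 \<le> u" for u
  proof -
    have "laplace \<nu> u = (\<integral>q. exp (- u * h q) \<partial>(B \<Otimes>\<^sub>M \<rho>))"
      unfolding laplace_def \<nu>_def by (subst integral_distr[OF h]) auto
    also have "\<dots> = (\<integral>b. \<integral>y. exp (- u * h (b, y)) \<partial>\<rho> \<partial>B)"
    proof (rule integral_fst'[symmetric])
      show "integrable (B \<Otimes>\<^sub>M \<rho>) (\<lambda>q. exp (- u * h q))"
      proof (rule integrable_const_bound[where B = 1])
        show "AE q in B \<Otimes>\<^sub>M \<rho>. norm (exp (- u * h q)) \<le> 1"
          using AE_pair by eventually_elim (use u in auto)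
      qed (use h in measurable)
    qed
    also have "\<dots> = 1 - p * (1 - laplace \<rho> u)"
      using p \<rho>.prob_space unfolding B_def laplace_def by (simp add: h_def algebra_simps)
    finally show ?thesis .
  qed
  ultimately show ?thesis by auto
qed

text \<open>Continuity of a limit exponent at 0, as \<open>laplace_continuity\<close> demands. For
  \<open>u < 1\<close> the integrand is dominated by the one at \<open>u = 1\<close>.\<close>

lemma tendsto_integral_one_minus_exp:
  assumes Q: "sets Q = sets borel" "AE x in Q. 0 \<le> x"
    and int: "integrable Q (\<lambda>x. 1 - exp (- x))"
  shows "((\<lambda>u. \<integral>x. 1 - exp (- u * x) \<partial>Q) \<longlongrightarrow> 0) (at_right (0::real))"
proof (rule tendsto_at_right_sequentially[where b = 1])
  note [measurable_cong] = Q(1)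
  fix X :: "nat \<Rightarrow> real"
  assume X: "\<And>n. 0 < X n" "\<And>n. X n < 1" "X \<longlonglongrightarrow> 0"
  have "(\<lambda>n. \<integral>x. 1 - exp (- X n * x) \<partial>Q) \<longlonglongrightarrow> (\<integral>x. 0 \<partial>Q)"
  proof (rule integral_dominated_convergence[OF _ _ int])
    show "AE x in Q. (\<lambda>n. 1 - exp (- X n * x)) \<longlonglongrightarrow> 0"
    proof (rule AE_I2)
      fix x
      have "(\<lambda>n. 1 - exp (- X n * x)) \<longlonglongrightarrow> 1 - exp (- 0 * x)" by (intro tendsto_intros X)
      then show "(\<lambda>n. 1 - exp (- X n * x)) \<longlonglongrightarrow> 0" by simp
    qed
    show "AE x in Q. norm (1 - exp (- X n * x)) \<le> 1 - exp (- x)" for n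
      using Q(2)
    proof eventually_elim
      fix x :: real assume x: "0 \<le> x"
      have "X n * x \<le> 1 * x" using X(2)[of n] x by (intro mult_right_mono) auto
      moreover have "0 \<le> X n * x" using X(1)[of n] x by simp
      ultimately show "norm (1 - exp (- X n * x)) \<le> 1 - exp (- x)" by simp
    qed
  qed auto
  then show "(\<lambda>n. \<integral>x. 1 - exp (- X n * x) \<partial>Q) \<longlonglongrightarrow> 0" by simp
qed auto

text \<open>With \<open>Q = l \<rho>\<close> for a probability measure \<open>\<rho>\<close>, the
  transform is the limit of the \<open>n\<close>-th powers of
  \<open>1 - l / n * (1 - laplace \<rho> u)\<close>, each of which is the transform of a convolution
  power of a mixture.\<close>

lemma compound_poisson_exists:
  assumes fin: "finite_measure Q" and Q: "sets Q = sets borel" "AE x in Q. 0 \<le> x"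
  shows "\<exists>\<nu>. prob_on_nonneg \<nu> \<and> (\<forall>u>0. laplace \<nu> u = exp (- (\<integral>x. 1 - exp (- u * x) \<partial>Q)))"
proof -
  interpret Q: finite_measure Q by fact
  note [measurable_cong] = Q(1)
  have int: "integrable Q (\<lambda>x. exp (- u * x))" if "0 \<le> u" for u
    by (rule Q.integrable_const_bound[where B = 1]) (use Q(2) that in \<open>auto elim!: eventually_mono\<close>)
  define l where "l = measure Q (space Q)"
  show ?thesis
  proof (cases "l = 0")
    \<comment> \<open>The zero measure cannot be normalised; the point mass at 0 serves it.\<close>
    case True
    then have "emeasure Q (space Q) = 0" by (simp add: l_def Q.emeasure_eq_measure)
    then have "AE x in Q. False" by (simp add: AE_iff_measurable[OF sets.top])
    from eventually_mono[OF this] have "(\<integral>x. 1 - exp (- u * x) \<partial>Q) = 0" for u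
      by (intro integral_eq_zero_AE) blast
    then show ?thesis
      by (intro exI[of _ "return borel 0"]) (simp add: prob_on_nonneg_return laplace_return)
  next
    case False
    then have l: "l > 0" using measure_nonneg[of Q "space Q"] unfolding l_def by linarith
    define \<rho> where "\<rho> = density Q (\<lambda>_. ennreal (1 / l))"
    have \<rho>: "prob_on_nonneg \<rho>" unfolding prob_on_nonneg_def
    proof (intro conjI)
      show "prob_space \<rho>"
        by (rule prob_spaceI)
          (use l in \<open>simp add: \<rho>_def emeasure_density Q.emeasure_eq_measure l_def[symmetric] ennreal_mult[symmetric]\<close>)
      show "sets \<rho> = sets borel" by (simp add: \<rho>_def Q)
      show "AE x in \<rho>. 0 \<le> x" unfolding \<rho>_def using Q(2)
        by (subst AE_density) (auto elim: eventually_mono)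
    qed
    define c where "c u = (\<integral>x. 1 - exp (- u * x) \<partial>Q)" for u
    have c_eq: "c u = l * (1 - laplace \<rho> u)" if "0 \<le> u" for u
    proof -
      have "laplace \<rho> u = (1 / l) * (\<integral>x. exp (- u * x) \<partial>Q)"
        unfolding laplace_def \<rho>_def using l by (subst integral_real_density) auto
      moreover have "c u = l - (\<integral>x. exp (- u * x) \<partial>Q)"
        unfolding c_def using int[OF that] by (subst Bochner_Integration.integral_diff) (auto simp: l_def)
      ultimately show ?thesis using l by (simp add: field_simps)
    qed
    \<comment> \<open>Starting the sequence after \<open>N\<close> makes
      \<open>l / Suc (n + N)\<close> a legitimate mixing probability.\<close>
    obtain N where N: "real N \<ge> l" using real_arch_simple by blast
    have "\<exists>\<nu>. prob_on_nonneg \<nu> \<and> (\<forall>u\<ge>0. laplace \<nu> u = 1 - l / Suc (n + N) * (1 - laplace \<rho> u))" for n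
      by (rule laplace_mixture[OF \<rho>]) (use l N in auto)
    then obtain \<nu> where \<nu>: "\<And>n. prob_on_nonneg (\<nu> n)"
      and \<nu>_laplace: "\<And>n u. 0 \<le> u \<Longrightarrow> laplace (\<nu> n) u = 1 - l / Suc (n + N) * (1 - laplace \<rho> u)"
      by metis
    show ?thesis
      unfolding c_def[symmetric]
    proof (rule laplace_continuity[where M = "\<lambda>n. convolution_power (Suc (n + N)) (\<nu> n)"])
      show "prob_on_nonneg (convolution_power (Suc (n + N)) (\<nu> n))" for n
        by (intro prob_on_nonneg_convolution_power \<nu>)
      fix u :: real assume u: "0 < u"
      have "laplace (convolution_power (Suc (n + N)) (\<nu> n)) u = (1 + (- c u) / Suc (n + N)) ^ Suc (n + N)" for n
        using u by (subst laplace_convolution_power[OF \<nu>]) (auto simp: \<nu>_laplace c_eq)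
      moreover have "(\<lambda>n. (1 + (- c u) / (n + Suc N)) ^ (n + Suc N)) \<longlonglongrightarrow> exp (- c u)"
        by (rule LIMSEQ_ignore_initial_segment[OF tendsto_exp_limit_sequentially[of "- c u"], of "Suc N", simplified of_nat_add[symmetric]])
      ultimately show "(\<lambda>n. laplace (convolution_power (Suc (n + N)) (\<nu> n)) u) \<longlonglongrightarrow> exp (- c u)"
        by simp
    next
      have "(c \<longlongrightarrow> 0) (at_right 0)" unfolding c_def
        using int[of 1] by (intro tendsto_integral_one_minus_exp Q) auto
      then have "((\<lambda>u. exp (- c u)) \<longlongrightarrow> exp (- 0)) (at_right 0)" by (intro tendsto_intros)
      then show "((\<lambda>u. exp (- c u)) \<longlongrightarrow> 1) (at_right 0)" by simp
    qed
  qed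
qed

text \<open>\<open>Q\<close> may have infinite mass near 0. Its restrictions to
  \<open>x > 1 / Suc n\<close> are finite and give compound Poisson laws; the drift enters as
  convolution with a point mass. A mass of \<open>Q\<close> at 0 is invisible because the integrand
  vanishes there.\<close>

lemma levy_khintchine_exists:
  assumes Q: "sets Q = sets borel" "AE x in Q. 0 \<le> x"
    and int: "\<And>u. 0 < u \<Longrightarrow> integrable Q (\<lambda>x. 1 - exp (- u * x))" and \<gamma>: "0 \<le> \<gamma>"
  shows "\<exists>\<nu>. prob_on_nonneg \<nu> \<and> (\<forall>u>0. laplace \<nu> u = exp (- (u * \<gamma>) - (\<integral>x. 1 - exp (- u * x) \<partial>Q)))"
proof -
  note [measurable_cong] = Q(1)
  define R where "R n = density Q (\<lambda>x. ennreal (indicator {1 / Suc n<..} x))" for n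
  have R_int: "(\<integral>x. 1 - exp (- u * x) \<partial>R n) = (\<integral>x. indicator {1 / Suc n<..} x * (1 - exp (- u * x)) \<partial>Q)" for u n
    unfolding R_def by (subst integral_real_density) auto
  have "\<exists>\<nu>. prob_on_nonneg \<nu> \<and> (\<forall>u>0. laplace \<nu> u = exp (- (\<integral>x. 1 - exp (- u * x) \<partial>R n)))" for n
  proof (rule compound_poisson_exists)
    \<comment> \<open>Lower bound of \<open>1 - exp (- x)\<close> on the restricted range; Markov's
      inequality then bounds the mass.\<close>
    define a where "a = 1 - exp (- (1 / Suc n))"
    have a: "a > 0" by (simp add: a_def)
    have "emeasure (R n) (space (R n)) = (\<integral>\<^sup>+x. indicator {1 / Suc n<..} x \<partial>Q)"
      unfolding R_def by (subst emeasure_density) (auto intro!: nn_integral_cong simp: indicator_def simp del: nn_integral_indicator)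
    also have "\<dots> \<le> (\<integral>\<^sup>+x. ennreal ((1 / a) * norm (1 - exp (- 1 * x))) \<partial>Q)"
    proof (rule nn_integral_mono_AE)
      show "AE x in Q. indicator {1 / real (Suc n)<..} x \<le> ennreal ((1 / a) * norm (1 - exp (- 1 * x)))"
        using Q(2)
      proof eventually_elim
        fix x :: real assume x: "0 \<le> x"
        have "1 \<le> (1 / a) * norm (1 - exp (- 1 * x))" if "x > 1 / Suc n"
        proof -
          have "a \<le> 1 - exp (- x)" using that by (simp add: a_def)
          then show ?thesis using a by (simp add: field_simps)
        qed
        then show "indicator {1 / real (Suc n)<..} x \<le> ennreal ((1 / a) * norm (1 - exp (- 1 * x)))"
          by (auto simp: indicator_def)
      qed
    qed
    also have "\<dots> < \<infinity>"
      using a int[of 1] unfolding integrable_iff_bounded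
      by (subst ennreal_mult) (auto simp: nn_integral_cmult ennreal_mult_less_top)
    finally show "finite_measure (R n)" by (intro finite_measureI) auto
    show "sets (R n) = sets borel" by (simp add: R_def Q)
    show "AE x in R n. 0 \<le> x" unfolding R_def using Q(2)
      by (subst AE_density) (auto elim: eventually_mono)
  qed
  then obtain \<nu> where \<nu>: "\<And>n. prob_on_nonneg (\<nu> n)"
    and \<nu>_laplace: "\<And>n u. 0 < u \<Longrightarrow> laplace (\<nu> n) u = exp (- (\<integral>x. 1 - exp (- u * x) \<partial>R n))"
    by metis
  show ?thesis
  proof (rule laplace_continuity[where M = "\<lambda>n. return borel \<gamma> \<star> \<nu> n"])
    show "prob_on_nonneg (return borel \<gamma> \<star> \<nu> n)" for n
      by (intro prob_on_nonneg_convolution \<nu> prob_on_nonneg_return \<gamma>)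
    fix u :: real assume u: "0 < u"
    have "(\<lambda>n. \<integral>x. indicator {1 / Suc n<..} x * (1 - exp (- u * x)) \<partial>Q) \<longlonglongrightarrow> (\<integral>x. 1 - exp (- u * x) \<partial>Q)"
    proof (rule integral_dominated_convergence[where w = "\<lambda>x. norm (1 - exp (- u * x))"])
      show "AE x in Q. (\<lambda>n. indicator {1 / Suc n<..} x * (1 - exp (- u * x))) \<longlonglongrightarrow> 1 - exp (- u * x)"
        using Q(2)
      proof eventually_elim
        fix x :: real assume x: "0 \<le> x"
        show "(\<lambda>n. indicator {1 / Suc n<..} x * (1 - exp (- u * x))) \<longlonglongrightarrow> 1 - exp (- u * x)"
        proof (cases "x = 0")
          case False
          have "eventually (\<lambda>n. 1 / real (Suc n) < x) sequentially"
            using order_tendstoD(2)[OF LIMSEQ_Suc[OF lim_1_over_n], of x] x False by simp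
          then have "eventually (\<lambda>n. indicator {1 / Suc n<..} x * (1 - exp (- u * x)) = 1 - exp (- u * x)) sequentially"
            by eventually_elim simp
          then show ?thesis by (rule tendsto_eventually)
        qed simp
      qed
      show "AE x in Q. norm (indicator {1 / Suc n<..} x * (1 - exp (- u * x))) \<le> norm (1 - exp (- u * x))" for n
        by (auto simp: indicator_def)
    qed (use int[OF u] in auto)
    then have "(\<lambda>n. exp (- u * \<gamma>) * exp (- (\<integral>x. 1 - exp (- u * x) \<partial>R n)))
        \<longlonglongrightarrow> exp (- u * \<gamma>) * exp (- (\<integral>x. 1 - exp (- u * x) \<partial>Q))"
      unfolding R_int by (intro tendsto_intros)
    then show "(\<lambda>n. laplace (return borel \<gamma> \<star> \<nu> n) u) \<longlonglongrightarrow> exp (- (u * \<gamma>) - (\<integral>x. 1 - exp (- u * x) \<partial>Q))"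
      using u by (simp add: laplace_convolution[OF prob_on_nonneg_return[OF \<gamma>] \<nu>] laplace_return
        \<nu>_laplace exp_add[symmetric])
  next
    have "((\<lambda>u. \<integral>x. 1 - exp (- u * x) \<partial>Q) \<longlongrightarrow> 0) (at_right 0)"
      using int[of 1] by (intro tendsto_integral_one_minus_exp Q) auto
    then have "((\<lambda>u. exp (- (u * \<gamma>) - (\<integral>x. 1 - exp (- u * x) \<partial>Q))) \<longlongrightarrow> exp (- (0 * \<gamma>) - 0)) (at_right 0)"
      by (intro tendsto_intros)
    then show "((\<lambda>u. exp (- (u * \<gamma>) - (\<integral>x. 1 - exp (- u * x) \<partial>Q))) \<longlongrightarrow> 1) (at_right 0)" by simp
  qed
qed

text \<open>The \<open>n\<close>-th root is the law with drift \<open>\<gamma> / n\<close> and Levy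
  measure \<open>Q / n\<close>.\<close>

lemma infinitely_divisible_if_levy_khintchine:
  assumes L: "prob_on_nonneg L"
    and Q: "sets Q = sets borel" "AE x in Q. 0 \<le> x"
    and int: "\<And>u. 0 < u \<Longrightarrow> integrable Q (\<lambda>x. 1 - exp (- u * x))" and \<gamma>: "0 \<le> \<gamma>"
    and eq: "\<And>u. 0 < u \<Longrightarrow> - ln (laplace L u) = u * \<gamma> + (\<integral>x. 1 - exp (- u * x) \<partial>Q)"
  shows "infinitely_divisible L"
  unfolding infinitely_divisible_def
proof (intro allI impI)
  fix n :: nat assume n: "1 \<le> n"
  note [measurable_cong] = Q(1)
  define Qn where "Qn = density Q (\<lambda>_. ennreal (1 / n))"
  have Qn_int: "(\<integral>x. 1 - exp (- u * x) \<partial>Qn) = (1 / n) * (\<integral>x. 1 - exp (- u * x) \<partial>Q)" for u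
    unfolding Qn_def by (subst integral_real_density) auto
  have "\<exists>\<nu>. prob_on_nonneg \<nu> \<and> (\<forall>u>0. laplace \<nu> u = exp (- (u * (\<gamma> / n)) - (\<integral>x. 1 - exp (- u * x) \<partial>Qn)))"
  proof (rule levy_khintchine_exists)
    show "sets Qn = sets borel" by (simp add: Qn_def Q)
    show "AE x in Qn. 0 \<le> x" unfolding Qn_def using Q(2)
      by (subst AE_density) (auto elim: eventually_mono)
    show "integrable Qn (\<lambda>x. 1 - exp (- u * x))" if "0 < u" for u
      unfolding Qn_def using int[OF that] by (subst integrable_real_density) auto
  qed (use \<gamma> in auto)
  then obtain \<nu> where \<nu>: "prob_on_nonneg \<nu>"
    and \<nu>_laplace: "\<And>u. 0 < u \<Longrightarrow> laplace \<nu> u = exp (- (u * (\<gamma> / n)) - (\<integral>x. 1 - exp (- u * x) \<partial>Qn))"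
    by blast
  have "L = convolution_power n \<nu>"
  proof (rule laplace_unique[OF L prob_on_nonneg_convolution_power[OF \<nu>]])
    fix u :: real assume u: "0 < u"
    have "laplace L u = exp (ln (laplace L u))" using laplace_pos[OF L, of u] u by simp
    also have "ln (laplace L u) = - (u * \<gamma>) - (\<integral>x. 1 - exp (- u * x) \<partial>Q)"
      using eq[OF u] by linarith
    also have "exp (- (u * \<gamma>) - (\<integral>x. 1 - exp (- u * x) \<partial>Q)) = laplace \<nu> u ^ n"
      using n unfolding \<nu>_laplace[OF u] Qn_int exp_of_nat_mult[symmetric] by (simp add: algebra_simps)
    also have "\<dots> = laplace (convolution_power n \<nu>) u"
      using u by (simp add: laplace_convolution_power[OF \<nu>])
    finally show "laplace L u = laplace (convolution_power n \<nu>) u" .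
  qed
  then show "\<exists>\<nu>. prob_space \<nu> \<and> sets \<nu> = sets borel \<and> L = convolution_power n \<nu>"
    using \<nu> by (auto simp: prob_on_nonneg_def)
qed

section \<open>Log-concave sequences from renewal equations\<close>

lemma power_mult_exp_le:
  fixes a x :: real
  assumes "0 < a" "0 \<le> x" shows "x ^ n * exp (- a * x) \<le> fact n / a ^ n"
proof -
  have "(\<Sum>k\<in>{n}. (a * x) ^ k /\<^sub>R fact k) \<le> exp (a * x)"
    unfolding exp_def using sum_le_suminf[OF summable_exp_generic[of "a * x"], of "{n}"] assms by simp
  then show ?thesis using assms by (simp add: exp_minus field_simps power_mult_distrib)
qed

lemma
  assumes M: "sets M = sets borel" "AE x in M. 0 \<le> x"
    and int: "\<And>v. 0 < v \<Longrightarrow> integrable M (\<lambda>x. x ^ n * exp (- v * x))" and u: "0 < (u::real)"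
  shows integrable_moment_Suc: "integrable M (\<lambda>x. x ^ Suc n * exp (- u * x))"
    and has_derivative_moment: "((\<lambda>v. \<integral>x. x ^ n * exp (- v * x) \<partial>M) has_real_derivative
       - (\<integral>x. x ^ Suc n * exp (- u * x) \<partial>M)) (at u)"
proof -
  note [measurable_cong] = M(1)
  \<comment> \<open>A dominator for all \<open>v > u / 2\<close>: half of the decay
    \<open>exp (- (u / 2) * x)\<close> absorbs the extra factor \<open>x\<close> at the price
    \<open>4 / u\<close>, the other half keeps the moment of order \<open>n\<close>
    integrable.\<close>
  define g where "g x = 4 / u * (x ^ n * exp (- (u / 4) * x))" for x
  have g: "integrable M g" unfolding g_def using u by (intro integrable_mult_right int) auto
  have bound: "\<bar>x ^ Suc n * exp (- v * x)\<bar> \<le> g x" if x: "0 \<le> x" and v: "u / 2 < v" for v x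
  proof -
    have "x ^ Suc n * exp (- v * x) \<le> x ^ Suc n * exp (- (u / 2) * x)"
      using x mult_right_mono[of "u / 2" v x] v by (intro mult_left_mono) auto
    also have "\<dots> = x ^ n * exp (- (u / 4) * x) * (x ^ 1 * exp (- (u / 4) * x))"
      by (simp add: exp_add[symmetric])
    also have "\<dots> \<le> x ^ n * exp (- (u / 4) * x) * (fact 1 / (u / 4) ^ 1)"
      using x u by (intro mult_left_mono power_mult_exp_le) auto
    finally show ?thesis using x by (simp add: g_def mult_ac)
  qed
  show *: "integrable M (\<lambda>x. x ^ Suc n * exp (- u * x))"
    by (rule Bochner_Integration.integrable_bound[OF g])
       (use M(2) bound[of _ u] u in \<open>auto elim!: eventually_mono simp: order.trans[OF _ abs_ge_self]\<close>)
  have "((\<lambda>v. \<integral>x. x ^ n * exp (- v * x) \<partial>M) has_real_derivative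
       (\<integral>x. - (x ^ Suc n * exp (- u * x)) \<partial>M)) (at u)"
  proof (rule has_real_derivative_integral[where a = "u / 2" and b = "2 * u" and g = g])
    show "AE x in M. \<forall>v\<in>{u / 2<..<2 * u}. ((\<lambda>v. x ^ n * exp (- v * x)) has_real_derivative
         - (x ^ Suc n * exp (- v * x))) (at v) \<and> \<bar>- (x ^ Suc n * exp (- v * x))\<bar> \<le> g x"
      using M(2)
    proof eventually_elim
      fix x :: real assume x: "0 \<le> x"
      show "\<forall>v\<in>{u / 2<..<2 * u}. ((\<lambda>v. x ^ n * exp (- v * x)) has_real_derivative
         - (x ^ Suc n * exp (- v * x))) (at v) \<and> \<bar>- (x ^ Suc n * exp (- v * x))\<bar> \<le> g x"
      proof (intro ballI conjI)
        fix v assume "v \<in> {u / 2<..<2 * u}"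
        then show "\<bar>- (x ^ Suc n * exp (- v * x))\<bar> \<le> g x" using bound[OF x, of v] by simp
        show "((\<lambda>v. x ^ n * exp (- v * x)) has_real_derivative - (x ^ Suc n * exp (- v * x))) (at v)"
          by (auto intro!: derivative_eq_intros)
      qed
    qed
  qed (use u int g in auto)
  then show "((\<lambda>v. \<integral>x. x ^ n * exp (- v * x) \<partial>M) has_real_derivative
       - (\<integral>x. x ^ Suc n * exp (- u * x) \<partial>M)) (at u)" by simp
qed

lemma has_derivative_scaled_moment:
  assumes "((\<lambda>v. \<integral>x. x ^ n * exp (- v * x) \<partial>M) has_real_derivative
       - (\<integral>x. x ^ Suc n * exp (- u * x) \<partial>M)) (at (u::real))"
  shows "((\<lambda>v. (\<integral>x. x ^ n * exp (- v * x) \<partial>M) / fact n) has_real_derivative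
       - (real (Suc n) * ((\<integral>x. x ^ Suc n * exp (- u * x) \<partial>M) / fact (Suc n)))) (at u)"
  by (rule DERIV_cong[OF DERIV_cdivide[OF assms]]) (simp add: field_simps del: of_nat_Suc)

text \<open>The families are \<open>(- 1) ^ n / fact n\<close> times the \<open>n\<close>-th
  derivatives of \<open>w 0\<close> and \<open>p 0\<close>, hence Taylor coefficients up to sign,
  and the sum is the coefficient of order \<open>Suc n\<close> of the constant product 1.\<close>

lemma scaled_Leibniz_vanishes:
  fixes w p :: "nat \<Rightarrow> real \<Rightarrow> real"
  assumes w: "\<And>n u. 0 < u \<Longrightarrow> (w n has_real_derivative - (real (Suc n) * w (Suc n) u)) (at u)"
    and p: "\<And>n u. 0 < u \<Longrightarrow> (p n has_real_derivative - (real (Suc n) * p (Suc n) u)) (at u)"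
    and one: "\<And>u. 0 < u \<Longrightarrow> w 0 u * p 0 u = 1"
    and u: "0 < u"
  shows "(\<Sum>k\<le>Suc n. w (Suc n - k) u * p k u) = 0"
proof -
  define S where "S n u = (\<Sum>k\<le>n. w (n - k) u * p k u)" for n u
  have D: "(S n has_real_derivative - (real (Suc n) * S (Suc n) u)) (at u)" if u: "0 < u" for n u
  proof -
    have "(S n has_real_derivative (\<Sum>k\<le>n. - (real (Suc (n - k)) * w (Suc (n - k)) u) * p k u +
        - (real (Suc k) * p (Suc k) u) * w (n - k) u)) (at u)"
      unfolding S_def
    proof (rule DERIV_sum)
      fix k
      show "((\<lambda>u. w (n - k) u * p k u) has_real_derivative - (real (Suc (n - k)) * w (Suc (n - k)) u) * p k u +
        - (real (Suc k) * p (Suc k) u) * w (n - k) u) (at u)"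
        by (rule DERIV_cong[OF DERIV_mult[OF w[OF u] p[OF u]]]) simp
    qed
    moreover have "(\<Sum>k\<le>n. - (real (Suc (n - k)) * w (Suc (n - k)) u) * p k u +
        - (real (Suc k) * p (Suc k) u) * w (n - k) u) = - (real (Suc n) * S (Suc n) u)"
    proof -
      \<comment> \<open>Differentiating the first factor weights \<open>T k\<close> by
        \<open>Suc n - k\<close>, differentiating the second one, after an index shift, by
        \<open>k\<close>; the weights add up to \<open>Suc n\<close>.\<close>
      define T where "T k = w (Suc n - k) u * p k u" for k
      have "(\<Sum>k\<le>n. real (Suc (n - k)) * w (Suc (n - k)) u * p k u) = (\<Sum>k\<le>n. real (Suc n - k) * T k)"
        by (intro sum.cong) (auto simp: T_def Suc_diff_le)
      also have "\<dots> = (\<Sum>k\<le>Suc n. real (Suc n - k) * T k)" by simp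
      finally have 1: "(\<Sum>k\<le>n. real (Suc (n - k)) * w (Suc (n - k)) u * p k u) = (\<Sum>k\<le>Suc n. real (Suc n - k) * T k)" .
      have 2: "(\<Sum>k\<le>n. real (Suc k) * p (Suc k) u * w (n - k) u) = (\<Sum>k\<le>Suc n. real k * T k)"
        by (subst sum.atMost_Suc_shift) (simp add: T_def mult_ac)
      have "(\<Sum>k\<le>Suc n. real (Suc n - k) * T k) + (\<Sum>k\<le>Suc n. real k * T k) = (\<Sum>k\<le>Suc n. real (Suc n) * T k)"
        unfolding sum.distrib[symmetric] by (intro sum.cong) (auto simp: of_nat_diff algebra_simps)
      also have "\<dots> = real (Suc n) * S (Suc n) u" by (simp only: sum_distrib_left[symmetric] S_def T_def)
      finally show ?thesis using 1 2
        by (simp add: sum.distrib sum_negf sum_subtractf del: of_nat_Suc sum.atMost_Suc)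
    qed
    ultimately show ?thesis by simp
  qed
  have const_zero: "S (Suc n) u = 0" if "\<And>v. 0 < v \<Longrightarrow> S n v = c" "0 < u" for n u c
  proof -
    have "((\<lambda>_. c) has_real_derivative - (real (Suc n) * S (Suc n) u)) (at u)"
      using D[OF \<open>0 < u\<close>, of n]
      by (rule has_field_derivative_transform_within_open[where S = "{0<..}"]) (use that in auto)
    then have "- (real (Suc n) * S (Suc n) u) = 0" using DERIV_unique DERIV_const by blast
    then show ?thesis by simp
  qed
  have "\<forall>u>0. S (Suc n) u = 0"
  proof (induction n)
    case 0 show ?case using const_zero[of 0 1] one by (simp add: S_def)
  next
    case (Suc n) then show ?case using const_zero[of "Suc n" 0] by blast
  qed
  with u show ?thesis by (simp add: S_def)
qed

text \<open>
  A sequence with \<open>\<Sum>\<^sub>k w\<^sub>n\<^sub>-\<^sub>k p\<^sub>k = 0\<close> is the scale function of an upward skip-free random walk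
  (\<open>p\<^sub>0\<close> governs the upward steps, \<open>p\<^sub>k\<close> for \<open>k \<ge> 2\<close> the downward jumps).
  Dividing the recursion by \<open>w\<^sub>n\<close> expresses \<open>w\<^sub>n\<^sub>+\<^sub>1 / w\<^sub>n\<close> through ratios \<open>w\<^sub>i / w\<^sub>n\<close> that grow with \<open>n\<close>
  by the induction hypothesis.
\<close>

lemma renewal_ratio_antimono:
  fixes w p :: "nat \<Rightarrow> real"
  assumes w: "\<And>n. 0 < w n" and p0: "0 < p 0" and p: "\<And>k. 2 \<le> k \<Longrightarrow> 0 \<le> p k"
    and rec: "\<And>n. (\<Sum>k\<le>Suc n. w (Suc n - k) * p k) = 0"
  shows "antimono (\<lambda>n. w (Suc n) / w n)"
proof -
  define r where "r n = w (Suc n) / w n" for n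
  have r_eq: "r n = - (p 1 + (\<Sum>j<n. p (j + 2) * (w (n - Suc j) / w n))) / p 0" for n
  proof -
    have "(\<Sum>k\<le>Suc n. w (Suc n - k) * p k) = w (Suc n) * p 0 + (\<Sum>k\<le>n. w (n - k) * p (Suc k))"
      by (subst sum.atMost_Suc_shift) simp
    also have "(\<Sum>k\<le>n. w (n - k) * p (Suc k)) = w n * p 1 + (\<Sum>j<n. w (n - Suc j) * p (j + 2))"
      unfolding lessThan_Suc_atMost[symmetric] by (subst sum.lessThan_Suc_shift) simp
    finally have "w (Suc n) * p 0 = - (w n * p 1 + (\<Sum>j<n. w (n - Suc j) * p (j + 2)))"
      using rec[of n] by linarith
    then have "r n * p 0 = - (w n * p 1 + (\<Sum>j<n. w (n - Suc j) * p (j + 2))) / w n"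
      by (simp add: r_def)
    also have "\<dots> = - (p 1 + (\<Sum>j<n. w (n - Suc j) * p (j + 2)) / w n)"
      using w[of n] by (simp add: add_divide_distrib diff_divide_distrib)
    also have "(\<Sum>j<n. w (n - Suc j) * p (j + 2)) / w n = (\<Sum>j<n. p (j + 2) * (w (n - Suc j) / w n))"
      unfolding sum_divide_distrib by (simp add: mult.commute)
    finally show ?thesis using p0 by (simp only: eq_divide_eq) simp
  qed
  have step: "r (Suc n) \<le> r n" for n
  proof (induction n rule: less_induct)
    case (less n)
    have "(\<Sum>j<n. p (j + 2) * (w (n - Suc j) / w n)) \<le> (\<Sum>j<n. p (j + 2) * (w (n - j) / w (Suc n)))"
    proof (intro sum_mono mult_left_mono p)
      fix j assume j: "j \<in> {..<n}"
      have "r n \<le> r (n - Suc j)"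
      proof -
        have "r (n - Suc j + i) \<le> r (n - Suc j)" if "i \<le> Suc j" for i
          using that
        proof (induction i)
          case (Suc i)
          have "r (Suc (n - Suc j + i)) \<le> r (n - Suc j + i)" using Suc j by (intro less) auto
          then show ?case using Suc by simp
        qed simp
        from this[of "Suc j"] show ?thesis using j by simp
      qed
      moreover have "Suc (n - Suc j) = n - j" using j by auto
      \<comment> \<open>Cross-multiplication turns the comparison of successive ratios into the
        growth in \<open>n\<close> of the ratios to \<open>w n\<close> at fixed distance
        \<open>j\<close>.\<close>
      ultimately have "w (Suc n) / w n \<le> w (n - j) / w (n - Suc j)" by (simp add: r_def)
      then show "w (n - Suc j) / w n \<le> w (n - j) / w (Suc n)"
        using w[of n] w[of "Suc n"] w[of "n - Suc j"] w[of "n - j"] by (simp add: field_simps)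
    qed auto
    \<comment> \<open>The sum belonging to \<open>Suc n\<close> has one further term, containing
      \<open>p (n + 2) * w 0\<close>, which is nonnegative.\<close>
    also have "\<dots> \<le> (\<Sum>j<Suc n. p (j + 2) * (w (Suc n - Suc j) / w (Suc n)))"
      using p[of "n + 2"] w[of 0] w[of "Suc n"] by (simp add: p)
    finally show ?case using p0 by (subst (1 2) r_eq) (auto simp: divide_right_mono)
  qed
  then have "antimono r" by (simp add: decseq_Suc_iff)
  then show ?thesis by (simp add: r_def[abs_def])
qed

text \<open>Chord slopes of a concave sequence from a common base point decrease: the first
  \<open>k\<close> increments are at least \<open>d k\<close>, the later ones at most
  \<open>d k\<close>. The division-free form includes \<open>k = 0\<close>.\<close>

lemma antimono_increment_slope:
  fixes c :: "nat \<Rightarrow> real"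
  assumes c: "antimono (\<lambda>n. c (Suc n) - c n)" and "k \<le> m"
  shows "real k * (c (n + m) - c n) \<le> real m * (c (n + k) - c n)"
proof -
  define d where "d i = c (Suc (n + i)) - c (n + i)" for i
  have d: "d j \<le> d i" if "i \<le> j" for i j
    using antimonoD[OF c, of "n + i" "n + j"] that by (simp add: d_def)
  have A: "c (n + i) - c n = (\<Sum>j<i. d j)" for i
    using sum_lessThan_telescope[of "\<lambda>j. c (n + j)" i] by (simp add: d_def)
  have low: "real k * d k \<le> (\<Sum>j<k. d j)"
    using sum_bounded_below[of "{..<k}" "d k" d, OF d] by simp
  have "(\<Sum>j<m. d j) = (\<Sum>j<k. d j) + (\<Sum>j=k..<m. d j)"
    using sum.atLeastLessThan_concat[of 0 k m d] \<open>k \<le> m\<close> by (simp add: atLeast0LessThan)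
  also have "(\<Sum>j=k..<m. d j) \<le> real (m - k) * d k"
    using sum_bounded_above[of "{k..<m}" d "d k", OF d] by simp
  finally have le: "(\<Sum>j<m. d j) \<le> (\<Sum>j<k. d j) + real (m - k) * d k" by simp
  have "real k * (\<Sum>j<m. d j) \<le> real k * (\<Sum>j<k. d j) + real (m - k) * (real k * d k)"
    using mult_left_mono[OF le, of "real k"] by (simp add: algebra_simps)
  also have "\<dots> \<le> real k * (\<Sum>j<k. d j) + real (m - k) * (\<Sum>j<k. d j)"
    using low by (intro add_left_mono mult_left_mono) auto
  also have "\<dots> = real m * (\<Sum>j<k. d j)" using \<open>k \<le> m\<close> by (simp add: of_nat_diff algebra_simps)
  finally show ?thesis by (simp add: A)
qed

section \<open>Post-Widder inversion\<close>

lemma has_bochner_integral_erlang_moment: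
  assumes "0 < l"
  shows "has_bochner_integral lborel (\<lambda>x. erlang_density k l x * x ^ i) (fact (k + i) / (fact k * l ^ i))"
proof (rule has_bochner_integral_nn_integral)
  show "AE x in lborel. 0 \<le> erlang_density k l x * x ^ i"
    using assms by (intro AE_I2) (auto simp: erlang_density_def)
qed (use nn_integral_erlang_ith_moment[OF assms, of k i] assms in auto)

lemma
  assumes "0 < l"
  shows integrable_erlang_density: "integrable lborel (erlang_density k l)"
    and integral_erlang_density: "(\<integral>y. erlang_density k l y \<partial>lborel) = 1"
    and integrable_erlang_square: "integrable lborel (\<lambda>y. erlang_density k l y * (y - x)\<^sup>2)"
    and integral_erlang_square: "(\<integral>y. erlang_density k l y * (y - x)\<^sup>2 \<partial>lborel)
      = (real k + 1) * (real k + 2) / l\<^sup>2 - 2 * x * (real k + 1) / l + x\<^sup>2"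
proof -
  have 0: "has_bochner_integral lborel (erlang_density k l) 1"
    using has_bochner_integral_erlang_moment[OF assms, of k 0] by simp
  then show "integrable lborel (erlang_density k l)" "(\<integral>y. erlang_density k l y \<partial>lborel) = 1"
    by (auto simp: has_bochner_integral_iff)
  have 1: "has_bochner_integral lborel (\<lambda>y. erlang_density k l y * y) ((real k + 1) / l)"
    using has_bochner_integral_erlang_moment[OF assms, of k 1] by (simp add: add_ac)
  have 2: "has_bochner_integral lborel (\<lambda>y. erlang_density k l y * y\<^sup>2) ((real k + 1) * (real k + 2) / l\<^sup>2)"
  proof -
    have "fact (k + 2) = fact k * ((real k + 1) * (real k + 2))"
      by (simp add: numeral_2_eq_2 algebra_simps)
    then have "fact (k + 2) / (fact k * l ^ 2) = (real k + 1) * (real k + 2) / l\<^sup>2" by simp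
    with has_bochner_integral_erlang_moment[OF assms, of k 2] show ?thesis by (simp only:)
  qed
  have "has_bochner_integral lborel
      (\<lambda>y. erlang_density k l y * y\<^sup>2 - 2 * x * (erlang_density k l y * y) + x\<^sup>2 * erlang_density k l y)
      ((real k + 1) * (real k + 2) / l\<^sup>2 - 2 * x * ((real k + 1) / l) + x\<^sup>2 * 1)"
    by (intro has_bochner_integral_add has_bochner_integral_diff has_bochner_integral_mult_right 0 1 2)
  also have "(\<lambda>y. erlang_density k l y * y\<^sup>2 - 2 * x * (erlang_density k l y * y) + x\<^sup>2 * erlang_density k l y)
      = (\<lambda>y. erlang_density k l y * (y - x)\<^sup>2)"
    by (auto simp: power2_eq_square algebra_simps)
  finally show "integrable lborel (\<lambda>y. erlang_density k l y * (y - x)\<^sup>2)"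
    "(\<integral>y. erlang_density k l y * (y - x)\<^sup>2 \<partial>lborel)
      = (real k + 1) * (real k + 2) / l\<^sup>2 - 2 * x * (real k + 1) / l + x\<^sup>2"
    by (auto simp: has_bochner_integral_iff)
qed

text \<open>Exponential tilting lowers the rate by one and keeps the shape, so integrals weighted by
  \<open>exp y\<close> are again Erlang moments.\<close>

lemma erlang_density_exp_tilt:
  assumes "1 < l"
  shows "erlang_density k l y * exp y = (l / (l - 1)) ^ Suc k * erlang_density k (l - 1) y"
proof -
  have "exp (- l * y) * exp y = exp (- (l - 1) * y)" by (simp add: exp_add[symmetric] algebra_simps)
  then show ?thesis using assms by (simp add: erlang_density_def power_divide)
qed

text \<open>The Erlang law with shape \<open>n j + 1\<close> and rate \<open>j\<close> has mean
  tending to \<open>x\<close> and variance tending to 0. As \<open>f\<close> may grow like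
  \<open>exp y\<close>, the Chebyshev estimate is carried out with the weight
  \<open>(y - x)\<^sup>2 * exp y\<close>.\<close>

lemma post_widder:
  fixes f :: "real \<Rightarrow> real"
  assumes f: "f \<in> borel_measurable borel" and growth: "\<And>y. 0 \<le> y \<Longrightarrow> \<bar>f y\<bar> \<le> C * exp y"
    and cont: "isCont f x" and x: "0 \<le> x" and n: "(\<lambda>j. real (n j) / real j) \<longlonglongrightarrow> x"
  shows "(\<lambda>j. \<integral>y. erlang_density (n j) (real j) y * f y \<partial>lborel) \<longlonglongrightarrow> f x"
proof -
  \<comment> \<open>The weighted second moment in closed form: the tilting factor times the second
    moment about \<open>x\<close> at rate \<open>j - 1\<close>.\<close>
  define V where "V j = (real j / (real j - 1)) ^ Suc (n j) *
    ((real (n j) + 1) * (real (n j) + 2) / (real j - 1)\<^sup>2 - 2 * x * (real (n j) + 1) / (real j - 1) + x\<^sup>2)" for j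
  have E: "has_bochner_integral lborel (\<lambda>y. erlang_density (n j) (real j) y * ((y - x)\<^sup>2 * exp y)) (V j)"
    if j: "2 \<le> j" for j
  proof -
    have j1: "0 < real j - 1" using j by simp
    have "has_bochner_integral lborel (\<lambda>y. (real j / (real j - 1)) ^ Suc (n j) *
       (erlang_density (n j) (real j - 1) y * (y - x)\<^sup>2)) (V j)"
      unfolding V_def integral_erlang_square[OF j1, symmetric]
      using integrable_erlang_square[OF j1]
      by (intro has_bochner_integral_mult_right has_bochner_integral_integrable)
    also have "(\<lambda>y. (real j / (real j - 1)) ^ Suc (n j) * (erlang_density (n j) (real j - 1) y * (y - x)\<^sup>2))
        = (\<lambda>y. erlang_density (n j) (real j) y * ((y - x)\<^sup>2 * exp y))"
    proof
      fix y
      have "erlang_density (n j) (real j) y * ((y - x)\<^sup>2 * exp y) = (erlang_density (n j) (real j) y * exp y) * (y - x)\<^sup>2"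
        by simp
      also have "erlang_density (n j) (real j) y * exp y = (real j / (real j - 1)) ^ Suc (n j) * erlang_density (n j) (real j - 1) y"
        using j by (intro erlang_density_exp_tilt) auto
      finally show "(real j / (real j - 1)) ^ Suc (n j) * (erlang_density (n j) (real j - 1) y * (y - x)\<^sup>2)
        = erlang_density (n j) (real j) y * ((y - x)\<^sup>2 * exp y)"
        by (simp only: mult.assoc)
    qed
    finally show ?thesis .
  qed
  have V_lim: "V \<longlonglongrightarrow> 0"
  proof -
    have inv: "(\<lambda>j. 1 / real j) \<longlonglongrightarrow> 0" by (rule lim_1_over_n)
    have q: "(\<lambda>j. real j / (real j - 1)) \<longlonglongrightarrow> 1" by real_asymp
    have a: "(\<lambda>j. (real (n j) + c) / (real j - 1)) \<longlonglongrightarrow> x" for c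
    proof -
      have "(\<lambda>j. (real (n j) / real j + c * (1 / real j)) * (real j / (real j - 1))) \<longlonglongrightarrow> (x + c * 0) * 1"
        by (intro tendsto_intros n inv q)
      moreover have "eventually (\<lambda>j. (real (n j) / real j + c * (1 / real j)) * (real j / (real j - 1))
          = (real (n j) + c) / (real j - 1)) sequentially"
        using eventually_gt_at_top[of 1] by eventually_elim (simp add: field_simps)
      ultimately have "(\<lambda>j. (real (n j) + c) / (real j - 1)) \<longlonglongrightarrow> (x + c * 0) * 1"
        by (rule Lim_transform_eventually)
      then show ?thesis by simp
    qed
    have "(\<lambda>j. ((real (n j) + 1) / (real j - 1)) * ((real (n j) + 2) / (real j - 1))
        - 2 * x * ((real (n j) + 1) / (real j - 1)) + x\<^sup>2) \<longlonglongrightarrow> x * x - 2 * x * x + x\<^sup>2"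
      by (intro tendsto_intros a)
    then have quad: "(\<lambda>j. (real (n j) + 1) * (real (n j) + 2) / (real j - 1)\<^sup>2 - 2 * x * (real (n j) + 1) / (real j - 1) + x\<^sup>2)
        \<longlonglongrightarrow> 0"
      by (simp add: power2_eq_square)
    \<comment> \<open>The tilting factor is \<open>(1 + 1 / (j - 1)) ^ Suc (n j)\<close>, at most
      the exponential of \<open>(n j + 1) / (j - 1)\<close>, hence eventually at most
      \<open>exp (x + 1)\<close>.\<close>
    have "eventually (\<lambda>j. (real (n j) + 1) / (real j - 1) < x + 1) sequentially"
      by (rule order_tendstoD(2)[OF a]) simp
    then have "eventually (\<lambda>j. \<bar>(real j / (real j - 1)) ^ Suc (n j)\<bar> \<le> exp (x + 1)) sequentially"
      using eventually_gt_at_top[of 1]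
    proof eventually_elim
      case (elim j)
      have "real j / (real j - 1) = 1 + 1 / (real j - 1)" using elim by (simp add: field_simps)
      also have "\<dots> \<le> exp (1 / (real j - 1))" by (rule exp_ge_add_one_self)
      finally have "(real j / (real j - 1)) ^ Suc (n j) \<le> exp (1 / (real j - 1)) ^ Suc (n j)"
        using elim by (intro power_mono) auto
      also have "\<dots> = exp ((real (n j) + 1) / (real j - 1))"
        by (simp add: exp_of_nat_mult[symmetric] add_ac del: power_Suc)
      also have "\<dots> \<le> exp (x + 1)" using elim by simp
      finally show ?case using elim by (simp del: power_Suc)
    qed
    then have "eventually (\<lambda>j. norm (V j) \<le> exp (x + 1) * \<bar>(real (n j) + 1) * (real (n j) + 2) / (real j - 1)\<^sup>2
        - 2 * x * (real (n j) + 1) / (real j - 1) + x\<^sup>2\<bar>) sequentially"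
      unfolding V_def norm_mult by eventually_elim (auto intro!: mult_right_mono simp del: power_Suc)
    then show ?thesis
      by (rule Lim_null_comparison) (intro tendsto_mult_right_zero tendsto_rabs_zero quad)
  qed
  show ?thesis
  proof (rule LIMSEQ_I)
    fix e :: real assume e: "0 < e"
    obtain d where d: "0 < d" "\<And>y. \<bar>y - x\<bar> < d \<Longrightarrow> \<bar>f y - f x\<bar> < e / 2"
      using cont e unfolding continuous_at_eps_delta by (metis dist_real_def half_gt_zero)
    have C: "0 \<le> C" using growth[of 0] by simp
    \<comment> \<open>At distance at least \<open>d\<close> from \<open>x\<close> the factor
      \<open>(y - x)\<^sup>2 / d\<^sup>2\<close> is at least 1 and pays for both
      \<open>C * exp y\<close> and \<open>\<bar>f x\<bar> * exp y\<close>.\<close>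
    define K where "K = (C + \<bar>f x\<bar>) / d\<^sup>2"
    have K: "0 \<le> K" using C d by (simp add: K_def)
    have bound: "\<bar>f y - f x\<bar> \<le> e / 2 + K * ((y - x)\<^sup>2 * exp y)" if y: "0 \<le> y" for y
    proof (cases "\<bar>y - x\<bar> < d")
      case True then show ?thesis using d(2)[of y] K by (smt (verit) exp_ge_zero mult_nonneg_nonneg zero_le_power2)
    next
      case False
      then have "d\<^sup>2 \<le> \<bar>y - x\<bar>\<^sup>2" using d(1) by (intro power_mono) auto
      then have "1 \<le> (y - x)\<^sup>2 / d\<^sup>2" using d(1) by simp
      have "\<bar>f y - f x\<bar> \<le> C * exp y + \<bar>f x\<bar>" using growth[OF y] by linarith
      also have "\<dots> \<le> C * exp y + \<bar>f x\<bar> * exp y" using y by (simp add: mult_le_cancel_left1)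
      also have "\<dots> = (C + \<bar>f x\<bar>) * exp y * 1" by (simp add: algebra_simps)
      also have "\<dots> \<le> (C + \<bar>f x\<bar>) * exp y * ((y - x)\<^sup>2 / d\<^sup>2)"
        using C \<open>1 \<le> (y - x)\<^sup>2 / d\<^sup>2\<close> by (intro mult_left_mono) auto
      also have "\<dots> = K * ((y - x)\<^sup>2 * exp y)" by (simp add: K_def mult_ac)
      finally show ?thesis using e by simp
    qed
    have "(\<lambda>j. K * V j) \<longlonglongrightarrow> K * 0" by (intro tendsto_intros V_lim)
    from order_tendstoD(2)[OF this, of "e / 2"] e
    have "eventually (\<lambda>j. K * V j < e / 2) sequentially" by simp
    moreover have "eventually (\<lambda>j. 2 \<le> j) sequentially" by (rule eventually_ge_at_top)
    ultimately have "eventually (\<lambda>j. norm ((\<integral>y. erlang_density (n j) (real j) y * f y \<partial>lborel) - f x) < e) sequentially"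
    proof eventually_elim
      case (elim j)
      define D where "D = erlang_density (n j) (real j)"
      have j0: "0 < real j" using elim by simp
      note D_int = integrable_erlang_density[OF j0, of "n j", folded D_def]
      note E_int = E[OF elim(2), folded D_def, THEN integrable.intros]
      have D_nonneg: "0 \<le> D y" for y using j0 by (simp add: D_def)
      have le: "\<bar>D y * (f y - f x)\<bar> \<le> e / 2 * D y + K * (D y * ((y - x)\<^sup>2 * exp y))" for y
      proof (cases "0 \<le> y")
        case True
        have "\<bar>D y * (f y - f x)\<bar> = D y * \<bar>f y - f x\<bar>" using D_nonneg by (simp add: abs_mult)
        also have "\<dots> \<le> D y * (e / 2 + K * ((y - x)\<^sup>2 * exp y))"
          using bound[OF True] D_nonneg by (intro mult_left_mono)
        finally show ?thesis by (simp add: algebra_simps)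
      next
        case False then show ?thesis by (simp add: D_def erlang_density_def)
      qed
      have bnd: "integrable lborel (\<lambda>y. e / 2 * D y + K * (D y * ((y - x)\<^sup>2 * exp y)))"
        by (intro Bochner_Integration.integrable_add integrable_mult_right D_int E_int)
      have diff_int: "integrable lborel (\<lambda>y. D y * (f y - f x))"
        by (rule Bochner_Integration.integrable_bound[OF bnd])
          (use le f in \<open>auto simp: D_def intro!: AE_I2 order.trans[OF _ abs_ge_self]\<close>)
      have "(\<integral>y. D y * f y \<partial>lborel) = (\<integral>y. D y * (f y - f x) + f x * D y \<partial>lborel)"
        by (intro Bochner_Integration.integral_cong) (auto simp: algebra_simps)
      also have "\<dots> = (\<integral>y. D y * (f y - f x) \<partial>lborel) + f x"
        using diff_int D_int integral_erlang_density[OF j0, of "n j", folded D_def]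
        by (subst Bochner_Integration.integral_add) auto
      finally have "(\<integral>y. D y * f y \<partial>lborel) - f x = (\<integral>y. D y * (f y - f x) \<partial>lborel)" by simp
      also have "norm \<dots> \<le> (\<integral>y. \<bar>D y * (f y - f x)\<bar> \<partial>lborel)" by simp
      also have "\<dots> \<le> (\<integral>y. e / 2 * D y + K * (D y * ((y - x)\<^sup>2 * exp y)) \<partial>lborel)"
        using diff_int bnd le by (intro integral_mono) auto
      also have "\<dots> = e / 2 + K * V j"
        using D_int E_int E[OF elim(2), folded D_def, THEN has_bochner_integral_integral_eq]
          integral_erlang_density[OF j0, of "n j", folded D_def]
        by (subst Bochner_Integration.integral_add) auto
      also have "\<dots> < e" using elim by simp
      finally show ?case by (simp add: D_def)
    qed
    then show "\<exists>no. \<forall>j\<ge>no. norm ((\<integral>y. erlang_density (n j) (real j) y * f y \<partial>lborel) - f x) < e"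
      by (simp add: eventually_sequentially)
  qed
qed

section \<open>Scale functions\<close>

text \<open>After multiplication by \<open>1 + t\<close> the left side is at most 1, while the right
  side becomes \<open>1 + t ^ 3\<close>.\<close>

lemma exp_minus_le_quadratic:
  fixes t :: real assumes "0 \<le> t" shows "exp (- t) \<le> 1 - t + t\<^sup>2"
proof -
  have "exp (- t) * (1 + t) \<le> exp (- t) * exp t"
    using exp_ge_add_one_self[of t] by (intro mult_left_mono) auto
  also have "\<dots> = 1" by (simp add: exp_minus)
  also have "1 \<le> (1 - t + t\<^sup>2) * (1 + t)"
    using assms by (simp add: algebra_simps power2_eq_square)
  finally show ?thesis using assms by (simp add: mult_le_cancel_right)
qed

lemma measure_on_pos_AE:
  assumes "measure_on_pos M" shows "AE x in M. 0 < x"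
proof -
  have M: "sets M = sets borel" "emeasure M {..0} = 0" using assms by (auto simp: measure_on_pos_def)
  have sp: "space M = UNIV" using sets_eq_imp_space_eq[OF M(1)] by simp
  have "{x. \<not> 0 < x} = {..(0::real)}" by auto
  then show ?thesis by (subst AE_iff_measurable[where N = "{..0}"]) (auto simp: M sp)
qed

section \<open>The scale function and its moments\<close>

text \<open>\<open>R_neg\<close> does not belong to the notion of scale function; for convergent
  processes it is supplied by \<open>R_negative\<close>.\<close>

locale dual_scale =
  fixes R W :: "real \<Rightarrow> real" and \<alpha> \<beta> :: real and \<mu> :: "real measure"
  assumes R_param: "R_parameters R \<alpha> \<beta> \<mu>"
    and W_scale: "dual_scale_function R W"
    and R_neg: "\<And>u. 0 < u \<Longrightarrow> R u < 0"
begin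

lemma W_nonneg [simp]: "0 \<le> W x"
  and W_neg [simp]: "x < 0 \<Longrightarrow> W x = 0"
  and W_continuous_on: "continuous_on {0..} W"
  and W_mono_on: "mono_on {0..} W"
  using W_scale by (auto simp: dual_scale_function_def)

lemma W_mono: "x \<le> y \<Longrightarrow> W x \<le> W y"
  using W_mono_on[THEN mono_onD, of x y] by (cases "x < 0") auto

lemma W_measurable [measurable]: "W \<in> borel_measurable borel"
  by (rule borel_measurable_mono) (auto simp: mono_def W_mono)

lemma W_isCont: "0 < x \<Longrightarrow> isCont W x"
  using continuous_on_interior[OF W_continuous_on, of x] by simp

lemma exp_W_indicator: "indicator {0..} x *\<^sub>R (exp (- u * x) * W x) = exp (- u * x) * W x"
  by (auto simp: indicator_def)

lemma
  assumes "0 < u"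
  shows W_integrable: "integrable lborel (\<lambda>x. exp (- u * x) * W x)"
    and W_laplace: "(\<integral>x. exp (- u * x) * W x \<partial>lborel) = - 1 / R u"
  using W_scale assms
  unfolding dual_scale_function_def set_integrable_def set_lebesgue_integral_def exp_W_indicator by auto

text \<open>Monotonicity converts the finite Laplace integral at 1 into a pointwise bound: on
  \<open>[y, y + 1]\<close> its integrand is at least \<open>exp (- (y + 1)) * W y\<close>.\<close>

lemma W_growth: "\<exists>C. \<forall>y. W y \<le> C * exp y"
proof (intro exI allI)
  fix y :: real
  define C where "C = (\<integral>x. exp (- 1 * x) * W x \<partial>lborel)"
  have C0: "0 \<le> C" unfolding C_def by (intro integral_nonneg_AE AE_I2) auto
  show "W y \<le> C * exp 1 * exp y"
  proof (cases "0 \<le> y")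
    case True
    have "(\<integral>x. indicator {y..y + 1} x * (exp (- (y + 1)) * W y) \<partial>lborel) \<le> C"
      unfolding C_def
    proof (rule integral_mono)
      show "integrable lborel (\<lambda>x. indicator {y..y + 1} x * (exp (- (y + 1)) * W y))" by simp
      fix x :: real
      show "indicator {y..y + 1} x * (exp (- (y + 1)) * W y) \<le> exp (- 1 * x) * W x"
        by (auto simp: indicator_def intro!: mult_mono W_mono)
    qed (use W_integrable[of 1] in simp)
    then have "exp (- (y + 1)) * W y \<le> C" by simp
    then have "exp (y + 1) * (exp (- (y + 1)) * W y) \<le> exp (y + 1) * C" by (intro mult_left_mono) auto
    then show ?thesis by (simp add: mult.assoc[symmetric] exp_add[symmetric]) (simp add: exp_add mult_ac)
  qed (use C0 in simp)
qed

definition w :: "nat \<Rightarrow> real \<Rightarrow> real" where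
  "w n u = (\<integral>x. x ^ n * exp (- u * x) \<partial>density lborel W) / fact n"

lemma W_density_nonneg: "AE x in density lborel W. 0 \<le> x"
proof (subst AE_density)
  have "0 \<le> x" if "0 < W x" for x using W_neg[of x] that by linarith
  then show "AE x in lborel. 0 < ennreal (W x) \<longrightarrow> 0 \<le> x" by simp
qed simp

lemma W_moment_integrable:
  "0 < u \<Longrightarrow> integrable (density lborel W) (\<lambda>x. x ^ n * exp (- u * x))"
proof (induction n arbitrary: u)
  case 0
  then show ?case using W_integrable[of u]
    by (subst integrable_real_density) (auto simp: mult.commute)
next
  case (Suc n)
  then show ?case
    by (intro integrable_moment_Suc W_density_nonneg) auto
qed

lemma w_integral: "w n u = (\<integral>x. x ^ n * exp (- u * x) * W x \<partial>lborel) / fact n"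
  unfolding w_def by (subst integral_real_density) (auto simp: mult_ac)

lemma w_0: "0 < u \<Longrightarrow> w 0 u = - 1 / R u"
  using W_laplace by (simp add: w_integral)

lemma w_deriv: "0 < u \<Longrightarrow> (w n has_real_derivative - (real (Suc n) * w (Suc n) u)) (at u)"
  unfolding w_def
  by (intro has_derivative_scaled_moment has_derivative_moment W_density_nonneg W_moment_integrable) auto

text \<open>A vanishing moment would force \<open>W = 0\<close> almost everywhere, and then
  \<open>- 1 / R u = 0\<close> although \<open>R u < 0\<close>.\<close>

lemma w_pos: assumes u: "0 < u" shows "0 < w n u"
proof -
  have int: "integrable lborel (\<lambda>x. x ^ n * exp (- u * x) * W x)"
    using W_moment_integrable[OF u, of n] by (subst (asm) integrable_real_density) (auto simp: mult_ac)
  have nonneg: "0 \<le> x ^ n * exp (- u * x) * W x" for x by (cases "x < 0") auto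
  have "(\<integral>x. x ^ n * exp (- u * x) * W x \<partial>lborel) \<noteq> 0"
  proof
    assume "(\<integral>x. x ^ n * exp (- u * x) * W x \<partial>lborel) = 0"
    then have "AE x in lborel. x ^ n * exp (- u * x) * W x = 0"
      using integral_nonneg_eq_0_iff_AE[OF int] nonneg by simp
    moreover have "AE x in lborel. x \<noteq> (0::real)" by (rule AE_lborel_singleton)
    ultimately have "AE x in lborel. exp (- u * x) * W x = 0" by eventually_elim auto
    then have "(\<integral>x. exp (- u * x) * W x \<partial>lborel) = 0" by (rule integral_eq_zero_AE)
    then show False using W_laplace[OF u] R_neg[OF u] by simp
  qed
  moreover have "0 \<le> (\<integral>x. x ^ n * exp (- u * x) * W x \<partial>lborel)"
    using nonneg by (intro integral_nonneg_AE AE_I2)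
  ultimately show ?thesis by (simp add: w_integral)
qed

section \<open>Taylor coefficients of \<open>- R\<close>\<close>

lemma \<alpha>_nonneg: "0 \<le> \<alpha>"
  and \<mu>_sets [measurable_cong]: "sets \<mu> = sets borel"
  and \<mu>_AE: "AE x in \<mu>. 0 < x"
  and \<mu>_integrable: "integrable \<mu> (\<lambda>x. min (x\<^sup>2) 1)"
proof -
  show "0 \<le> \<alpha>" using R_param by (simp add: R_parameters_def)
  have pos: "measure_on_pos \<mu>" using R_param by (simp add: R_parameters_def)
  then show [measurable_cong]: "sets \<mu> = sets borel" by (simp add: measure_on_pos_def)
  show "AE x in \<mu>. 0 < x" using pos by (rule measure_on_pos_AE)
  show "integrable \<mu> (\<lambda>x. min (x\<^sup>2) 1)"
    using R_param by (intro integrableI_nonneg AE_I2) (auto simp: R_parameters_def)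
qed

text \<open>The integrand of \<open>- R\<close> after \<open>n\<close> derivatives in
  \<open>u\<close>, scaled by \<open>(- 1) ^ n / fact n\<close>. The compensator survives only for
  \<open>n \<le> 1\<close>; from \<open>n = 2\<close> on the integrand is nonnegative on the support
  of \<open>\<mu>\<close>.\<close>

definition q :: "nat \<Rightarrow> real \<Rightarrow> real \<Rightarrow> real" where
  "q n u x = (case n of 0 \<Rightarrow> exp (- u * x) - 1 + u * x * indicator {0<..1} x
     | Suc 0 \<Rightarrow> x * exp (- u * x) - x * indicator {0<..1} x
     | _ \<Rightarrow> x ^ n * exp (- u * x) / fact n)"

definition p :: "nat \<Rightarrow> real \<Rightarrow> real" where
  "p n u = (case n of 0 \<Rightarrow> \<alpha> * u\<^sup>2 - \<beta> * u | Suc 0 \<Rightarrow> \<beta> - 2 * \<alpha> * u | Suc (Suc 0) \<Rightarrow> \<alpha> | _ \<Rightarrow> 0)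
     + (\<integral>x. q n u x \<partial>\<mu>)"

lemma q_measurable [measurable]: "q n u \<in> borel_measurable borel"
  unfolding q_def by (auto split: nat.split)

text \<open>Uniformity in \<open>v\<close> is what differentiation under the integral needs. For
  \<open>x \<le> 1\<close> each \<open>q n\<close> is of second order in \<open>x\<close>, with
  constants controlled by \<open>b\<close>; for \<open>x > 1\<close> the exponential with rate above
  \<open>a\<close> keeps it bounded.\<close>

lemma q_bound:
  assumes a: "0 < a"
  shows "\<exists>K. \<forall>v\<in>{a<..<b}. \<forall>x>0. \<bar>q n v x\<bar> \<le> K * min (x\<^sup>2) 1"
proof -
  have min_le: "min (x\<^sup>2) 1 = x\<^sup>2" if "0 < x" "x \<le> 1" for x :: real
    using that by (simp add: power_le_one min_absorb1)
  have min_gt: "min (x\<^sup>2) 1 = 1" if "1 < x" for x :: real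
    using that by (simp add: one_le_power min_absorb2)
  consider "n = 0" | "n = 1" | "2 \<le> n" by linarith
  then show ?thesis
  proof cases
    case 1
    have "\<bar>q n v x\<bar> \<le> (1 + b\<^sup>2) * min (x\<^sup>2) 1" if v: "a < v" "v < b" and x: "0 < x" for v x
    proof (cases "x \<le> 1")
      case True
      have q: "q n v x = exp (- (v * x)) - 1 + v * x" using 1 x True by (simp add: q_def)
      have "1 - v * x \<le> exp (- (v * x))" using exp_ge_add_one_self[of "- (v * x)"] by simp
      moreover have "exp (- (v * x)) \<le> 1 - v * x + (v * x)\<^sup>2"
        using exp_minus_le_quadratic[of "v * x"] a v x by simp
      moreover have "(v * x)\<^sup>2 \<le> (1 + b\<^sup>2) * x\<^sup>2"
      proof -
        have "v\<^sup>2 \<le> b\<^sup>2" using a v by (intro power_mono) auto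
        then show ?thesis unfolding power_mult_distrib by (intro mult_right_mono) (linarith, simp)
      qed
      ultimately show ?thesis unfolding q min_le[OF x True] abs_le_iff by linarith
    next
      case False
      then have q: "q n v x = exp (- (v * x)) - 1" using 1 by (simp add: q_def)
      have "exp (- (v * x)) \<le> 1" using a v x by simp
      moreover have "0 < exp (- (v * x))" by simp
      ultimately have "\<bar>q n v x\<bar> \<le> 1" unfolding q by linarith
      then have "\<bar>q n v x\<bar> \<le> 1 + b\<^sup>2" using zero_le_power2[of b] by linarith
      then show ?thesis using False min_gt[of x] by simp
    qed
    then show ?thesis by (intro exI[of _ "1 + b\<^sup>2"]) auto
  next
    case 2
    have "\<bar>q n v x\<bar> \<le> (b + 1 / a) * min (x\<^sup>2) 1" if v: "a < v" "v < b" and x: "0 < x" for v x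
    proof (cases "x \<le> 1")
      case True
      have q: "\<bar>q n v x\<bar> = x * (1 - exp (- (v * x)))"
        using 2 x True a v by (simp add: q_def algebra_simps)
      have "1 - v * x \<le> exp (- (v * x))" using exp_ge_add_one_self[of "- (v * x)"] by simp
      then have "\<bar>q n v x\<bar> \<le> x * (v * x)" unfolding q using x by (intro mult_left_mono) auto
      also have "\<dots> = v * x\<^sup>2" by (simp add: power2_eq_square)
      also have "\<dots> \<le> (b + 1 / a) * x\<^sup>2"
      proof (rule mult_right_mono)
        show "v \<le> b + 1 / a" using a v by (simp add: add_increasing2)
      qed simp
      finally show ?thesis using min_le[OF x True] by simp
    next
      case False
      have "\<bar>q n v x\<bar> = x ^ 1 * exp (- v * x)" using 2 False x by (simp add: q_def)
      also have "\<dots> \<le> fact 1 / v ^ 1" using a v x by (intro power_mult_exp_le) auto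
      also have "\<dots> \<le> 1 / a" using a v by (simp add: frac_le)
      also have "\<dots> \<le> b + 1 / a" using a v by simp
      finally show ?thesis using False min_gt[of x] by simp
    qed
    then show ?thesis by (intro exI[of _ "b + 1 / a"]) auto
  next
    case 3
    from le_Suc_ex[OF this] obtain m where m: "n = Suc (Suc m)" by auto
    have "\<bar>q n v x\<bar> \<le> (1 + 1 / a ^ n) * min (x\<^sup>2) 1" if v: "a < v" "v < b" and x: "0 < x" for v x
    proof -
      have q: "\<bar>q n v x\<bar> = x ^ n * exp (- v * x) / fact n" using x by (simp add: q_def m)
      have bd: "x ^ n * exp (- v * x) / fact n \<le> 1 / v ^ n"
        using divide_right_mono[OF power_mult_exp_le[of v x n], of "fact n"] a v x by simp
      show ?thesis
      proof (cases "x \<le> 1")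
        case True
        have "x ^ n * exp (- v * x) / fact n \<le> x ^ n * exp (- v * x) / 1"
          using x fact_ge_1[of n] by (intro divide_left_mono) auto
        also have "\<dots> \<le> x ^ n * 1" unfolding div_by_1 using a v x by (intro mult_left_mono) auto
        also have "\<dots> \<le> x\<^sup>2" unfolding mult_1_right using x True 3 by (intro power_decreasing) auto
        also have "\<dots> \<le> (1 + 1 / a ^ n) * x\<^sup>2" using a by (simp add: distrib_right)
        finally show ?thesis unfolding q min_le[OF x True] .
      next
        case False
        note bd
        also have "1 / v ^ n \<le> 1 / a ^ n" using a v by (intro divide_left_mono power_mono) auto
        also have "\<dots> \<le> 1 + 1 / a ^ n" by simp
        finally show ?thesis using False min_gt[of x] unfolding q by simp
      qed
    qed
    then show ?thesis by (intro exI[of _ "1 + 1 / a ^ n"]) auto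
  qed
qed

lemma q_integrable: assumes u: "0 < u" shows "integrable \<mu> (q n u)"
proof -
  obtain K where K: "\<And>v x. v \<in> {u / 2<..<2 * u} \<Longrightarrow> 0 < x \<Longrightarrow> \<bar>q n v x\<bar> \<le> K * min (x\<^sup>2) 1"
    using q_bound[of "u / 2" "2 * u" n] u by (meson half_gt_zero)
  show ?thesis
  proof (rule Bochner_Integration.integrable_bound)
    show "integrable \<mu> (\<lambda>x. K * min (x\<^sup>2) 1)" by (intro integrable_mult_right \<mu>_integrable)
    show "AE x in \<mu>. norm (q n u x) \<le> norm (K * min (x\<^sup>2) 1)"
      using \<mu>_AE by eventually_elim (use K[of u] u in \<open>auto intro: order.trans[OF _ abs_ge_self]\<close>)
  qed measurable
qed

lemma q_deriv: "((\<lambda>u. q n u x) has_real_derivative - (real (Suc n) * q (Suc n) u x)) (at u)"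
proof -
  consider "n = 0" | "n = 1" | m where "n = Suc (Suc m)" by (metis One_nat_def not0_implies_Suc)
  then show ?thesis
  proof cases
    case 1 then show ?thesis unfolding q_def by (auto intro!: derivative_eq_intros)
  next
    case 2 then show ?thesis unfolding q_def by (auto intro!: derivative_eq_intros simp: power2_eq_square)
  next
    case 3 
    have "((\<lambda>u. x ^ n * exp (- u * x) / fact n) has_real_derivative - (real (Suc n) * (x ^ Suc n * exp (- u * x) / fact (Suc n)))) (at u)"
      by (auto intro!: derivative_eq_intros simp: field_simps simp del: of_nat_Suc)
    then show ?thesis using 3 by (simp add: q_def)
  qed
qed

lemma p_deriv: assumes u: "0 < u" shows "(p n has_real_derivative - (real (Suc n) * p (Suc n) u)) (at u)"
proof -
  obtain K where K: "\<And>v x. v \<in> {u / 2<..<2 * u} \<Longrightarrow> 0 < x \<Longrightarrow> \<bar>q (Suc n) v x\<bar> \<le> K * min (x\<^sup>2) 1"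
    using q_bound[of "u / 2" "2 * u" "Suc n"] u by (meson half_gt_zero)
  have "((\<lambda>u. \<integral>x. q n u x \<partial>\<mu>) has_real_derivative (\<integral>x. - (real (Suc n) * q (Suc n) u x) \<partial>\<mu>)) (at u)"
  proof (rule has_real_derivative_integral[where a = "u / 2" and b = "2 * u"])
    show "integrable \<mu> (\<lambda>x. real (Suc n) * (K * min (x\<^sup>2) 1))" by (intro integrable_mult_right \<mu>_integrable)
    show "AE x in \<mu>. \<forall>v\<in>{u / 2<..<2 * u}. ((\<lambda>u. q n u x) has_real_derivative - (real (Suc n) * q (Suc n) v x)) (at v)
        \<and> \<bar>- (real (Suc n) * q (Suc n) v x)\<bar> \<le> real (Suc n) * (K * min (x\<^sup>2) 1)"
      using \<mu>_AE
    proof eventually_elim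
      fix x :: real assume x: "0 < x"
      show "\<forall>v\<in>{u / 2<..<2 * u}. ((\<lambda>u. q n u x) has_real_derivative - (real (Suc n) * q (Suc n) v x)) (at v)
        \<and> \<bar>- (real (Suc n) * q (Suc n) v x)\<bar> \<le> real (Suc n) * (K * min (x\<^sup>2) 1)"
        unfolding abs_minus_cancel abs_mult abs_of_nat
        by (intro ballI conjI q_deriv mult_left_mono K x) auto
    qed
  qed (use u q_integrable in auto)
  then have D: "((\<lambda>u. \<integral>x. q n u x \<partial>\<mu>) has_real_derivative - (real (Suc n) * (\<integral>x. q (Suc n) u x \<partial>\<mu>))) (at u)" by simp
  consider "n = 0" | "n = 1" | "n = 2" | m where "n = Suc (Suc (Suc m))"
    by (metis One_nat_def Suc_1 not0_implies_Suc)
  then show ?thesis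
  proof cases
    case 1 show ?thesis unfolding p_def using D unfolding 1 by (auto intro!: derivative_eq_intros simp: algebra_simps)
  next
    case 2 show ?thesis unfolding p_def using D unfolding 2 by (auto intro!: derivative_eq_intros simp: algebra_simps)
  next
    case 3 show ?thesis unfolding p_def using D unfolding 3 by (auto intro!: derivative_eq_intros simp: numeral_2_eq_2 algebra_simps)
  next
    case 4 show ?thesis unfolding p_def using D unfolding 4 by (auto intro!: derivative_eq_intros)
  qed
qed

lemma p_0: assumes "0 \<le> u" shows "p 0 u = - R u"
proof -
  have "(LINT \<xi>:{0<..}|\<mu>. exp (- u * \<xi>) - 1 + u * \<xi> * indicator {0<..1} \<xi>) = (\<integral>x. q 0 u x \<partial>\<mu>)"
    unfolding set_lebesgue_integral_def
    by (rule integral_cong_AE) (use \<mu>_AE in \<open>auto simp: q_def elim: eventually_mono\<close>)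
  then show ?thesis using R_param assms by (simp add: R_parameters_def p_def)
qed

lemma p_nonneg: "2 \<le> n \<Longrightarrow> 0 \<le> p n u"
proof -
  assume "2 \<le> n"
  from le_Suc_ex[OF this] obtain m where m: "n = Suc (Suc m)" by auto
  have "0 \<le> (\<integral>x. q n u x \<partial>\<mu>)"
    by (rule integral_nonneg_AE) (use \<mu>_AE in \<open>auto simp: q_def m elim!: eventually_mono\<close>)
  then show ?thesis using \<alpha>_nonneg unfolding p_def m by (auto split: nat.split)
qed

lemma w_ratio_antimono: assumes u: "0 < u" shows "antimono (\<lambda>n. w (Suc n) u / w n u)"
proof (rule renewal_ratio_antimono[where p = "\<lambda>n. p n u"])
  show "(\<Sum>k\<le>Suc n. w (Suc n - k) u * p k u) = 0" for n
  proof (rule scaled_Leibniz_vanishes[OF w_deriv p_deriv _ u])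
    show "w 0 u * p 0 u = 1" if "0 < u" for u
      using R_neg[OF that] that by (simp add: w_0 p_0)
  qed
qed (use w_pos[OF u] R_neg[OF u] u in \<open>auto simp: p_0 p_nonneg\<close>)

section \<open>Growth of \<open>R\<close> and positivity of \<open>W\<close>\<close>

lemma R_growth: "\<exists>C. \<forall>u\<ge>1. - R u \<le> C * u\<^sup>2"
proof (intro exI allI impI)
  fix u :: real assume u: "1 \<le> u"
  define I where "I = (\<integral>x. min (x\<^sup>2) 1 \<partial>\<mu>)"
  have uu: "1 \<le> u\<^sup>2" "u \<le> u\<^sup>2"
    using u one_le_power[of u 2] power_increasing[of 1 2 u] by simp_all
  have "(\<integral>x. q 0 u x \<partial>\<mu>) \<le> (\<integral>x. u\<^sup>2 * min (x\<^sup>2) 1 \<partial>\<mu>)"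
  proof (rule integral_mono_AE)
    show "AE x in \<mu>. q 0 u x \<le> u\<^sup>2 * min (x\<^sup>2) 1"
      using \<mu>_AE
    proof eventually_elim
      fix x :: real assume x: "0 < x"
      show "q 0 u x \<le> u\<^sup>2 * min (x\<^sup>2) 1"
      proof (cases "x \<le> 1")
        case True
        have "exp (- (u * x)) \<le> 1 - u * x + (u * x)\<^sup>2"
          using u x by (intro exp_minus_le_quadratic) auto
        moreover have "min (x\<^sup>2) 1 = x\<^sup>2" using x True by (simp add: power_le_one min_absorb1)
        ultimately show ?thesis using x True by (simp add: q_def power_mult_distrib)
      next
        case False
        then have "q 0 u x = exp (- (u * x)) - 1" by (simp add: q_def)
        moreover have "min (x\<^sup>2) 1 = 1" using False by (simp add: one_le_power min_absorb2)
        moreover have "exp (- (u * x)) - 1 \<le> u\<^sup>2"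
        proof -
          have "exp (- (u * x)) \<le> 1" using u x by simp
          with uu show ?thesis by linarith
        qed
        ultimately show ?thesis by simp
      qed
    qed
  qed (use u q_integrable \<mu>_integrable in auto)
  then have "(\<integral>x. q 0 u x \<partial>\<mu>) \<le> u\<^sup>2 * I" by (simp add: I_def)
  moreover have "- \<beta> * u \<le> \<bar>\<beta>\<bar> * u\<^sup>2"
    using uu u mult_mono[of "- \<beta>" "\<bar>\<beta>\<bar>" u "u\<^sup>2"] by auto
  ultimately have "p 0 u \<le> (\<alpha> + \<bar>\<beta>\<bar> + I) * u\<^sup>2" by (simp add: p_def algebra_simps)
  then show "- R u \<le> (\<alpha> + \<bar>\<beta>\<bar> + I) * u\<^sup>2" using u by (simp add: p_0)
qed

text \<open>If \<open>W\<close> vanished up to \<open>x\<close>, its Laplace transform would decay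
  like \<open>exp (- u * x)\<close>, whereas \<open>- 1 / R u\<close> decays at most quadratically
  by \<open>R_growth\<close>.\<close>

lemma W_pos: assumes x: "0 < x" shows "0 < W x"
proof (rule ccontr)
  assume "\<not> 0 < W x"
  then have zero: "W y = 0" if "y \<le> x" for y
    using W_mono[OF that] W_nonneg[of x] W_nonneg[of y] by linarith
  obtain C where C: "\<And>u. 1 \<le> u \<Longrightarrow> - R u \<le> C * u\<^sup>2" using R_growth by blast
  define c where "c = (\<integral>y. exp (- 1 * y) * W y \<partial>lborel)"
  have le: "1 \<le> C * c * (u\<^sup>2 * exp (- (u - 1) * x))" if u: "1 \<le> u" for u
  proof -
    have "(\<integral>y. exp (- u * y) * W y \<partial>lborel) \<le> (\<integral>y. exp (- (u - 1) * x) * (exp (- 1 * y) * W y) \<partial>lborel)"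
    proof (rule integral_mono)
      fix y
      show "exp (- u * y) * W y \<le> exp (- (u - 1) * x) * (exp (- 1 * y) * W y)"
      proof (cases "y \<le> x")
        case False
        then have "(u - 1) * x \<le> (u - 1) * y" using u by (intro mult_left_mono) auto
        then have "exp (- u * y) \<le> exp (- (u - 1) * x) * exp (- 1 * y)"
          unfolding exp_add[symmetric] by (simp add: algebra_simps)
        then have "exp (- u * y) * W y \<le> exp (- (u - 1) * x) * exp (- 1 * y) * W y"
          by (intro mult_right_mono) auto
        then show ?thesis by (simp only: mult.assoc)
      qed (simp add: zero)
    qed (use u W_integrable[of u] W_integrable[of 1] in auto)
    also have "\<dots> = exp (- (u - 1) * x) * c" by (simp only: c_def integral_mult_right_zero)
    finally have "- 1 / R u \<le> exp (- (u - 1) * x) * c" using W_laplace[of u] u by simp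
    moreover have Ru: "R u < 0" using R_neg u by simp
    ultimately have "1 \<le> exp (- (u - 1) * x) * c * (- R u)" by (simp add: field_simps)
    also have "\<dots> \<le> exp (- (u - 1) * x) * c * (C * u\<^sup>2)"
      using C[OF u] by (intro mult_left_mono) (auto simp: c_def intro!: mult_nonneg_nonneg integral_nonneg_AE AE_I2)
    finally show ?thesis by (simp add: mult_ac)
  qed
  have "((\<lambda>u. u\<^sup>2 * exp (- (u - 1) * x)) \<longlongrightarrow> 0) at_top" using x by real_asymp
  then have "((\<lambda>u. C * c * (u\<^sup>2 * exp (- (u - 1) * x))) \<longlongrightarrow> C * c * 0) at_top" by (intro tendsto_intros)
  then have "1 \<le> C * c * 0"
  proof (rule tendsto_lowerbound)
    show "eventually (\<lambda>u. 1 \<le> C * c * (u\<^sup>2 * exp (- (u - 1) * x))) at_top"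
      using eventually_ge_at_top[of "1::real"] by (rule eventually_mono) (rule le)
  qed simp
  then show False by simp
qed

end

section \<open>Log-concavity of \<open>W\<close>\<close>

lemma tendsto_floor_scaled:
  assumes "0 \<le> x" shows "(\<lambda>j. real (nat \<lfloor>x * real j\<rfloor>) / real j) \<longlonglongrightarrow> x"
proof (rule tendsto_sandwich)
  show "\<forall>\<^sub>F j in sequentially. x - 1 / real j \<le> real (nat \<lfloor>x * real j\<rfloor>) / real j"
    using eventually_gt_at_top[of 0]
  proof eventually_elim
    case (elim j)
    have "x * real j - 1 \<le> real (nat \<lfloor>x * real j\<rfloor>)" using assms by linarith
    then have "(x * real j - 1) / real j \<le> real (nat \<lfloor>x * real j\<rfloor>) / real j"
      by (intro divide_right_mono) auto
    then show ?case using elim by (simp add: diff_divide_distrib)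
  qed
  show "\<forall>\<^sub>F j in sequentially. real (nat \<lfloor>x * real j\<rfloor>) / real j \<le> x"
    using eventually_gt_at_top[of 0]
  proof eventually_elim
    case (elim j)
    have "real (nat \<lfloor>x * real j\<rfloor>) \<le> x * real j" using assms by simp
    then show ?case using elim by (simp add: field_simps)
  qed
  have "(\<lambda>j. x - 1 / real j) \<longlonglongrightarrow> x - 0" by (intro tendsto_intros lim_1_over_n)
  then show "(\<lambda>j. x - 1 / real j) \<longlonglongrightarrow> x" by simp
qed simp

context dual_scale
begin

definition erlang_mean :: "nat \<Rightarrow> nat \<Rightarrow> real" where
  "erlang_mean n j = (\<integral>y. erlang_density n (real j) y * W y \<partial>lborel)"

text \<open>The bridge between the renewal equation and the inversion formula: the moment
  \<open>w n\<close>, taken at argument \<open>j\<close>, is an Erlang mean of \<open>W\<close> up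
  to a power of \<open>j\<close>.\<close>

lemma erlang_mean_eq: "erlang_mean n j = real j ^ Suc n * w n (real j)"
proof -
  have "erlang_mean n j = (\<integral>y. real j ^ Suc n / fact n * (y ^ n * exp (- real j * y) * W y) \<partial>lborel)"
    unfolding erlang_mean_def
    by (rule Bochner_Integration.integral_cong) (auto simp: erlang_density_def not_less)
  then show ?thesis by (simp add: w_integral)
qed

lemma erlang_mean_limit:
  assumes "0 < x" "(\<lambda>j. real (n j) / real j) \<longlonglongrightarrow> x"
  shows "(\<lambda>j. erlang_mean (n j) j) \<longlonglongrightarrow> W x"
proof -
  obtain C where C: "\<And>y. W y \<le> C * exp y" using W_growth by blast
  show ?thesis unfolding erlang_mean_def
    using C assms W_isCont by (intro post_widder[where C = C]) auto
qed

definition slope :: "real \<Rightarrow> real \<Rightarrow> real" where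
  "slope x h = (ln (W (x + h)) - ln (W x)) / h"

text \<open>Concavity of \<open>ln W\<close>, inherited from the concave sequences
  \<open>n \<mapsto> ln (erlang_mean n j)\<close> on lattices of mesh \<open>1 / j\<close>.\<close>

lemma slope_antimono:
  assumes x: "0 < x" and h: "0 < h'" "h' \<le> h"
  shows "slope x h \<le> slope x h'"
proof -
  \<comment> \<open>Lattice approximations of the base point \<open>x\<close> and of the two step
    lengths \<open>h'\<close> and \<open>h\<close>.\<close>
  define n where "n j = nat \<lfloor>x * real j\<rfloor>" for j :: nat
  define k where "k j = nat \<lfloor>h' * real j\<rfloor>" for j :: nat
  define m where "m j = nat \<lfloor>h * real j\<rfloor>" for j :: nat
  define c where "c n j = ln (erlang_mean n j)" for n j
  have lim: "(\<lambda>j. real (n j) / real j) \<longlonglongrightarrow> x" "(\<lambda>j. real (k j) / real j) \<longlonglongrightarrow> h'"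
    "(\<lambda>j. real (m j) / real j) \<longlonglongrightarrow> h"
    unfolding n_def k_def m_def using x h tendsto_floor_scaled[of x] tendsto_floor_scaled[of h']
      tendsto_floor_scaled[of h] by simp_all
  have km: "k j \<le> m j" for j
    unfolding k_def m_def using h by (intro nat_mono floor_mono mult_right_mono) auto
  have c: "(\<lambda>j. c (n j) j) \<longlonglongrightarrow> ln (W x)"
    unfolding c_def using x W_pos[OF x] by (intro tendsto_ln erlang_mean_limit lim) auto
  have ck: "(\<lambda>j. c (n j + k j) j) \<longlonglongrightarrow> ln (W (x + h'))"
    unfolding c_def using x h W_pos[of "x + h'"] tendsto_add[OF lim(1,2)]
    by (intro tendsto_ln erlang_mean_limit) (auto simp: add_divide_distrib)
  have cm: "(\<lambda>j. c (n j + m j) j) \<longlonglongrightarrow> ln (W (x + h))"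
    unfolding c_def using x h W_pos[of "x + h"] tendsto_add[OF lim(1,3)]
    by (intro tendsto_ln erlang_mean_limit) (auto simp: add_divide_distrib)
  have "h' * (ln (W (x + h)) - ln (W x)) \<le> h * (ln (W (x + h')) - ln (W x))"
  proof (rule LIMSEQ_le)
    show "(\<lambda>j. real (k j) / real j * (c (n j + m j) j - c (n j) j)) \<longlonglongrightarrow> h' * (ln (W (x + h)) - ln (W x))"
      by (intro tendsto_intros lim c cm)
    show "(\<lambda>j. real (m j) / real j * (c (n j + k j) j - c (n j) j)) \<longlonglongrightarrow> h * (ln (W (x + h')) - ln (W x))"
      by (intro tendsto_intros lim c ck)
    have "real (k j) / real j * (c (n j + m j) j - c (n j) j) \<le> real (m j) / real j * (c (n j + k j) j - c (n j) j)"
      if j: "0 < j" for j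
    proof -
      \<comment> \<open>The power of \<open>j\<close> adds the same constant \<open>ln j\<close> to
        every increment, so the increments decrease along with the ratios of
        \<open>w\<close>.\<close>
      have inc: "c (Suc n) j - c n j = ln (real j * (w (Suc n) (real j) / w n (real j)))" for n
        using j w_pos[of "real j" n] w_pos[of "real j" "Suc n"]
        by (simp add: c_def erlang_mean_eq ln_mult ln_div)
      have "antimono (\<lambda>n. c (Suc n) j - c n j)"
        unfolding inc
      proof (rule antimonoI)
        fix a b :: nat assume "a \<le> b"
        then have "real j * (w (Suc b) (real j) / w b (real j)) \<le> real j * (w (Suc a) (real j) / w a (real j))"
          using j antimonoD[OF w_ratio_antimono[of "real j"], of a b] by (intro mult_left_mono) auto
        moreover have "0 < real j * (w (Suc n) (real j) / w n (real j))" for n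
          using j w_pos[of "real j"] by simp
        ultimately show "ln (real j * (w (Suc b) (real j) / w b (real j)))
            \<le> ln (real j * (w (Suc a) (real j) / w a (real j)))"
          by (simp only: ln_le_cancel_iff)
      qed
      from divide_right_mono[OF antimono_increment_slope[OF this km[of j], of "n j"], of "real j"]
      show ?thesis by simp
    qed
    then show "\<exists>N. \<forall>j\<ge>N. real (k j) / real j * (c (n j + m j) j - c (n j) j)
        \<le> real (m j) / real j * (c (n j + k j) j - c (n j) j)"
      by (intro exI[of _ 1]) auto
  qed
  then show ?thesis using h by (simp add: slope_def field_simps)
qed

text \<open>The chord slope from \<open>y\<close> to \<open>x + h\<close> is a weighted mean of
  those from \<open>y\<close> to \<open>x\<close> and from \<open>x\<close> to \<open>x + h\<close>.
  Since it is at most the former, the latter is at most the former too.\<close>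

lemma slope_le_shift:
  assumes y: "0 < y" "y < x" and h: "0 < h"
  shows "slope x h \<le> slope y (x - y)"
proof -
  define G where "G = ln (W x) - ln (W y)"
  define H where "H = ln (W (x + h)) - ln (W x)"
  have "slope y (x + h - y) \<le> slope y (x - y)" using y h by (intro slope_antimono) auto
  then have "(H + G) / (x - y + h) \<le> G / (x - y)"
    by (simp add: slope_def G_def H_def algebra_simps)
  moreover have "0 < x - y" "0 < x - y + h" using y h by auto
  ultimately have "(H + G) * (x - y) \<le> G * (x - y + h)"
    by (simp add: pos_divide_le_eq pos_le_divide_eq)
  then have "H * (x - y) \<le> G * h" by (simp add: algebra_simps)
  then have "H / h \<le> G / (x - y)" using y h by (simp add: pos_divide_le_eq pos_le_divide_eq mult.commute)
  then show ?thesis by (simp add: slope_def G_def H_def)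
qed

text \<open>One bound for all base points \<open>x \<ge> z\<close>. The comparison chord runs from
  \<open>z / 2\<close> to \<open>z\<close>, away from 0, where \<open>ln W\<close> need not be
  bounded.\<close>

lemma slope_bound:
  assumes z: "0 < z" "z \<le> x" and h: "0 < h"
  shows "slope x h \<le> slope (z / 2) (z / 2)"
proof -
  have "slope x h \<le> slope (z / 2) (x - z / 2)" using z h by (intro slope_le_shift) auto
  also have "\<dots> \<le> slope (z / 2) (z / 2)" using z by (intro slope_antimono) auto
  finally show ?thesis .
qed

text \<open>A local Lipschitz bound, from \<open>1 - exp (- a) \<le> a\<close> for the increment
  \<open>a\<close> of \<open>ln W\<close>. It dominates difference quotients in
  \<open>integral_D\<close> and small jumps in \<open>increment_integrable\<close>.\<close>

lemma W_increment_le: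
  assumes z: "0 < z" "z \<le> x" and h: "0 \<le> h"
  shows "W (x + h) - W x \<le> W (x + h) * (slope (z / 2) (z / 2) * h)"
proof (cases "h = 0")
  case False
  then have h: "0 < h" using assms by simp
  define a where "a = ln (W (x + h)) - ln (W x)"
  have Wx: "0 < W x" "0 < W (x + h)" using z h W_pos by auto
  have "a \<le> slope (z / 2) (z / 2) * h"
    using slope_bound[OF z h] h by (simp add: slope_def a_def pos_divide_le_eq)
  moreover have "W x = W (x + h) * exp (- a)"
    using Wx by (simp add: a_def exp_diff)
  moreover have "1 - exp (- a) \<le> a" using exp_ge_add_one_self[of "- a"] by simp
  ultimately have "1 - exp (- a) \<le> slope (z / 2) (z / 2) * h" by linarith
  then have "W (x + h) * (1 - exp (- a)) \<le> W (x + h) * (slope (z / 2) (z / 2) * h)"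
    using Wx by (intro mult_left_mono) auto
  then show ?thesis using \<open>W x = W (x + h) * exp (- a)\<close> by (simp add: right_diff_distrib)
qed simp

section \<open>The right derivative of \<open>W\<close> and its integral\<close>

text \<open>Chord slopes from \<open>x\<close> are monotone and bounded, so \<open>ln W\<close> has
  a right derivative; the exponential function carries it over to \<open>W\<close>.\<close>

lemma W_right_derivative:
  assumes x: "0 < x" shows "\<exists>d. (W has_real_derivative d) (at_right x)"
proof -
  define l where "l = Inf ((\<lambda>h. - slope x h) ` ({0<..} \<inter> UNIV))"
  have "((\<lambda>h. - slope x h) \<longlongrightarrow> l) (at 0 within ({0<..} \<inter> UNIV))" unfolding l_def
  proof (rule Lim_right_bound)
    show "- slope x a \<le> - slope x b" if "0 < a" "a \<le> b" for a b
      using slope_antimono[OF x] that by simp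
    show "- slope (x / 2) (x / 2) \<le> - slope x a" if "0 < a" for a
      using slope_bound[OF x order.refl that] by simp
  qed
  then have "((\<lambda>h. slope x h) \<longlongrightarrow> - l) (at_right 0)"
    using tendsto_minus[of "\<lambda>h. - slope x h" l "at_right 0"] by simp
  then have "((\<lambda>y. (ln (W y) - ln (W x)) / (y - x)) \<longlongrightarrow> - l) (at_right x)"
    by (subst filterlim_at_right_to_0) (simp add: slope_def[abs_def] add.commute)
  then have g: "((\<lambda>y. ln (W y)) has_real_derivative - l) (at_right x)"
    by (simp add: has_field_derivative_iff)
  have "((\<lambda>y. exp (ln (W y))) has_real_derivative exp (ln (W x)) * (- l)) (at x within {x..})"
    unfolding at_within_Ici_at_right by (rule DERIV_chain2[OF DERIV_exp g])
  then have "(W has_real_derivative exp (ln (W x)) * (- l)) (at x within {x..})"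
  proof (rule has_field_derivative_transform_within[where d = x])
    fix y assume "dist y x < x"
    then have "0 < y" by (simp add: dist_real_def)
    then show "exp (ln (W y)) = W y" using W_pos by simp
  qed (use x in auto)
  then show ?thesis unfolding at_within_Ici_at_right by blast
qed

definition D :: "real \<Rightarrow> real" where "D x = vector_derivative W (at_right x)"

lemma W_differentiable_at_right: "0 < x \<Longrightarrow> W differentiable (at_right x)"
  using W_right_derivative by (metis differentiable_def has_field_derivative_def)

lemma D_deriv: assumes x: "0 < x" shows "(W has_real_derivative D x) (at_right x)"
  using W_differentiable_at_right[OF x]
  by (simp add: D_def vector_derivative_works[symmetric] has_real_derivative_iff_has_vector_derivative)

lemma D_limit: assumes x: "0 < x"
  shows "(\<lambda>n. (W (x + 1 / Suc n) - W x) / (1 / Suc n)) \<longlonglongrightarrow> D x"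
proof -
  have "((\<lambda>y. (W y - W x) / (y - x)) \<longlongrightarrow> D x) (at_right x)"
    using D_deriv[OF x] by (simp add: has_field_derivative_iff)
  then have "((\<lambda>h. (W (x + h) - W x) / h) \<longlongrightarrow> D x) (at_right 0)"
    by (subst (asm) filterlim_at_right_to_0) (simp add: add.commute)
  from tendsto_at_right_of_nat_inverse[OF this] show ?thesis .
qed

lemma D_nonneg: assumes x: "0 < x" shows "0 \<le> D x"
  by (rule LIMSEQ_le_const[OF D_limit[OF x]]) (auto intro!: divide_nonneg_pos simp: W_mono)

lemma D_measurable [measurable]: "(\<lambda>x. indicator {0<..} x * D x) \<in> borel_measurable borel"
proof (rule borel_measurable_LIMSEQ_real)
  fix x :: real
  show "(\<lambda>n. indicator {0<..} x * ((W (x + 1 / Suc n) - W x) / (1 / Suc n))) \<longlonglongrightarrow> indicator {0<..} x * D x"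
    using D_limit[of x] by (cases "0 < x") auto
qed measurable

text \<open>With an antiderivative \<open>G\<close> of \<open>W\<close>, the integral of a
  difference quotient of \<open>W\<close> over \<open>[x,y]\<close> equals the difference of two
  difference quotients of \<open>G\<close>, which tends to \<open>W y - W x\<close>. The Lipschitz
  bound allows the limit under the integral.\<close>

lemma integral_D:
  assumes x: "0 < x" "x \<le> y"
  shows "(\<integral>z. indicator {x..y} z * D z \<partial>lborel) = W y - W x"
    and "integrable lborel (\<lambda>z. indicator {x..y} z * D z)"
proof -
  define h where "h n = 1 / real (Suc n)" for n
  have h: "0 < h n" "h n \<le> 1" for n by (auto simp: h_def)
  have h0: "h \<longlonglongrightarrow> 0" unfolding h_def by (rule LIMSEQ_Suc[OF lim_1_over_n])
  define f where "f n z = indicator {x..y} z * ((W (z + h n) - W z) / h n)" for n z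
  define B where "B = W (y + 1) * slope (x / 2) (x / 2)"
  have meas: "(\<lambda>z. indicator {x..y} z * D z) \<in> borel_measurable lborel"
  proof -
    have "(\<lambda>z. indicator {x..y} z * (indicator {0<..} z * D z)) \<in> borel_measurable lborel" by measurable
    also have "(\<lambda>z. indicator {x..y} z * (indicator {0<..} z * D z)) = (\<lambda>z. indicator {x..y} z * D z)"
      using x by (auto simp: indicator_def)
    finally show ?thesis .
  qed
  have lim: "AE z in lborel. (\<lambda>n. f n z) \<longlonglongrightarrow> indicator {x..y} z * D z"
    using x D_limit by (intro AE_I2) (auto simp: f_def h_def indicator_def)
  have bound: "AE z in lborel. norm (f n z) \<le> indicator {x..y} z * B" for n
  proof (rule AE_I2)
    fix z :: real
    show "norm (f n z) \<le> indicator {x..y} z * B"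
    proof (cases "z \<in> {x..y}")
      case True
      have S: "0 \<le> slope (x / 2) (x / 2)"
        using x W_pos[of x] W_pos[of "x / 2"] W_mono[of "x / 2" x] by (simp add: slope_def)
      have "(W (z + h n) - W z) / h n \<le> W (z + h n) * slope (x / 2) (x / 2)"
        using W_increment_le[of x z "h n"] True x h[of n] by (simp add: pos_divide_le_eq mult.assoc)
      also have "\<dots> \<le> B" unfolding B_def using True h[of n] S by (intro mult_right_mono W_mono) auto
      finally show ?thesis using True W_mono[of z "z + h n"] h[of n] by (simp add: f_def)
    qed (simp add: f_def)
  qed
  have w: "integrable lborel (\<lambda>z. indicator {x..y} z * B)"
    by (intro integrable_mult_left integrable_real_indicator) (auto simp: emeasure_lborel_Icc_eq)
  have fm: "f n \<in> borel_measurable lborel" for n unfolding f_def by measurable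
  show "integrable lborel (\<lambda>z. indicator {x..y} z * D z)"
    by (rule integrable_dominated_convergence[OF meas fm w lim bound])
  have conv: "(\<lambda>n. \<integral>z. f n z \<partial>lborel) \<longlonglongrightarrow> (\<integral>z. indicator {x..y} z * D z \<partial>lborel)"
    by (rule integral_dominated_convergence[OF meas fm w lim bound])
  define G where "G t = integral {0..t} W" for t
  have G: "(G has_real_derivative W t) (at t)" if t: "0 < t" for t
  proof -
    have "(G has_real_derivative W t) (at t within {0..t + 1})"
      unfolding G_def using t
      by (intro integral_has_real_derivative) (auto intro: continuous_on_subset[OF W_continuous_on])
    then show ?thesis using t by (simp add: at_within_Icc_at)
  qed
  have "(\<integral>z. f n z \<partial>lborel) = (G (y + h n) - G y) / h n - (G (x + h n) - G x) / h n" for n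
  proof -
    have "(\<integral>z. ((W (z + h n) - W z) / h n) * indicator {x..y} z \<partial>lborel)
      = (G (y + h n) - G y) / h n - (G (x + h n) - G x) / h n"
    proof (rule integral_FTC_Icc_real[OF x(2)])
      fix z assume z: "x \<le> z" "z \<le> y"
      then have z0: "0 < z" "0 < z + h n" using x h[of n] by auto
      show "((\<lambda>z. (G (z + h n) - G z) / h n) has_real_derivative (W (z + h n) - W z) / h n) (at z)"
        by (intro DERIV_cdivide DERIV_diff G z0 DERIV_shift[THEN iffD1])
      have "isCont (\<lambda>z. W (z + h n)) z"
        by (rule isCont_o2[where g = W and f = "\<lambda>z. z + h n"]) (auto intro: W_isCont z0)
      then show "isCont (\<lambda>z. (W (z + h n) - W z) / h n) z"
        using h[of n] by (intro continuous_intros W_isCont z0) auto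
    qed
    then show ?thesis by (simp add: f_def mult.commute)
  qed
  moreover have "(\<lambda>n. (G (t + h n) - G t) / h n) \<longlonglongrightarrow> W t" if t: "0 < t" for t
  proof -
    have "((\<lambda>k. (G (t + k) - G t) / k) \<longlongrightarrow> W t) (at_right 0)"
      using G[OF t] unfolding DERIV_def by (rule tendsto_within_subset) auto
    from tendsto_at_right_of_nat_inverse[OF this] show ?thesis by (simp add: h_def)
  qed
  ultimately have "(\<lambda>n. \<integral>z. f n z \<partial>lborel) \<longlonglongrightarrow> W y - W x"
    using x by (auto intro!: tendsto_intros)
  with conv show "(\<integral>z. indicator {x..y} z * D z \<partial>lborel) = W y - W x" by (rule LIMSEQ_unique)
qed

text \<open>The Lipschitz bound may degenerate at 0, so \<open>(0,y]\<close> is exhausted by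
  intervals \<open>[y / Suc n, y]\<close>; right continuity of \<open>W\<close> at 0 identifies the
  limit. The jump of size \<open>W 0\<close> at 0 is not seen by \<open>D\<close>.\<close>

lemma nn_integral_D:
  assumes y: "0 \<le> y"
  shows "(\<integral>\<^sup>+z. ennreal (indicator {0<..} z * D z) * indicator {..y} z \<partial>lborel) = ennreal (W y - W 0)"
proof (cases "y = 0")
  case True
  have "(\<integral>\<^sup>+z. ennreal (indicator {0<..} z * D z) * indicator {..0} z \<partial>lborel) = (\<integral>\<^sup>+z. 0 \<partial>(lborel :: real measure))"
    by (intro nn_integral_cong) (auto simp: indicator_def)
  then show ?thesis using True by simp
next
  case False
  then have y: "0 < y" using assms by simp
  define d where "d z = indicator {0<..} z * D z" for z
  have [measurable]: "d \<in> borel_measurable borel" unfolding d_def by measurable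
  define N where "N = density lborel (\<lambda>z. ennreal (d z))"
  have N: "emeasure N {x..y} = ennreal (W y - W x)" if x: "0 < x" "x \<le> y" for x
  proof -
    have "emeasure N {x..y} = (\<integral>\<^sup>+z. ennreal (d z) * indicator {x..y} z \<partial>lborel)"
      unfolding N_def by (subst emeasure_density) auto
    also have "\<dots> = (\<integral>\<^sup>+z. ennreal (indicator {x..y} z * D z) \<partial>lborel)"
      using x by (intro nn_integral_cong) (auto simp: indicator_def d_def)
    also have "\<dots> = ennreal (W y - W x)"
      using x integral_D[OF x] D_nonneg
      by (subst nn_integral_eq_integral) (auto simp: indicator_def intro!: AE_I2)
    finally show ?thesis .
  qed
  define e where "e n = y / real (Suc n)" for n
  have e: "0 < e n" "e n \<le> y" for n using y by (auto simp: e_def field_simps)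
  have e0: "e \<longlonglongrightarrow> 0"
    using tendsto_mult_right_zero[OF LIMSEQ_Suc[OF lim_1_over_n], of y] by (simp add: e_def[abs_def])
  have "(\<lambda>n. emeasure N {e n..y}) \<longlonglongrightarrow> emeasure N (\<Union>n. {e n..y})"
  proof (rule Lim_emeasure_incseq)
    show "incseq (\<lambda>n. {e n..y})"
      using y by (intro incseq_SucI) (auto simp: e_def field_simps intro: order.trans[rotated])
  qed (auto simp: N_def)
  also have "(\<Union>n. {e n..y}) = {0<..y}"
  proof (intro set_eqI iffI)
    fix z assume z: "z \<in> {0<..y}"
    then have "eventually (\<lambda>n. e n < z) sequentially" using order_tendstoD(2)[OF e0] by auto
    then obtain n where "e n < z" by (auto simp: eventually_sequentially)
    then show "z \<in> (\<Union>n. {e n..y})" using z by (auto intro!: exI[of _ n])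
  qed (use e in \<open>auto intro: less_le_trans\<close>)
  finally have 1: "(\<lambda>n. ennreal (W y - W (e n))) \<longlonglongrightarrow> emeasure N {0<..y}" using N e by simp
  have "(W \<longlongrightarrow> W 0) (at 0 within {0..})"
    using W_continuous_on by (simp add: continuous_on)
  then have "(\<lambda>n. W (e n)) \<longlonglongrightarrow> W 0"
  proof (rule filterlim_compose)
    have "e n \<noteq> 0" "0 \<le> e n" for n using e(1)[of n] by auto
    then show "filterlim e (at 0 within {0..}) sequentially" using e0 by (simp add: filterlim_at)
  qed
  then have "(\<lambda>n. ennreal (W y - W (e n))) \<longlonglongrightarrow> ennreal (W y - W 0)"
    by (intro tendsto_intros)
  with 1 have "emeasure N {0<..y} = ennreal (W y - W 0)" by (rule LIMSEQ_unique)
  moreover have "emeasure N {0<..y} = (\<integral>\<^sup>+z. ennreal (d z) * indicator {0<..y} z \<partial>lborel)"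
    unfolding N_def by (subst emeasure_density) auto
  moreover have "\<dots> = (\<integral>\<^sup>+z. ennreal (indicator {0<..} z * D z) * indicator {..y} z \<partial>lborel)"
    by (intro nn_integral_cong) (auto simp: indicator_def d_def)
  ultimately show ?thesis by simp
qed

section \<open>Laplace transform of the right derivative\<close>

lemma nn_laplace_W:
  assumes u: "0 < u"
  shows "(\<integral>\<^sup>+x. ennreal (exp (- u * x) * W x) \<partial>lborel) = ennreal (- 1 / R u)"
  using W_integrable[OF u] W_laplace[OF u]
  by (subst nn_integral_eq_integral) auto

lemma nn_integral_exp_atLeast:
  fixes u c :: real assumes u: "0 < u"
  shows "(\<integral>\<^sup>+x. ennreal (exp (- u * x)) * indicator {c..} x \<partial>lborel) = ennreal (exp (- u * c) / u)"
  by (rule nn_integral_has_integral_lebesgue'[OF _ has_integral_exp_minus_to_infinity[OF u]]) simp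

text \<open>Integration by parts through Tonelli: \<open>W x\<close> is \<open>W 0\<close> plus the
  integral of \<open>D\<close> over \<open>(0,x]\<close>, and exchanging the order gives
  \<open>- 1 / R u = W 0 / u + J / u\<close>.\<close>

lemma nn_laplace_D:
  assumes u: "0 < u"
  shows "(\<integral>\<^sup>+z. ennreal (exp (- u * z) * (indicator {0<..} z * D z)) \<partial>lborel) = ennreal (u / (- R u) - W 0)"
proof -
  define d where "d z = indicator {0<..} z * D z" for z
  have [measurable]: "d \<in> borel_measurable borel" unfolding d_def by measurable
  have d: "0 \<le> d z" for z using D_nonneg by (simp add: d_def indicator_def)
  define J where "J = (\<integral>\<^sup>+z. ennreal (exp (- u * z) * d z) \<partial>lborel)"
  have split: "ennreal (exp (- u * x) * W x) = ennreal (W 0) * (ennreal (exp (- u * x)) * indicator {0..} x)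
      + (\<integral>\<^sup>+z. ennreal (exp (- u * x)) * indicator {z..} x * ennreal (d z) \<partial>lborel)" for x
  proof (cases "0 \<le> x")
    case True
    have "(\<integral>\<^sup>+z. ennreal (exp (- u * x)) * indicator {z..} x * ennreal (d z) \<partial>lborel)
       = (\<integral>\<^sup>+z. ennreal (exp (- u * x)) * (ennreal (d z) * indicator {..x} z) \<partial>lborel)"
      by (intro nn_integral_cong) (auto simp: indicator_def)
    also have "\<dots> = ennreal (exp (- u * x)) * ennreal (W x - W 0)"
      using nn_integral_D[OF True] by (subst nn_integral_cmult) (auto simp: d_def)
    finally show ?thesis
      using True W_mono[OF True] by (simp add: ennreal_mult[symmetric] ennreal_plus[symmetric] algebra_simps del: ennreal_plus)
  next
    case False
    have "(\<integral>\<^sup>+z. ennreal (exp (- u * x)) * indicator {z..} x * ennreal (d z) \<partial>lborel) = (\<integral>\<^sup>+z. 0 \<partial>(lborel :: real measure))"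
      using False by (intro nn_integral_cong) (auto simp: indicator_def d_def)
    then show ?thesis using False by simp
  qed
  have "ennreal (- 1 / R u) = (\<integral>\<^sup>+x. ennreal (W 0) * (ennreal (exp (- u * x)) * indicator {0..} x) \<partial>lborel)
      + (\<integral>\<^sup>+x. \<integral>\<^sup>+z. ennreal (exp (- u * x)) * indicator {z..} x * ennreal (d z) \<partial>lborel \<partial>lborel)"
    unfolding nn_laplace_W[OF u, symmetric] split by (subst nn_integral_add) (auto simp: indicator_def)
  also have "(\<integral>\<^sup>+x. ennreal (W 0) * (ennreal (exp (- u * x)) * indicator {0..} x) \<partial>lborel) = ennreal (W 0 / u)"
    using nn_integral_exp_atLeast[OF u, of 0] u
    by (subst nn_integral_cmult) (auto simp: ennreal_mult[symmetric])
  also have "(\<integral>\<^sup>+x. \<integral>\<^sup>+z. ennreal (exp (- u * x)) * indicator {z..} x * ennreal (d z) \<partial>lborel \<partial>lborel)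
     = (\<integral>\<^sup>+z. \<integral>\<^sup>+x. ennreal (exp (- u * x)) * indicator {z..} x * ennreal (d z) \<partial>lborel \<partial>lborel)"
    by (rule lborel_pair.Fubini'[symmetric]) (auto simp: indicator_def)
  also have "\<dots> = (\<integral>\<^sup>+z. ennreal (1 / u) * ennreal (exp (- u * z) * d z) \<partial>lborel)"
  proof (rule nn_integral_cong)
    fix z
    show "(\<integral>\<^sup>+x. ennreal (exp (- u * x)) * indicator {z..} x * ennreal (d z) \<partial>lborel) = ennreal (1 / u) * ennreal (exp (- u * z) * d z)"
      using nn_integral_exp_atLeast[OF u, of z] u d
      by (subst nn_integral_multc) (auto simp: ennreal_mult[symmetric])
  qed
  also have "\<dots> = ennreal (1 / u) * J" unfolding J_def by (rule nn_integral_cmult) measurable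
  finally have eq: "ennreal (- 1 / R u) = ennreal (W 0 / u) + ennreal (1 / u) * J" .
  \<comment> \<open>Finiteness is read off from the finite left side; only then may the equation be
    solved for \<open>J\<close>.\<close>
  have "J \<noteq> \<infinity>"
  proof
    assume "J = \<infinity>"
    then have "ennreal (- 1 / R u) = \<infinity>" using eq u by (simp add: ennreal_mult_top)
    then show False by simp
  qed
  then obtain r where r: "J = ennreal r" "0 \<le> r" by (cases J) auto
  have "ennreal (- 1 / R u) = ennreal (W 0 / u + 1 / u * r)"
    using eq r u by (simp add: ennreal_mult[symmetric] ennreal_plus[symmetric] del: ennreal_plus)
  moreover have "0 \<le> - 1 / R u" using R_neg[OF u] by (simp add: divide_nonpos_neg)
  ultimately have "- 1 / R u = W 0 / u + 1 / u * r" using u r by (subst (asm) ennreal_inj) auto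
  then have "r = u / (- R u) - W 0" using u R_neg[OF u] by (simp add: field_simps)
  then show ?thesis using r by (simp add: J_def d_def)
qed

end

section \<open>The limit distribution of a CBI-process\<close>

text \<open>The semiflow yields right derivatives only, so the mean value theorem is replaced by a
  last-time argument: after the last \<open>t\<close> with
  \<open>\<bar>f t - f 0\<bar> \<le> e * t\<close> a vanishing right derivative preserves the bound
  a little longer.\<close>

lemma right_derivative_zero_imp_constant:
  fixes f :: "real \<Rightarrow> real"
  assumes cont: "continuous_on {0..} f"
    and deriv: "\<And>t. 0 \<le> t \<Longrightarrow> ((\<lambda>h. f (t + h)) has_real_derivative 0) (at 0 within {0..})"
    and T: "0 \<le> T"
  shows "f T = f 0"
proof (rule ccontr)
  assume neq: "f T \<noteq> f 0"
  then have "0 < T" using T by (cases "T = 0") auto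
  \<comment> \<open>Half the mean slope over \<open>[0,T]\<close>, so that the bound certainly fails
    at \<open>T\<close>.\<close>
  define e where "e = \<bar>f T - f 0\<bar> / (2 * T)"
  have e: "0 < e" using neq \<open>0 < T\<close> by (simp add: e_def)
  define g where "g t = \<bar>f t - f 0\<bar> - e * t" for t
  have "T * \<bar>f T - f 0\<bar> / (2 * T) < \<bar>f T - f 0\<bar>" using neq \<open>0 < T\<close> by simp
  then have gT: "0 < g T" by (simp add: g_def e_def mult.commute)
  have contg: "continuous_on {0..T} g" unfolding g_def
    by (intro continuous_intros continuous_on_subset[OF cont]) auto
  define S where "S = {t \<in> {0..T}. g t \<le> 0}"
  have "closed ({0..T} \<inter> g -` {..0})"
    by (rule continuous_closed_preimage[OF contg]) auto
  from compact_Int_closed[OF compact_Icc this, of 0 T] have "compact S"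
    by (rule back_subst) (auto simp: S_def)
  moreover have "0 \<in> S" using T by (simp add: S_def g_def)
  ultimately obtain a where a: "a \<in> S" "\<And>t. t \<in> S \<Longrightarrow> t \<le> a"
    using compact_attains_sup[of S] by auto
  have aT: "0 \<le> a" "a < T" "g a \<le> 0"
    using a(1) gT by (auto simp: S_def order_less_le)
  have "((\<lambda>h. (f (a + h) - f a) / h) \<longlongrightarrow> 0) (at 0 within {0..})"
    using deriv[OF aT(1)] by (simp add: has_field_derivative_iff)
  from tendstoD[OF this e] obtain d where d: "0 < d"
    "\<And>h. 0 < h \<Longrightarrow> h < d \<Longrightarrow> \<bar>(f (a + h) - f a) / h\<bar> < e"
    unfolding eventually_at by (auto simp: dist_real_def)
  define h where "h = min (d / 2) (T - a)"
  have h: "0 < h" "h < d" "a + h \<le> T" using d aT by (auto simp: h_def)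
  have "\<bar>f (a + h) - f a\<bar> \<le> e * h"
    using d(2)[OF h(1,2)] h by (simp add: pos_divide_less_eq less_imp_le)
  then have "g (a + h) \<le> g a" by (simp add: g_def algebra_simps)
  then have "a + h \<in> S" using aT h by (simp add: S_def)
  then show False using a(2)[of "a + h"] h by simp
qed

section \<open>The exponents as a semiflow\<close>

locale convergent_CBI =
  fixes \<Omega> :: "'w measure" and P :: "real \<Rightarrow> 'w measure" and X :: "real \<Rightarrow> 'w \<Rightarrow> real"
    and F R :: "real \<Rightarrow> real" and \<phi> \<psi> :: "real \<Rightarrow> real \<Rightarrow> real" and L :: "real measure"
  assumes markov: "markov_process \<Omega> P X"
    and stoch_cont: "stochastically_continuous \<Omega> P X"
    and affine: "affine_exponents P X \<phi> \<psi>"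
    and F_deriv: "\<And>u. 0 \<le> u \<Longrightarrow> ((\<lambda>t. \<phi> t u) has_real_derivative F u) (at 0 within {0..})"
    and R_deriv: "\<And>u. 0 \<le> u \<Longrightarrow> ((\<lambda>t. \<psi> t u) has_real_derivative R u) (at 0 within {0..})"
    and limit: "limit_distribution P X L"
begin

lemma P_prob: "0 \<le> x \<Longrightarrow> prob_space (P x)"
  and P_sets: "0 \<le> x \<Longrightarrow> sets (P x) = sets \<Omega>"
  and X_measurable: "0 \<le> t \<Longrightarrow> X t \<in> borel_measurable \<Omega>"
  and X_nonneg: "0 \<le> t \<Longrightarrow> \<omega> \<in> space \<Omega> \<Longrightarrow> 0 \<le> X t \<omega>"
  and X_0: "0 \<le> x \<Longrightarrow> AE \<omega> in P x. X 0 \<omega> = x"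
  and law_kernel: "0 \<le> t \<Longrightarrow> law P X t \<in> restrict_space borel {0..} \<rightarrow>\<^sub>M prob_algebra borel"
  using markov by (auto simp: markov_process_def)

lemma P_space: "0 \<le> x \<Longrightarrow> space (P x) = space \<Omega>"
  using P_sets by (rule sets_eq_imp_space_eq)

lemma X_measurable_P: "0 \<le> x \<Longrightarrow> 0 \<le> t \<Longrightarrow> X t \<in> borel_measurable (P x)"
  using X_measurable P_sets by (simp cong: measurable_cong_sets)

lemma law_nonneg:
  assumes "0 \<le> x" "0 \<le> t" shows "prob_on_nonneg (law P X t x)"
proof -
  interpret prob_space "P x" using P_prob assms by simp
  note m = X_measurable_P[OF assms]
  show ?thesis unfolding prob_on_nonneg_def law_def
    using prob_space_distr[OF m] assms X_nonneg by (auto simp: AE_distr_iff[OF m] P_space)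
qed

lemma laplace_law:
  assumes "0 \<le> x" "0 \<le> t" "0 \<le> u" shows "laplace (law P X t x) u = exp (- (\<phi> t u + x * \<psi> t u))"
proof -
  have "laplace (law P X t x) u = (\<integral>\<omega>. exp (- u * X t \<omega>) \<partial>P x)"
    unfolding laplace_def law_def by (subst integral_distr[OF X_measurable_P]) (use assms in auto)
  moreover have "- ln (\<integral>\<omega>. exp (- u * X t \<omega>) \<partial>P x) = \<phi> t u + x * \<psi> t u"
    using affine assms by (simp add: affine_exponents_def)
  moreover have "0 < laplace (law P X t x) u"
    using laplace_pos[OF law_nonneg] assms by simp
  ultimately show ?thesis by (metis exp_ln minus_minus)
qed

text \<open>An affine function of \<open>x\<close> that is nonnegative on the half line has
  nonnegative coefficients. This makes \<open>\<psi> t u\<close> admissible as a new Laplace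
  argument.\<close>

lemma exponents_nonneg:
  assumes "0 \<le> t" "0 \<le> u" shows "0 \<le> \<phi> t u" "0 \<le> \<psi> t u"
proof -
  have le: "0 \<le> \<phi> t u + x * \<psi> t u" if "0 \<le> x" for x
    using laplace_le_1[OF law_nonneg, of x t u] laplace_law[of x t u] that assms by simp
  show "0 \<le> \<phi> t u" using le[of 0] by simp
  show "0 \<le> \<psi> t u"
  proof (rule ccontr)
    assume neg: "\<not> 0 \<le> \<psi> t u"
    \<comment> \<open>At this starting point the exponent would be \<open>-1\<close>.\<close>
    define x where "x = (\<phi> t u + 1) / (- \<psi> t u)"
    have "0 \<le> x" unfolding x_def using neg le[of 0] by (intro divide_nonneg_pos) auto
    moreover have "x * \<psi> t u = - (\<phi> t u + 1)" using neg by (simp add: x_def field_simps)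
    ultimately show False using le[of x] by simp
  qed
qed

lemma initial: assumes "0 \<le> u" shows "\<phi> 0 u = 0" "\<psi> 0 u = u"
proof -
  have *: "\<phi> 0 u + x * \<psi> 0 u = u * x" if x: "0 \<le> x" for x
  proof -
    interpret prob_space "P x" using P_prob x by simp
    have "laplace (law P X 0 x) u = (\<integral>\<omega>. exp (- u * X 0 \<omega>) \<partial>P x)"
      unfolding laplace_def law_def by (subst integral_distr[OF X_measurable_P]) (use x in auto)
    also have "\<dots> = (\<integral>\<omega>. exp (- u * x) \<partial>P x)"
      using X_measurable_P[OF x] by (intro integral_cong_AE eventually_mono[OF X_0[OF x]]) auto
    finally show ?thesis using laplace_law[OF x _ assms, of 0] prob_space by simp
  qed
  show "\<phi> 0 u = 0" using *[of 0] by simp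
  then show "\<psi> 0 u = u" using *[of 1] by simp
qed

text \<open>Expectation of the Markov property: the conditional probability given the past up to
  \<open>s\<close> integrates to the unconditional one.\<close>

lemma chapman_kolmogorov:
  assumes x: "0 \<le> x" and s: "0 \<le> s" and t: "0 \<le> t"
  shows "law P X (s + t) x = P x \<bind> (\<lambda>\<omega>. law P X t (X s \<omega>))"
    and "(\<lambda>\<omega>. law P X t (X s \<omega>)) \<in> P x \<rightarrow>\<^sub>M subprob_algebra borel"
proof -
  interpret prob_space "P x" using P_prob x by simp
  have Xr: "X s \<in> P x \<rightarrow>\<^sub>M restrict_space borel {0..}"
    using X_nonneg[OF s] by (intro measurable_restrict_space2 X_measurable_P x s) (auto simp: P_space x)
  have K: "(\<lambda>\<omega>. law P X t (X s \<omega>)) \<in> P x \<rightarrow>\<^sub>M prob_algebra borel"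
    by (rule measurable_compose[OF Xr law_kernel[OF t]])
  then show K': "(\<lambda>\<omega>. law P X t (X s \<omega>)) \<in> P x \<rightarrow>\<^sub>M subprob_algebra borel"
    by (rule measurable_prob_algebraD)
  have sub: "subalgebra (P x) (natural_filtration \<Omega> X s)"
  proof -
    have "sigma_sets (space \<Omega>) {X r -` A \<inter> space \<Omega> |r A. 0 \<le> r \<and> r \<le> s \<and> A \<in> sets borel} \<subseteq> sets \<Omega>"
      using X_measurable by (intro sets.sigma_sets_subset) (auto dest: measurable_sets)
    then show ?thesis
      unfolding subalgebra_def natural_filtration_def
      by (subst sets_measure_of) (auto simp: P_space x P_sets space_measure_of_conv)
  qed
  interpret finite_measure_subalgebra "P x" "natural_filtration \<Omega> X s"
    by unfold_locales (rule sub)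
  note m = X_measurable_P[OF x add_nonneg_nonneg[OF s t]]
  show "law P X (s + t) x = P x \<bind> (\<lambda>\<omega>. law P X t (X s \<omega>))"
  proof (rule measure_eqI)
    show "sets (law P X (s + t) x) = sets (P x \<bind> (\<lambda>\<omega>. law P X t (X s \<omega>)))"
      using sets_bind[OF sets_kernel[OF K'] not_empty] by (simp add: law_def)
    fix A assume "A \<in> sets (law P X (s + t) x)"
    then have A: "A \<in> sets borel" by (simp add: law_def)
    have iA: "(\<lambda>\<omega>. indicator A (X (s + t) \<omega>) :: real) \<in> borel_measurable (P x)"
      using A m by measurable
    have intA: "integrable (P x) (\<lambda>\<omega>. indicator A (X (s + t) \<omega>) :: real)"
      using iA by (intro integrable_const_bound[where B = 1]) auto
    have ce: "AE \<omega> in P x. real_cond_exp (P x) (natural_filtration \<Omega> X s) (\<lambda>\<omega>'. indicator A (X (s + t) \<omega>')) \<omega>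
        = measure (law P X t (X s \<omega>)) A"
      using markov x s t A unfolding markov_process_def by blast
    have mm: "(\<lambda>\<omega>. measure (law P X t (X s \<omega>)) A) \<in> borel_measurable (P x)"
      by (rule measurable_compose[OF K' measurable_measure_subprob_algebra[OF A]])
    have "ennreal (measure (law P X (s + t) x) A) = ennreal (\<integral>\<omega>. indicator A (X (s + t) \<omega>) \<partial>P x)"
    proof -
      have "measure (law P X (s + t) x) A = measure (P x) (X (s + t) -` A \<inter> space (P x))"
        unfolding law_def using A m by (subst measure_distr) auto
      also have "\<dots> = (\<integral>\<omega>. indicator (X (s + t) -` A \<inter> space (P x)) \<omega> \<partial>P x)"
        using measurable_sets[OF m A] by simp
      also have "\<dots> = (\<integral>\<omega>. indicator A (X (s + t) \<omega>) \<partial>P x)"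
        by (intro Bochner_Integration.integral_cong) (auto simp: indicator_def)
      finally show ?thesis by simp
    qed
    also have "(\<integral>\<omega>. indicator A (X (s + t) \<omega>) \<partial>P x)
       = (\<integral>\<omega>. real_cond_exp (P x) (natural_filtration \<Omega> X s) (\<lambda>\<omega>'. indicator A (X (s + t) \<omega>')) \<omega> \<partial>P x)"
      using real_cond_exp_intg(2)[of "\<lambda>_. 1" "\<lambda>\<omega>'. indicator A (X (s + t) \<omega>')"] intA iA by simp
    also have "\<dots> = (\<integral>\<omega>. measure (law P X t (X s \<omega>)) A \<partial>P x)"
      using ce mm by (intro integral_cong_AE) (auto intro: borel_measurable_cond_exp2)
    also have "ennreal \<dots> = (\<integral>\<^sup>+\<omega>. ennreal (measure (law P X t (X s \<omega>)) A) \<partial>P x)"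
    proof (rule nn_integral_eq_integral[symmetric])
      show "integrable (P x) (\<lambda>\<omega>. measure (law P X t (X s \<omega>)) A)"
      proof (rule integrable_const_bound[where B = 1])
        show "AE \<omega> in P x. norm (measure (law P X t (X s \<omega>)) A) \<le> 1"
          using law_nonneg[OF X_nonneg[OF s] t] prob_space.prob_le_1
          by (intro AE_I2) (auto simp: P_space x prob_on_nonneg_def)
      qed (rule mm)
    qed auto
    also have "\<dots> = (\<integral>\<^sup>+\<omega>. emeasure (law P X t (X s \<omega>)) A \<partial>P x)"
    proof (rule nn_integral_cong)
      fix \<omega> assume "\<omega> \<in> space (P x)"
      then interpret l: prob_space "law P X t (X s \<omega>)"
        using law_nonneg[OF X_nonneg[OF s] t] by (auto simp: P_space x prob_on_nonneg_def)
      show "ennreal (measure (law P X t (X s \<omega>)) A) = emeasure (law P X t (X s \<omega>)) A"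
        by (simp add: l.emeasure_eq_measure)
    qed
    also have "\<dots> = emeasure (P x \<bind> (\<lambda>\<omega>. law P X t (X s \<omega>))) A"
      by (rule emeasure_bind[symmetric, OF not_empty K' A])
    finally show "emeasure (law P X (s + t) x) A = emeasure (P x \<bind> (\<lambda>\<omega>. law P X t (X s \<omega>))) A"
    proof -
      interpret l: prob_space "law P X (s + t) x"
        using law_nonneg[OF x, of "s + t"] s t by (auto simp: prob_on_nonneg_def)
      assume "ennreal (measure (law P X (s + t) x) A) = emeasure (P x \<bind> (\<lambda>\<omega>. law P X t (X s \<omega>))) A"
      then show ?thesis by (simp add: l.emeasure_eq_measure)
    qed
  qed
qed

lemma ennreal_laplace:
  assumes M: "prob_on_nonneg M" and u: "0 \<le> u"
  shows "(\<integral>\<^sup>+y. ennreal (exp (- u * y)) \<partial>M) = ennreal (laplace M u)"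
  unfolding laplace_def by (rule nn_integral_eq_integral[OF prob_on_nonneg_integrable_exp[OF M u]]) simp

text \<open>Laplace transform of the Chapman-Kolmogorov equation. Both sides are affine in the
  starting point, and the points 0 and 1 separate the coefficients.\<close>

lemma semiflow:
  assumes s: "0 \<le> s" and t: "0 \<le> t" and u: "0 \<le> u"
  shows "\<phi> (s + t) u = \<phi> t u + \<phi> s (\<psi> t u)" "\<psi> (s + t) u = \<psi> s (\<psi> t u)"
proof -
  have *: "\<phi> (s + t) u + x * \<psi> (s + t) u = \<phi> t u + (\<phi> s (\<psi> t u) + x * \<psi> s (\<psi> t u))" if x: "0 \<le> x" for x
  proof -
    note m = X_measurable_P[OF x s]
    have "ennreal (laplace (law P X (s + t) x) u) = (\<integral>\<^sup>+y. ennreal (exp (- u * y)) \<partial>law P X (s + t) x)"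
      using s t x u by (intro ennreal_laplace[symmetric] law_nonneg) auto
    also have "\<dots> = (\<integral>\<^sup>+\<omega>. \<integral>\<^sup>+y. ennreal (exp (- u * y)) \<partial>law P X t (X s \<omega>) \<partial>P x)"
      unfolding chapman_kolmogorov(1)[OF x s t]
      by (rule nn_integral_bind[OF _ chapman_kolmogorov(2)[OF x s t]]) measurable
    also have "\<dots> = (\<integral>\<^sup>+\<omega>. ennreal (exp (- \<phi> t u)) * ennreal (exp (- \<psi> t u * X s \<omega>)) \<partial>P x)"
    proof (rule nn_integral_cong)
      fix \<omega> assume "\<omega> \<in> space (P x)"
      then have X: "0 \<le> X s \<omega>" using X_nonneg[OF s] by (simp add: P_space x)
      show "(\<integral>\<^sup>+y. ennreal (exp (- u * y)) \<partial>law P X t (X s \<omega>)) = ennreal (exp (- \<phi> t u)) * ennreal (exp (- \<psi> t u * X s \<omega>))"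
        unfolding ennreal_laplace[OF law_nonneg[OF X t] u] laplace_law[OF X t u]
        by (simp add: ennreal_mult[symmetric] exp_add[symmetric] algebra_simps)
    qed
    also have "\<dots> = ennreal (exp (- \<phi> t u)) * (\<integral>\<^sup>+\<omega>. ennreal (exp (- \<psi> t u * X s \<omega>)) \<partial>P x)"
      using m by (intro nn_integral_cmult) measurable
    also have "(\<integral>\<^sup>+\<omega>. ennreal (exp (- \<psi> t u * X s \<omega>)) \<partial>P x) = (\<integral>\<^sup>+y. ennreal (exp (- \<psi> t u * y)) \<partial>law P X s x)"
      unfolding law_def using m by (subst nn_integral_distr) auto
    also have "\<dots> = ennreal (laplace (law P X s x) (\<psi> t u))"
      using exponents_nonneg[OF t u] by (intro ennreal_laplace law_nonneg x s)
    finally have "laplace (law P X (s + t) x) u = exp (- \<phi> t u) * laplace (law P X s x) (\<psi> t u)"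
      by (simp add: ennreal_mult[symmetric] laplace_def)
    then show ?thesis
      using laplace_law[OF x _ u, of "s + t"] laplace_law[OF x s exponents_nonneg(2)[OF t u]] s t
      by (simp add: exp_add[symmetric])
  qed
  show 1: "\<phi> (s + t) u = \<phi> t u + \<phi> s (\<psi> t u)" using *[of 0] by simp
  show "\<psi> (s + t) u = \<psi> s (\<psi> t u)" using *[of 1] 1 by simp
qed

section \<open>The limit law and its exponent\<close>

lemma L_nonneg: "prob_on_nonneg L"
proof -
  have L: "prob_space L" "sets L = sets borel" "emeasure L {..<0} = 0"
    using limit by (auto simp: limit_distribution_def)
  have sp: "space L = UNIV" using sets_eq_imp_space_eq[OF L(2)] by simp
  have "{x. \<not> 0 \<le> x} = {..<(0::real)}" by auto
  then have "AE x in L. 0 \<le> x"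
    by (subst AE_iff_measurable[where N = "{..<0}"]) (auto simp: L sp)
  with L show ?thesis by (simp add: prob_on_nonneg_def)
qed

lemma laplace_law_tendsto:
  assumes x: "0 \<le> x" and u: "0 \<le> u"
  shows "((\<lambda>t. laplace (law P X t x) u) \<longlongrightarrow> laplace L u) at_top"
proof (rule tendsto_at_topI_sequentially)
  fix T :: "nat \<Rightarrow> real" assume T: "filterlim T at_top sequentially"
  then obtain N where N: "\<And>n. n \<ge> N \<Longrightarrow> 0 \<le> T n"
    by (auto simp: filterlim_at_top eventually_sequentially)
  \<comment> \<open>The initial segment is dropped because times may be negative there, where the
    laws are unspecified.\<close>
  define M where "M n = law P X (T (n + N)) x" for n
  have M: "prob_on_nonneg (M n)" for n
    unfolding M_def using N[of "n + N"] by (intro law_nonneg x) auto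
  have "weak_conv_m M L"
    unfolding weak_conv_m_def weak_conv_def
  proof (intro allI impI)
    fix y assume "isCont (cdf L) y"
    then have "((\<lambda>t. cdf (law P X t x) y) \<longlongrightarrow> cdf L y) at_top"
      using limit x by (simp add: limit_distribution_def)
    from filterlim_compose[OF this T] have "(\<lambda>n. cdf (law P X (T n) x) y) \<longlonglongrightarrow> cdf L y" .
    from LIMSEQ_ignore_initial_segment[OF this, of N] show "(\<lambda>n. cdf (M n) y) \<longlonglongrightarrow> cdf L y"
      by (simp add: M_def)
  qed
  then have "(\<lambda>n. \<integral>y. exp (- u * max y 0) \<partial>M n) \<longlonglongrightarrow> (\<integral>y. exp (- u * max y 0) \<partial>L)"
    using prob_on_nonneg_real_distribution[OF M] prob_on_nonneg_real_distribution[OF L_nonneg] u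
    by (intro weak_conv_imp_integral_bdd_continuous_conv[where B = 1]) (auto intro!: continuous_intros)
  moreover have "(\<integral>y. exp (- u * max y 0) \<partial>K) = laplace K u" if K: "prob_on_nonneg K" for K
  proof -
    interpret real_distribution K using K by (rule prob_on_nonneg_real_distribution)
    have "AE y in K. 0 \<le> y" using K by (simp add: prob_on_nonneg_def)
    then have "AE y in K. exp (- u * max y 0) = exp (- u * y)" by eventually_elim auto
    then show ?thesis unfolding laplace_def by (intro integral_cong_AE) auto
  qed
  ultimately have "(\<lambda>n. laplace (M n) u) \<longlonglongrightarrow> laplace L u" using M L_nonneg by simp
  then show "(\<lambda>n. laplace (law P X (T n) x) u) \<longlonglongrightarrow> laplace L u"
    unfolding M_def by (rule LIMSEQ_offset)
qed

definition l :: "real \<Rightarrow> real" where "l u = - ln (laplace L u)"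

text \<open>The limit does not depend on the starting point, so the coefficient of \<open>x\<close>
  dies out.\<close>

lemma exponents_tendsto:
  assumes u: "0 \<le> u"
  shows "((\<lambda>t. \<phi> t u) \<longlongrightarrow> l u) at_top" "((\<lambda>t. \<psi> t u) \<longlongrightarrow> 0) at_top"
proof -
  have *: "((\<lambda>t. \<phi> t u + x * \<psi> t u) \<longlongrightarrow> l u) at_top" if x: "0 \<le> x" for x
  proof -
    have "((\<lambda>t. - ln (laplace (law P X t x) u)) \<longlongrightarrow> l u) at_top"
      unfolding l_def using laplace_pos[OF L_nonneg u]
      by (intro tendsto_intros laplace_law_tendsto x u) auto
    moreover have "eventually (\<lambda>t. - ln (laplace (law P X t x) u) = \<phi> t u + x * \<psi> t u) at_top"
      using eventually_ge_at_top[of "0::real"] by eventually_elim (simp add: laplace_law[OF x _ u])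
    ultimately show ?thesis by (rule Lim_transform_eventually)
  qed
  show 1: "((\<lambda>t. \<phi> t u) \<longlongrightarrow> l u) at_top" using *[of 0] by simp
  from tendsto_diff[OF *[of 1] 1] show "((\<lambda>t. \<psi> t u) \<longlongrightarrow> 0) at_top" by simp
qed

text \<open>Stationarity of \<open>L\<close>, written for the exponents.\<close>

lemma l_invariant:
  assumes t: "0 \<le> t" and u: "0 \<le> u"
  shows "l u = \<phi> t u + l (\<psi> t u)"
proof (rule tendsto_unique)
  have "filterlim (\<lambda>s. t + s) at_top at_top"
    by (rule filterlim_tendsto_add_at_top[OF tendsto_const filterlim_ident])
  then have "filterlim (\<lambda>s. s + t) at_top at_top" by (simp add: add.commute)
  from filterlim_compose[OF exponents_tendsto(1)[OF u] this]
  show "((\<lambda>s. \<phi> (s + t) u) \<longlongrightarrow> l u) at_top" .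
  have "((\<lambda>s. \<phi> t u + \<phi> s (\<psi> t u)) \<longlongrightarrow> \<phi> t u + l (\<psi> t u)) at_top"
    by (intro tendsto_intros exponents_tendsto exponents_nonneg t u)
  moreover have "eventually (\<lambda>s. \<phi> t u + \<phi> s (\<psi> t u) = \<phi> (s + t) u) at_top"
    using eventually_ge_at_top[of "0::real"] by eventually_elim (simp add: semiflow[OF _ t u])
  ultimately show "((\<lambda>s. \<phi> (s + t) u) \<longlongrightarrow> \<phi> t u + l (\<psi> t u)) at_top"
    by (rule Lim_transform_eventually)
qed simp

text \<open>Restricted to \<open>0 < u\<close> since \<open>L\<close> may have infinite
  mean.\<close>

lemma l_has_derivative:
  assumes u: "0 < u"
  shows "(l has_real_derivative (\<integral>x. x * exp (- u * x) \<partial>L) / laplace L u) (at u)"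
proof -
  have "((\<lambda>v. \<integral>x. x ^ 0 * exp (- v * x) \<partial>L) has_real_derivative - (\<integral>x. x ^ Suc 0 * exp (- u * x) \<partial>L)) (at u)"
    using L_nonneg u prob_on_nonneg_integrable_exp[OF L_nonneg]
    by (intro has_derivative_moment) (auto simp: prob_on_nonneg_def)
  then have D: "(laplace L has_real_derivative - (\<integral>x. x * exp (- u * x) \<partial>L)) (at u)"
    by (simp add: laplace_def[abs_def])
  have "((\<lambda>u. - ln (laplace L u)) has_real_derivative - (1 / laplace L u * (- (\<integral>x. x * exp (- u * x) \<partial>L)))) (at u)"
    using laplace_pos[OF L_nonneg, of u] u
    by (intro DERIV_minus DERIV_chain2[OF _ D] DERIV_ln_divide) auto
  then show ?thesis by (simp add: l_def[abs_def])
qed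

lemma F_eq:
  assumes u: "0 < u"
  shows "F u = - ((\<integral>x. x * exp (- u * x) \<partial>L) / laplace L u) * R u"
proof -
  define d where "d = (\<integral>x. x * exp (- u * x) \<partial>L) / laplace L u"
  have "((\<lambda>t. l (\<psi> t u)) has_real_derivative d * R u) (at 0 within {0..})"
    using l_has_derivative[OF u] initial(2)[of u] u unfolding d_def
    by (intro DERIV_chain2[OF _ R_deriv]) auto
  then have "((\<lambda>t. l u - l (\<psi> t u)) has_real_derivative 0 - d * R u) (at 0 within {0..})"
    by (intro DERIV_diff DERIV_const)
  then have "((\<lambda>t. \<phi> t u) has_real_derivative 0 - d * R u) (at 0 within {0..})"
  proof (rule has_field_derivative_transform_within[where d = 1])
    fix t :: real assume "t \<in> {0..}"
    then show "l u - l (\<psi> t u) = \<phi> t u" using l_invariant[of t u] u by simp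
  qed auto
  moreover have "((\<lambda>t. \<phi> t u) has_real_derivative F u) (at 0 within {0..})" using u by (intro F_deriv) simp
  \<comment> \<open>Derivatives at 0 within the half line are right limits, hence unique.\<close>
  ultimately have "F u = 0 - d * R u"
    unfolding at_within_Ici_at_right has_field_derivative_iff
    by (metis tendsto_unique trivial_limit_at_right_real)
  then show ?thesis by (simp add: d_def)
qed

section \<open>Continuity in time and negativity of \<open>R\<close>\<close>

text \<open>The only use of stochastic continuity: it makes \<open>\<psi>\<close> continuous in
  time, which right derivatives alone do not give.\<close>

lemma laplace_law_continuous:
  assumes x: "0 \<le> x" and u: "0 \<le> u"
  shows "continuous_on {0..} (\<lambda>t. laplace (law P X t x) u)"
  unfolding continuous_on_def
proof (intro ballI tendstoI)
  fix s e :: real assume s: "s \<in> {0..}" and e: "0 < e"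
  interpret prob_space "P x" using P_prob x by simp
  \<comment> \<open>The exponential is \<open>u\<close>-Lipschitz in the state, so displacements up
    to \<open>d\<close> cost at most \<open>e / 2\<close>; \<open>u + 1\<close> avoids division by
    zero.\<close>
  define d where "d = e / (2 * (u + 1))"
  have d: "0 < d" using e u by (simp add: d_def)
  have "((\<lambda>t. measure (P x) {\<omega>\<in>space \<Omega>. \<bar>X t \<omega> - X s \<omega>\<bar> > d}) \<longlongrightarrow> 0) (at s within {0..})"
    using stoch_cont x s d by (simp add: stochastically_continuous_def)
  from order_tendstoD(2)[OF this, of "e / 2"] e
  have "eventually (\<lambda>t. measure (P x) {\<omega>\<in>space \<Omega>. \<bar>X t \<omega> - X s \<omega>\<bar> > d} < e / 2) (at s within {0..})" by simp
  moreover have "eventually (\<lambda>t. t \<in> {0..}) (at s within {0..})" by (simp add: eventually_at_filter)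
  ultimately show "eventually (\<lambda>t. dist (laplace (law P X t x) u) (laplace (law P X s x) u) < e) (at s within {0..})"
  proof eventually_elim
    case (elim t)
    then have t: "0 \<le> t" and s: "0 \<le> s" using s by auto
    note [measurable] = X_measurable_P[OF x t] X_measurable_P[OF x s]
    define B where "B = {\<omega>\<in>space \<Omega>. \<bar>X t \<omega> - X s \<omega>\<bar> > d}"
    have B: "B \<in> sets (P x)" unfolding B_def P_space[OF x, symmetric] by measurable
    have lap: "laplace (law P X r x) u = (\<integral>\<omega>. exp (- u * X r \<omega>) \<partial>P x)" if "0 \<le> r" for r
      unfolding laplace_def law_def by (subst integral_distr[OF X_measurable_P]) (use x that in auto)
    have bd: "exp (- u * X r \<omega>) \<le> 1" if "0 \<le> r" "\<omega> \<in> space (P x)" for r \<omega>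
      using X_nonneg[of r \<omega>] that u by (simp add: P_space x)
    have int: "integrable (P x) (\<lambda>\<omega>. exp (- u * X r \<omega>))" if "0 \<le> r" for r
      using bd[OF that] X_measurable_P[OF x that] by (intro integrable_const_bound[where B = 1]) auto
    have "dist (laplace (law P X t x) u) (laplace (law P X s x) u)
        = \<bar>\<integral>\<omega>. exp (- u * X t \<omega>) - exp (- u * X s \<omega>) \<partial>P x\<bar>"
      unfolding lap[OF t] lap[OF s] dist_real_def using int[OF t] int[OF s] by simp
    also have "\<dots> \<le> (\<integral>\<omega>. \<bar>exp (- u * X t \<omega>) - exp (- u * X s \<omega>)\<bar> \<partial>P x)" by (rule integral_abs_bound)
    also have "\<dots> \<le> (\<integral>\<omega>. u * d + indicator B \<omega> \<partial>P x)"
    proof (rule integral_mono)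
      fix \<omega> assume \<omega>: "\<omega> \<in> space (P x)"
      show "\<bar>exp (- u * X t \<omega>) - exp (- u * X s \<omega>)\<bar> \<le> u * d + indicator B \<omega>"
      proof (cases "\<omega> \<in> B")
        case True
        have "\<bar>exp (- u * X t \<omega>) - exp (- u * X s \<omega>)\<bar> \<le> 1"
          using bd[OF t \<omega>] bd[OF s \<omega>] exp_ge_zero[of "- u * X t \<omega>"] exp_ge_zero[of "- u * X s \<omega>"]
          unfolding abs_le_iff by linarith
        then show ?thesis using True u d by (simp add: add_increasing)
      next
        case False
        then have c: "\<bar>X t \<omega> - X s \<omega>\<bar> \<le> d" using \<omega> by (auto simp: B_def P_space x)
        have lip: "exp (- b) - exp (- a) \<le> a - b" if "0 \<le> b" "b \<le> a" for a b :: real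
        proof -
          have "1 - exp (- (a - b)) \<le> a - b" using exp_ge_add_one_self[of "- (a - b)"] by linarith
          then have "exp (- b) * (1 - exp (- (a - b))) \<le> 1 * (a - b)"
            using that by (intro mult_mono) auto
          then show ?thesis by (simp add: right_diff_distrib exp_add[symmetric])
        qed
        have X0: "0 \<le> u * X t \<omega>" "0 \<le> u * X s \<omega>" using X_nonneg t s \<omega> u by (auto simp: P_space x)
        have "\<bar>exp (- u * X t \<omega>) - exp (- u * X s \<omega>)\<bar> \<le> \<bar>u * X t \<omega> - u * X s \<omega>\<bar>"
          using lip[of "u * X t \<omega>" "u * X s \<omega>"] lip[of "u * X s \<omega>" "u * X t \<omega>"] X0
          by (cases "u * X t \<omega> \<le> u * X s \<omega>") (auto simp: abs_if)
        also have "\<dots> = u * \<bar>X t \<omega> - X s \<omega>\<bar>" using u by (simp add: right_diff_distrib[symmetric] abs_mult)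
        also have "\<dots> \<le> u * d" using c u by (intro mult_left_mono)
        finally show ?thesis using False by simp
      qed
    qed (use int[OF t] int[OF s] B in \<open>auto simp: less_top[symmetric]\<close>)
    also have "\<dots> = u * d + measure (P x) B"
      using B prob_space by (subst Bochner_Integration.integral_add) (auto simp: less_top[symmetric])
    also have "\<dots> < e"
    proof -
      have "u * d \<le> (u + 1) * d" using d by (intro mult_right_mono) auto
      also have "\<dots> = e / 2" using u by (simp add: d_def field_simps)
      finally show ?thesis using elim by (simp add: B_def)
    qed
    finally show ?case .
  qed
qed

lemma psi_continuous:
  assumes u: "0 \<le> u" shows "continuous_on {0..} (\<lambda>t. \<psi> t u)"
proof -
  have "continuous_on {0..} (\<lambda>t. ln (laplace (law P X t 0) u) - ln (laplace (law P X t 1) u))"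
    using u laplace_pos[OF law_nonneg]
    by (intro continuous_intros laplace_law_continuous) (auto simp: less_imp_neq[symmetric])
  then show ?thesis
    by (rule continuous_on_eq) (use u in \<open>simp add: laplace_law\<close>)
qed

text \<open>By the semiflow property the right derivative of \<open>\<psi>\<close> in
  \<open>t\<close> is \<open>R\<close> at the current value. With \<open>R = 0\<close> on the half
  line \<open>\<psi> t 1\<close> would stay at 1, although it tends to 0.\<close>

lemma R_not_zero: "\<exists>u\<ge>0. R u \<noteq> 0"
proof (rule ccontr)
  assume "\<not> ?thesis"
  then have R0: "R u = 0" if "0 \<le> u" for u using that by blast
  have "\<psi> t 1 = \<psi> 0 1" if t: "0 \<le> t" for t
  proof (rule right_derivative_zero_imp_constant[OF psi_continuous _ t])
    fix t :: real assume t: "0 \<le> t"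
    have "((\<lambda>h. \<psi> h (\<psi> t 1)) has_real_derivative 0) (at 0 within {0..})"
      using R_deriv[of "\<psi> t 1"] R0[of "\<psi> t 1"] exponents_nonneg[OF t, of 1] by simp
    then show "((\<lambda>h. \<psi> (t + h) 1) has_real_derivative 0) (at 0 within {0..})"
    proof (rule has_field_derivative_transform_within[where d = 1])
      fix h :: real assume "h \<in> {0..}"
      then show "\<psi> h (\<psi> t 1) = \<psi> (t + h) 1" using semiflow(2)[of h t 1] t by (simp add: add.commute)
    qed auto
  qed simp
  then have "eventually (\<lambda>t. \<psi> t 1 = 1) at_top"
    using initial(2)[of 1] by (intro eventually_mono[OF eventually_ge_at_top[of "0::real"]]) simp
  then have "((\<lambda>t. \<psi> t 1) \<longlongrightarrow> 1) at_top" by (rule tendsto_eventually)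
  with exponents_tendsto(2)[of 1] have "(0::real) = 1"
    by (intro tendsto_unique[of at_top "\<lambda>t. \<psi> t 1"]) auto
  then show False by simp
qed

text \<open>\<open>- 1 / R u\<close> is an integral of a nonnegative function, so
  \<open>R u \<le> 0\<close>. The delicate case is \<open>R u = 0\<close>, where division by zero
  also gives 0: then \<open>W = 0\<close> almost everywhere, all Laplace integrals vanish, and
  \<open>R\<close> would be zero on the half line.\<close>

lemma R_negative:
  assumes W: "dual_scale_function R W" and R0: "R 0 = 0" and u: "0 < u"
  shows "R u < 0"
proof -
  have lap: "(LINT x:{0..}|lborel. exp (- u * x) * W x) = - 1 / R u"
    and int: "integrable lborel (\<lambda>x. indicator {0..} x *\<^sub>R (exp (- u * x) * W x))" if "0 < u" for u
    using W that by (auto simp: dual_scale_function_def set_integrable_def)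
  have nonneg: "0 \<le> indicator {0..} x *\<^sub>R (exp (- u * x) * W x)" for u x
    using W by (simp add: dual_scale_function_def)
  have le: "R u \<le> 0"
  proof -
    have "0 \<le> - 1 / R u" unfolding lap[OF u, symmetric] set_lebesgue_integral_def
      using nonneg by (intro integral_nonneg_AE AE_I2)
    then show ?thesis by (simp add: divide_le_0_iff zero_le_divide_iff)
  qed
  moreover have "R u \<noteq> 0"
  proof
    assume "R u = 0"
    then have "(\<integral>x. indicator {0..} x *\<^sub>R (exp (- u * x) * W x) \<partial>lborel) = 0"
      using lap[OF u] by (simp add: set_lebesgue_integral_def)
    then have AE: "AE x in lborel. indicator {0..} x *\<^sub>R (exp (- u * x) * W x) = 0"
      using integral_nonneg_eq_0_iff_AE[OF int[OF u]] nonneg by simp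
    have "R v = 0" if "0 \<le> v" for v
    proof (cases "v = 0")
      case False
      then have v: "0 < v" using that by simp
      have "AE x in lborel. indicator {0..} x *\<^sub>R (exp (- v * x) * W x) = 0"
        using AE by eventually_elim auto
      then have "(\<integral>x. indicator {0..} x *\<^sub>R (exp (- v * x) * W x) \<partial>lborel) = 0"
        by (rule integral_eq_zero_AE)
      then show ?thesis using lap[OF v] by (simp add: set_lebesgue_integral_def)
    qed (simp add: R0)
    then show False using R_not_zero by blast
  qed
  ultimately show ?thesis by simp
qed

end

section \<open>The Levy density of the limit distribution\<close>

locale dual_scale_immigration = dual_scale R W \<alpha> \<beta> \<mu>
  for R W \<alpha> \<beta> \<mu> +
  fixes F :: "real \<Rightarrow> real" and b :: real and m :: "real measure"
  assumes F_param: "F_parameters F b m"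
begin

lemma b_nonneg: "0 \<le> b"
  and m_sets [measurable_cong]: "sets m = sets borel"
  and m_AE: "AE x in m. 0 < x"
  and m_integrable: "integrable m (\<lambda>x. min x 1)"
proof -
  show "0 \<le> b" using F_param by (simp add: F_parameters_def)
  have pos: "measure_on_pos m" using F_param by (simp add: F_parameters_def)
  then show s [measurable_cong]: "sets m = sets borel" by (simp add: measure_on_pos_def)
  show AE: "AE x in m. 0 < x" using pos by (rule measure_on_pos_AE)
  show "integrable m (\<lambda>x. min x 1)"
  proof (rule integrableI_nonneg)
    show "AE x in m. 0 \<le> min x 1" using AE by eventually_elim simp
    show "(\<integral>\<^sup>+x. ennreal (min x 1) \<partial>m) < \<infinity>" using F_param by (simp add: F_parameters_def)
  qed measurable
qed

lemma m_space: "space m = UNIV"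
  using sets_eq_imp_space_eq[OF m_sets] by simp

text \<open>Required for exchanging the integrals over \<open>m\<close> and Lebesgue measure. The
  rays beyond \<open>1 / Suc n\<close> have finite mass because \<open>min x 1\<close> is
  integrable.\<close>

lemma m_sigma_finite: "sigma_finite_measure m"
proof (unfold_locales, intro exI conjI)
  define C where "C = insert {..0} (range (\<lambda>n::nat. {1 / Suc n<..})) "
  show "countable C" by (simp add: C_def)
  show "C \<subseteq> sets m" by (auto simp: C_def m_sets)
  show "\<Union> C = space m"
  proof -
    have "x \<in> \<Union> C" for x
    proof (cases "x \<le> 0")
      case False
      then obtain n where "1 / real (Suc n) < x" using nat_approx_posE[of x] by auto
      then show ?thesis by (auto simp: C_def)
    qed (simp add: C_def)
    then show ?thesis unfolding m_space by auto
  qed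
  show "\<forall>a\<in>C. emeasure m a \<noteq> \<infinity>"
  proof
    fix a assume "a \<in> C"
    then consider "a = {..0}" | n :: nat where "a = {1 / Suc n<..}" by (auto simp: C_def)
    then show "emeasure m a \<noteq> \<infinity>"
    proof cases
      case 1 then show ?thesis using F_param by (simp add: F_parameters_def measure_on_pos_def)
    next
      case 2
      have "emeasure m a = (\<integral>\<^sup>+x. indicator a x \<partial>m)" using 2 by (simp add: m_sets)
      also have "\<dots> \<le> (\<integral>\<^sup>+x. ennreal (real (Suc n)) * ennreal (min x 1) \<partial>m)"
      proof (rule nn_integral_mono)
        fix x :: real
        have "1 \<le> real (Suc n) * min x 1" if "x \<in> a"
          using that 2 by (cases "x \<le> 1") (auto simp: field_simps)
        then show "indicator a x \<le> ennreal (real (Suc n)) * ennreal (min x 1)"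
          by (cases "x \<in> a") (auto simp: ennreal_mult'[symmetric] simp del: of_nat_Suc)
      qed
      also have "\<dots> = ennreal (real (Suc n)) * (\<integral>\<^sup>+x. ennreal (min x 1) \<partial>m)"
        by (rule nn_integral_cmult) measurable
      also have "\<dots> < \<infinity>" using F_param by (simp add: F_parameters_def ennreal_mult_less_top)
      finally show ?thesis by simp
    qed
  qed
qed

sublocale m: sigma_finite_measure m by (rule m_sigma_finite)

sublocale lm: pair_sigma_finite lborel m ..

lemma exp_m_integrable: "0 \<le> u \<Longrightarrow> integrable m (\<lambda>x. 1 - exp (- u * x))"
proof (rule Bochner_Integration.integrable_bound)
  assume u: "0 \<le> u"
  show "integrable m (\<lambda>x. (u + 1) * min x 1)" by (intro integrable_mult_right m_integrable)
  show "AE x in m. norm (1 - exp (- u * x)) \<le> norm ((u + 1) * min x 1)"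
    using m_AE
  proof eventually_elim
    fix x :: real assume x: "0 < x"
    have "1 - exp (- u * x) \<le> (u + 1) * min x 1"
    proof (cases "x \<le> 1")
      case True
      have "1 - exp (- u * x) \<le> u * x" using exp_ge_add_one_self[of "- u * x"] by simp
      also have "\<dots> \<le> (u + 1) * x" using x by (intro mult_right_mono) auto
      finally show ?thesis using True by simp
    next
      case False
      have "1 - exp (- u * x) \<le> 1" by simp
      also have "\<dots> \<le> u + 1" using u by simp
      finally show ?thesis using False by simp
    qed
    moreover have "0 \<le> 1 - exp (- u * x)" using u x by simp
    ultimately show "norm (1 - exp (- u * x)) \<le> norm ((u + 1) * min x 1)" by simp
  qed
qed measurable

lemma F_formula: assumes u: "0 \<le> u" shows "F u = b * u + (\<integral>x. 1 - exp (- u * x) \<partial>m)"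
proof -
  have "F u = b * u - (LINT \<xi>:{0<..}|m. exp (- u * \<xi>) - 1)"
    using F_param u by (auto simp: F_parameters_def)
  also have "(LINT \<xi>:{0<..}|m. exp (- u * \<xi>) - 1) = (\<integral>x. - (1 - exp (- u * x)) \<partial>m)"
    unfolding set_lebesgue_integral_def
  proof (rule integral_cong_AE)
    show "AE x in m. indicator {0<..} x *\<^sub>R (exp (- u * x) - 1) = - (1 - exp (- u * x))"
      using m_AE by eventually_elim simp
  qed measurable
  also have "\<dots> = - (\<integral>x. 1 - exp (- u * x) \<partial>m)" by (rule Bochner_Integration.integral_minus)
  finally show ?thesis by simp
qed

lemma increment_nonneg: "0 \<le> \<xi> \<Longrightarrow> 0 \<le> W x - W (x - \<xi>)"
  by (simp add: W_mono)

text \<open>Small jumps are controlled by the Lipschitz bound of \<open>W\<close> near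
  \<open>x\<close>, large ones by \<open>W x\<close> itself; together this is a multiple of
  \<open>min \<xi> 1\<close>.\<close>

lemma increment_integrable:
  assumes x: "0 < x" shows "integrable m (\<lambda>\<xi>. W x - W (x - \<xi>))"
proof (rule Bochner_Integration.integrable_bound)
  define s where "s = \<bar>slope (x / 2 / 2) (x / 2 / 2)\<bar>"
  \<comment> \<open>Jumps up to \<open>c\<close> stay above \<open>x / 2\<close>, where the slope
    bound \<open>s\<close> applies, and satisfy \<open>min \<xi> 1 = \<xi>\<close>; for larger jumps
    \<open>min \<xi> 1 \<ge> c\<close>.\<close>
  define c where "c = min (x / 2) 1"
  have c: "0 < c" using x by (simp add: c_def)
  define K where "K = W x * s + W x / c"
  show "integrable m (\<lambda>\<xi>. K * min \<xi> 1)" by (intro integrable_mult_right m_integrable)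
  show "AE \<xi> in m. norm (W x - W (x - \<xi>)) \<le> norm (K * min \<xi> 1)"
    using m_AE
  proof eventually_elim
    fix \<xi> :: real assume \<xi>: "0 < \<xi>"
    have Ws: "0 \<le> W x * s" "0 \<le> W x / c" using c by (auto simp: s_def)
    have "W x - W (x - \<xi>) \<le> K * min \<xi> 1"
    proof (cases "\<xi> \<le> c")
      case True
      then have le: "x / 2 \<le> x - \<xi>" "\<xi> \<le> 1" by (auto simp: c_def)
      have "W (x - \<xi> + \<xi>) - W (x - \<xi>) \<le> W (x - \<xi> + \<xi>) * (slope (x / 2 / 2) (x / 2 / 2) * \<xi>)"
        using x le \<xi> by (intro W_increment_le) auto
      also have "\<dots> \<le> W x * (s * \<xi>)"
        using \<xi> by (auto simp: s_def intro!: mult_left_mono mult_right_mono)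
      also have "\<dots> \<le> K * \<xi>"
        using mult_nonneg_nonneg[OF Ws(2), of \<xi>] \<xi> unfolding K_def distrib_right by simp
      finally show ?thesis using le by simp
    next
      case False
      then have "c \<le> min \<xi> 1" by (auto simp: c_def)
      then have "W x / c * c \<le> W x / c * min \<xi> 1" using Ws by (intro mult_left_mono) auto
      also have "\<dots> \<le> K * min \<xi> 1" using Ws \<xi> by (intro mult_right_mono) (auto simp: K_def)
      finally have "W x \<le> K * min \<xi> 1" using c by simp
      then show ?thesis using W_nonneg[of "x - \<xi>"] by linarith
    qed
    then show "norm (W x - W (x - \<xi>)) \<le> norm (K * min \<xi> 1)"
      using increment_nonneg[of \<xi> x] \<xi> by simp
  qed
qed measurable

section \<open>The density \<open>k\<close> and its Laplace transform\<close>

text \<open>The function \<open>k\<close> extended by zero, so that all integrals run over the whole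
  line.\<close>

definition k0 :: "real \<Rightarrow> real" where
  "k0 x = indicator {0<..} x * (b * D x + (\<integral>\<xi>. W x - W (x - \<xi>) \<partial>m))"

lemma increment_integral_nonneg: "0 \<le> (\<integral>\<xi>. W x - W (x - \<xi>) \<partial>m)"
  using m_AE by (intro integral_nonneg_AE) (auto elim!: eventually_mono intro!: W_mono)

lemma k0_nonneg: "0 \<le> k0 x"
  using b_nonneg D_nonneg increment_integral_nonneg by (auto simp: k0_def indicator_def)

lemma increment_integral_measurable [measurable]:
  "(\<lambda>x. \<integral>\<xi>. W x - W (x - \<xi>) \<partial>m) \<in> borel_measurable borel"
  by (rule m.borel_measurable_lebesgue_integral) measurable

lemma k0_measurable [measurable]: "k0 \<in> borel_measurable borel"
proof -
  have "(\<lambda>x. b * (indicator {0<..} x * D x) + indicator {0<..} x * (\<integral>\<xi>. W x - W (x - \<xi>) \<partial>m)) \<in> borel_measurable borel"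
    by measurable
  then show ?thesis by (simp add: k0_def[abs_def] algebra_simps)
qed

text \<open>Translation by \<open>\<xi>\<close> multiplies the Laplace transform of \<open>W\<close>
  by \<open>exp (- u * \<xi>)\<close>.\<close>

lemma increment_laplace:
  assumes u: "0 < u" and \<xi>: "0 < \<xi>"
  shows "(\<integral>\<^sup>+x. ennreal (exp (- u * x) * (W x - W (x - \<xi>))) \<partial>lborel) = ennreal ((1 - exp (- u * \<xi>)) * (- 1 / R u))"
proof -
  have eq: "exp (- u * x) * W (x - \<xi>) = exp (- u * \<xi>) * (exp (- u * (- \<xi> + 1 * x)) * W (- \<xi> + 1 * x))" for x
  proof -
    have "exp (- u * x) = exp (- u * \<xi>) * exp (- u * (- \<xi> + 1 * x))"
      unfolding exp_add[symmetric] by (simp add: algebra_simps)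
    then show ?thesis by (simp add: mult.assoc)
  qed
  have int: "integrable lborel (\<lambda>x. exp (- u * (- \<xi> + 1 * x)) * W (- \<xi> + 1 * x))"
    using lborel_integrable_real_affine[OF W_integrable[OF u], of 1 "- \<xi>"] by simp
  have val: "(\<integral>x. exp (- u * (- \<xi> + 1 * x)) * W (- \<xi> + 1 * x) \<partial>lborel) = - 1 / R u"
    using lborel_integral_real_affine[of 1 "\<lambda>x. exp (- u * x) * W x" "- \<xi>"] W_laplace[OF u] by simp
  have int2: "integrable lborel (\<lambda>x. exp (- u * x) * W (x - \<xi>))"
    unfolding eq by (intro integrable_mult_right int)
  have "(\<integral>x. exp (- u * x) * (W x - W (x - \<xi>)) \<partial>lborel)
      = (\<integral>x. exp (- u * x) * W x \<partial>lborel) - (\<integral>x. exp (- u * x) * W (x - \<xi>) \<partial>lborel)"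
    unfolding right_diff_distrib using W_integrable[OF u] int2 by (rule Bochner_Integration.integral_diff)
  also have "(\<integral>x. exp (- u * x) * W (x - \<xi>) \<partial>lborel) = exp (- u * \<xi>) * (- 1 / R u)"
    unfolding eq integral_mult_right_zero val ..
  finally have "(\<integral>x. exp (- u * x) * (W x - W (x - \<xi>)) \<partial>lborel) = (1 - exp (- u * \<xi>)) * (- 1 / R u)"
    unfolding W_laplace[OF u] by (simp add: algebra_simps)
  moreover have "integrable lborel (\<lambda>x. exp (- u * x) * (W x - W (x - \<xi>)))"
    unfolding right_diff_distrib using W_integrable[OF u] int2 by (rule Bochner_Integration.integrable_diff)
  ultimately show ?thesis
    using \<xi> by (subst nn_integral_eq_integral) (auto simp: W_mono)
qed

text \<open>The drift contributes \<open>b * (u / (- R u) - W 0)\<close>, the jumps the integral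
  part of \<open>F u\<close> divided by \<open>- R u\<close>. The second claim is needed because
  \<open>ennreal\<close> sends negative reals to 0, which would hide a negative value in the
  first.\<close>

lemma nn_laplace_k0:
  assumes u: "0 < u"
  shows "(\<integral>\<^sup>+x. ennreal (exp (- u * x) * k0 x) \<partial>lborel) = ennreal (F u / (- R u) - b * W 0)"
    and "b * W 0 \<le> F u / (- R u)"
proof -
  define I where "I x = (\<integral>\<xi>. W x - W (x - \<xi>) \<partial>m)" for x
  have [measurable]: "I \<in> borel_measurable borel" unfolding I_def by measurable
  define d where "d z = indicator {0<..} z * D z" for z
  have [measurable]: "d \<in> borel_measurable borel" unfolding d_def by measurable
  have d: "0 \<le> d z" for z using D_nonneg by (simp add: d_def indicator_def)
  have I: "0 \<le> I x" for x unfolding I_def by (rule increment_integral_nonneg)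
  define c where "c = - 1 / R u"
  have c: "0 < c" using R_neg[OF u] by (simp add: c_def divide_neg_neg)
  have nn_W: "(\<integral>\<^sup>+x. ennreal (exp (- u * x) * W x) \<partial>lborel) = ennreal c"
    unfolding c_def by (rule nn_laplace_W[OF u])
  have nn_D: "(\<integral>\<^sup>+x. ennreal (exp (- u * x) * d x) \<partial>lborel) = ennreal (u * c - W 0)"
    using nn_laplace_D[OF u] by (simp add: d_def c_def)
  define E where "E = (\<integral>x. 1 - exp (- u * x) \<partial>m)"
  have Feq: "F u = b * u + E" using u unfolding E_def by (intro F_formula) simp
  have E: "0 \<le> E" unfolding E_def using m_AE u by (intro integral_nonneg_AE) (auto elim!: eventually_mono)
  have "(\<integral>\<^sup>+x. ennreal (exp (- u * x) * (indicator {0<..} x * I x)) \<partial>lborel)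
      = (\<integral>\<^sup>+x. \<integral>\<^sup>+\<xi>. ennreal (exp (- u * x) * (W x - W (x - \<xi>))) \<partial>m \<partial>lborel)"
  proof (rule nn_integral_cong_AE)
    \<comment> \<open>The two sides may differ at \<open>x = 0\<close>: the indicator cuts the left
      one off, while the right one is \<open>W 0\<close> times the mass of \<open>m\<close>.\<close>
    have "AE x in lborel. x \<noteq> (0::real)" by (rule AE_lborel_singleton)
    then show "AE x in lborel. ennreal (exp (- u * x) * (indicator {0<..} x * I x))
        = (\<integral>\<^sup>+\<xi>. ennreal (exp (- u * x) * (W x - W (x - \<xi>))) \<partial>m)"
    proof eventually_elim
      fix x :: real assume "x \<noteq> 0"
      show "ennreal (exp (- u * x) * (indicator {0<..} x * I x))
        = (\<integral>\<^sup>+\<xi>. ennreal (exp (- u * x) * (W x - W (x - \<xi>))) \<partial>m)"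
      proof (cases "0 < x")
        case True
        have "(\<integral>\<^sup>+\<xi>. ennreal (exp (- u * x) * (W x - W (x - \<xi>))) \<partial>m) = ennreal (\<integral>\<xi>. exp (- u * x) * (W x - W (x - \<xi>)) \<partial>m)"
        proof (rule nn_integral_eq_integral)
          show "integrable m (\<lambda>\<xi>. exp (- u * x) * (W x - W (x - \<xi>)))"
            by (intro integrable_mult_right increment_integrable True)
          show "AE \<xi> in m. 0 \<le> exp (- u * x) * (W x - W (x - \<xi>))"
            using m_AE by eventually_elim (simp add: W_mono)
        qed
        then show ?thesis using True by (simp add: I_def)
      next
        case False
        then have x: "x < 0" using \<open>x \<noteq> 0\<close> by simp
        have "AE \<xi> in m. ennreal (exp (- u * x) * (W x - W (x - \<xi>))) = 0"
          using m_AE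
        proof eventually_elim
          fix \<xi> :: real assume "0 < \<xi>"
          then have "W (x - \<xi>) = 0" using x by (intro W_neg) simp
          then show "ennreal (exp (- u * x) * (W x - W (x - \<xi>))) = 0" using x by simp
        qed
        then have "(\<integral>\<^sup>+\<xi>. ennreal (exp (- u * x) * (W x - W (x - \<xi>))) \<partial>m) = (\<integral>\<^sup>+\<xi>. 0 \<partial>m)"
          by (rule nn_integral_cong_AE)
        then show ?thesis using x by simp
      qed
    qed
  qed
  also have "\<dots> = (\<integral>\<^sup>+\<xi>. \<integral>\<^sup>+x. ennreal (exp (- u * x) * (W x - W (x - \<xi>))) \<partial>lborel \<partial>m)"
    by (rule lm.Fubini'[symmetric]) measurable
  also have "\<dots> = (\<integral>\<^sup>+\<xi>. ennreal ((1 - exp (- u * \<xi>)) * c) \<partial>m)"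
    unfolding c_def
    by (intro nn_integral_cong_AE eventually_mono[OF m_AE]) (rule increment_laplace[OF u])
  also have "\<dots> = ennreal (E * c)"
  proof (subst nn_integral_eq_integral)
    show "integrable m (\<lambda>\<xi>. (1 - exp (- u * \<xi>)) * c)"
      using u by (intro integrable_mult_left exp_m_integrable) auto
    show "AE \<xi> in m. 0 \<le> (1 - exp (- u * \<xi>)) * c"
      using m_AE by eventually_elim (use c u in simp)
    show "ennreal (\<integral>\<xi>. (1 - exp (- u * \<xi>)) * c \<partial>m) = ennreal (E * c)"
      unfolding integral_mult_left_zero E_def ..
  qed
  finally have 1: "(\<integral>\<^sup>+x. ennreal (exp (- u * x) * (indicator {0<..} x * I x)) \<partial>lborel) = ennreal (E * c)" .
  \<comment> \<open>From \<open>W x \<ge> W 0\<close> for \<open>x \<ge> 0\<close>; it ensures that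
    the real difference is not truncated by \<open>ennreal\<close>.\<close>
  have W0: "W 0 \<le> u * c"
  proof -
    have "ennreal (W 0 / u) \<le> ennreal (c)"
    proof -
      have "ennreal (W 0 / u) = (\<integral>\<^sup>+x. ennreal (W 0) * (ennreal (exp (- u * x)) * indicator {0..} x) \<partial>lborel)"
        using nn_integral_exp_atLeast[OF u, of 0] u
        by (subst nn_integral_cmult) (auto simp: ennreal_mult[symmetric])
      also have "\<dots> \<le> (\<integral>\<^sup>+x. ennreal (exp (- u * x) * W x) \<partial>lborel)"
        by (intro nn_integral_mono) (auto simp: indicator_def ennreal_mult[symmetric] mult.commute intro!: mult_left_mono ennreal_leI W_mono)
      finally show ?thesis unfolding nn_W .
    qed
    then have "W 0 / u \<le> c" using c by (simp add: ennreal_le_iff)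
    then have "W 0 / u * u \<le> c * u" using u by (intro mult_right_mono) auto
    then show ?thesis using u by (simp add: mult.commute)
  qed
  have split: "ennreal (exp (- u * x) * k0 x) = ennreal b * ennreal (exp (- u * x) * d x)
      + ennreal (exp (- u * x) * (indicator {0<..} x * I x))" for x
  proof -
    have "k0 x = b * d x + indicator {0<..} x * I x" by (simp add: k0_def d_def I_def indicator_def)
    then have "exp (- u * x) * k0 x = b * (exp (- u * x) * d x) + exp (- u * x) * (indicator {0<..} x * I x)"
      by (simp add: distrib_left mult.left_commute)
    moreover have "0 \<le> exp (- u * x) * d x" "0 \<le> exp (- u * x) * (indicator {0<..} x * I x)"
      using d[of x] I[of x] by auto
    ultimately show ?thesis using b_nonneg by (simp add: ennreal_plus ennreal_mult)
  qed
  have "(\<integral>\<^sup>+x. ennreal (exp (- u * x) * k0 x) \<partial>lborel)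
      = ennreal b * (\<integral>\<^sup>+x. ennreal (exp (- u * x) * d x) \<partial>lborel) + ennreal (E * c)"
    unfolding split 1[symmetric] by (subst nn_integral_add) (auto simp: nn_integral_cmult)
  also have "\<dots> = ennreal (b * (u * c - W 0) + E * c)"
    using nn_D b_nonneg W0 E c
    by (simp add: ennreal_mult[symmetric] ennreal_plus[symmetric] del: ennreal_plus)
  also have "b * (u * c - W 0) + E * c = F u / (- R u) - b * W 0"
    by (simp add: Feq c_def algebra_simps add_divide_distrib)
  finally show "(\<integral>\<^sup>+x. ennreal (exp (- u * x) * k0 x) \<partial>lborel) = ennreal (F u / (- R u) - b * W 0)" .
  have "0 \<le> b * (u * c - W 0) + E * c" using b_nonneg W0 E c by simp
  also have "b * (u * c - W 0) + E * c = F u / (- R u) - b * W 0"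
    by (simp add: Feq c_def algebra_simps add_divide_distrib)
  finally show "b * W 0 \<le> F u / (- R u)" by simp
qed

lemma F_nonneg: assumes u: "0 \<le> u" shows "0 \<le> F u"
proof -
  have "AE x in m. 0 \<le> 1 - exp (- u * x)" using m_AE by eventually_elim (use u in simp)
  then have "0 \<le> (\<integral>x. 1 - exp (- u * x) \<partial>m)" by (rule integral_nonneg_AE)
  then show ?thesis unfolding F_formula[OF u] using u b_nonneg by (intro add_nonneg_nonneg mult_nonneg_nonneg)
qed

lemma nn_integral_exp_Icc:
  fixes x u :: real assumes "0 < x" "0 \<le> u"
  shows "(\<integral>\<^sup>+v. ennreal (exp (- v * x)) * indicator {0..u} v \<partial>lborel) = ennreal ((1 - exp (- u * x)) / x)"
proof -
  have "(\<integral>\<^sup>+v. ennreal (exp (- v * x)) * indicator {0..u} v \<partial>lborel)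
      = ennreal (- exp (- u * x) / x - (- exp (- 0 * x) / x))"
    using assms by (intro nn_integral_FTC_Icc) (auto intro!: derivative_eq_intros)
  then show ?thesis by (simp add: diff_divide_distrib)
qed

text \<open>All terms are nonnegative, so Tonelli applies without prior integrability, and
  finiteness of \<open>l u\<close> delivers integrability of the Levy density.\<close>

lemma levy_khintchine_exponent:
  assumes l: "continuous_on {0..} l" "l 0 = 0"
    and l_deriv: "\<And>u. 0 < u \<Longrightarrow> (l has_real_derivative F u / (- R u)) (at u)" and u: "0 < u"
  shows "integrable lborel (\<lambda>x. (1 - exp (- u * x)) * (k0 x / x))"
    and "l u = u * (b * W 0) + (\<integral>x. (1 - exp (- u * x)) * (k0 x / x) \<partial>lborel)"
proof -
  define A where "A = (\<integral>\<^sup>+x. ennreal ((1 - exp (- u * x)) * (k0 x / x)) \<partial>lborel)"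
  \<comment> \<open>\<open>F / (- R)\<close> may be unbounded near 0. The fundamental theorem is
    used in the form that asks for continuity on the closed interval and derivatives only
    inside.\<close>
  have f_int: "((\<lambda>v. F v / (- R v)) has_integral l u - l 0) {0..u}"
    using u by (intro fundamental_theorem_of_calculus_interior continuous_on_subset[OF l(1)])
      (use l_deriv in \<open>auto simp: has_real_derivative_iff_has_vector_derivative[symmetric]\<close>)
  have f_nonneg: "0 \<le> F v / (- R v)" if "v \<in> {0..u}" for v
    using that F_nonneg[of v] R_neg[of v] F_formula[of 0] by (cases "v = 0") (auto intro: divide_nonneg_neg)
  have lu: "0 \<le> l u" using has_integral_nonneg[OF f_int f_nonneg] l(2) by simp
  have f_nn: "(\<integral>\<^sup>+v. ennreal (F v / (- R v)) * indicator {0..u} v \<partial>lborel) = ennreal (l u)"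
    using nn_integral_has_integral_lebesgue'[OF f_nonneg f_int] l(2) by simp
  have "A = (\<integral>\<^sup>+x. \<integral>\<^sup>+v. ennreal (exp (- v * x) * k0 x) * indicator {0..u} v \<partial>lborel \<partial>lborel)"
    unfolding A_def
  proof (rule nn_integral_cong)
    fix x :: real
    show "ennreal ((1 - exp (- u * x)) * (k0 x / x)) = (\<integral>\<^sup>+v. ennreal (exp (- v * x) * k0 x) * indicator {0..u} v \<partial>lborel)"
    proof (cases "0 < x")
      case True
      have "(\<integral>\<^sup>+v. ennreal (exp (- v * x) * k0 x) * indicator {0..u} v \<partial>lborel)
         = (\<integral>\<^sup>+v. ennreal (k0 x) * (ennreal (exp (- v * x)) * indicator {0..u} v) \<partial>lborel)"
        using k0_nonneg by (intro nn_integral_cong) (simp add: ennreal_mult mult_ac)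
      also have "\<dots> = ennreal (k0 x) * ennreal ((1 - exp (- u * x)) / x)"
        using True u nn_integral_exp_Icc[of x u] by (subst nn_integral_cmult) auto
      also have "\<dots> = ennreal ((1 - exp (- u * x)) * (k0 x / x))"
        using True u k0_nonneg[of x] by (simp add: ennreal_mult[symmetric] mult.commute)
      finally show ?thesis ..
    next
      case False
      then have "k0 x = 0" by (simp add: k0_def)
      then show ?thesis by simp
    qed
  qed
  also have "\<dots> = (\<integral>\<^sup>+v. \<integral>\<^sup>+x. ennreal (exp (- v * x) * k0 x) * indicator {0..u} v \<partial>lborel \<partial>lborel)"
    by (rule lborel_pair.Fubini') measurable
  finally have A_eq: "A = (\<integral>\<^sup>+v. \<integral>\<^sup>+x. ennreal (exp (- v * x) * k0 x) * indicator {0..u} v \<partial>lborel \<partial>lborel)" .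
  define \<gamma> where "\<gamma> = b * W 0"
  have \<gamma>: "0 \<le> \<gamma>" using b_nonneg by (simp add: \<gamma>_def)
  have "(\<integral>\<^sup>+v. ennreal \<gamma> * indicator {0..u} v \<partial>lborel) = ennreal (u * \<gamma>)"
    using u \<gamma> by (simp add: nn_integral_cmult_indicator ennreal_mult[symmetric] mult.commute)
  then have "A + ennreal (u * \<gamma>) = (\<integral>\<^sup>+v. (\<integral>\<^sup>+x. ennreal (exp (- v * x) * k0 x) * indicator {0..u} v \<partial>lborel)
      + ennreal \<gamma> * indicator {0..u} v \<partial>lborel)"
    unfolding A_eq by (subst nn_integral_add) auto
  also have "\<dots> = (\<integral>\<^sup>+v. ennreal (F v / (- R v)) * indicator {0..u} v \<partial>lborel)"
  proof (rule nn_integral_cong_AE)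
    have "AE v in lborel. v \<noteq> (0::real)" by (rule AE_lborel_singleton)
    then show "AE v in lborel. (\<integral>\<^sup>+x. ennreal (exp (- v * x) * k0 x) * indicator {0..u} v \<partial>lborel)
      + ennreal \<gamma> * indicator {0..u} v = ennreal (F v / (- R v)) * indicator {0..u} v"
    proof eventually_elim
      fix v :: real assume "v \<noteq> 0"
      show "(\<integral>\<^sup>+x. ennreal (exp (- v * x) * k0 x) * indicator {0..u} v \<partial>lborel)
        + ennreal \<gamma> * indicator {0..u} v = ennreal (F v / (- R v)) * indicator {0..u} v"
      proof (cases "v \<in> {0..u}")
        case True
        then have v: "0 < v" using \<open>v \<noteq> 0\<close> by simp
        have "ennreal (F v / (- R v) - \<gamma>) + ennreal \<gamma> = ennreal (F v / (- R v))"
          using nn_laplace_k0(2)[OF v] \<gamma> by (subst ennreal_plus[symmetric]) (auto simp: \<gamma>_def)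
        then show ?thesis using True nn_laplace_k0(1)[OF v] by (simp add: \<gamma>_def)
      qed simp
    qed
  qed
  also have "\<dots> = ennreal (l u)" by (rule f_nn)
  finally have sum: "A + ennreal (u * \<gamma>) = ennreal (l u)" .
  then have "A \<noteq> \<infinity>" by auto
  then obtain r where r: "A = ennreal r" "0 \<le> r" by (cases A) auto
  have "ennreal (r + u * \<gamma>) = ennreal (l u)" using sum r u \<gamma> by simp
  then have lr: "l u = r + u * \<gamma>" using r u \<gamma> lu by (subst (asm) ennreal_inj) auto
  have nonneg: "0 \<le> (1 - exp (- u * x)) * (k0 x / x)" for x
    using u k0_nonneg[of x] by (cases "0 < x") (auto simp: k0_def)
  show int: "integrable lborel (\<lambda>x. (1 - exp (- u * x)) * (k0 x / x))"
    using r nonneg by (intro integrableI_nonneg) (auto simp: A_def)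
  have "(\<integral>x. (1 - exp (- u * x)) * (k0 x / x) \<partial>lborel) = r"
    using nn_integral_eq_integral[OF int] nonneg r unfolding A_def[symmetric] by (simp add: integral_nonneg_AE)
  with lr show "l u = u * (b * W 0) + (\<integral>x. (1 - exp (- u * x)) * (k0 x / x) \<partial>lborel)"
    by (simp add: \<gamma>_def)
qed

end

theorem theorem3p1:
  fixes \<Omega> :: "'w measure" and P :: "real \<Rightarrow> 'w measure" and X :: "real \<Rightarrow> 'w \<Rightarrow> real"
    and F R W k :: "real \<Rightarrow> real" and b \<alpha> \<beta> \<gamma> :: real and m \<mu> L :: "real measure"
  assumes CBI: "conservative_CBI_process \<Omega> P X"
    and FR: "functional_characteristics P X F R"
    and F: "F_parameters F b m"
    and R: "R_parameters R \<alpha> \<beta> \<mu>"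
    and L: "limit_distribution P X L"
    and W: "dual_scale_function R W"
    and \<gamma>: "\<gamma> = b * W 0"
    and k: "\<And>x. x > 0 \<Longrightarrow>
      k x = b * vector_derivative W (at_right x) + (LINT \<xi>:{0<..}|m. W x - W (x - \<xi>))"
  shows "infinitely_divisible L
    \<and> 0 \<le> \<gamma>
    \<and> (\<forall>x>0. W differentiable (at_right x) \<and> set_integrable m {0<..} (\<lambda>\<xi>. W x - W (x - \<xi>)) \<and> 0 \<le> k x)
    \<and> (\<forall>u\<ge>0. set_integrable lborel {0<..} (\<lambda>x. (exp (- x * u) - 1) * (k x / x))
        \<and> - ln (LINT x:{0..}|L. exp (- u * x))
          = u * \<gamma> - (LINT x:{0<..}|lborel. (exp (- x * u) - 1) * (k x / x)))"
proof -
  from FR obtain \<phi> \<psi> where aff: "affine_exponents P X \<phi> \<psi>"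
    and derivs: "\<And>u. 0 \<le> u \<Longrightarrow> ((\<lambda>t. \<phi> t u) has_real_derivative F u) (at 0 within {0..})"
      "\<And>u. 0 \<le> u \<Longrightarrow> ((\<lambda>t. \<psi> t u) has_real_derivative R u) (at 0 within {0..})"
    unfolding functional_characteristics_def by blast
  interpret C: convergent_CBI \<Omega> P X F R \<phi> \<psi> L
    using CBI aff derivs L by unfold_locales (auto simp: conservative_CBI_process_def)
  have R0: "R 0 = 0" using R by (simp add: R_parameters_def)
  \<comment> \<open>Convergence of the process enters the analysis of \<open>W\<close> here, through
    the negativity of \<open>R\<close>.\<close>
  interpret S: dual_scale_immigration R W \<alpha> \<beta> \<mu> F b m
    using R W F C.R_negative[OF W R0] by unfold_locales
  have k_eq: "k x = S.k0 x" if x: "0 < x" for x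
  proof -
    have "(LINT \<xi>:{0<..}|m. W x - W (x - \<xi>)) = (\<integral>\<xi>. W x - W (x - \<xi>) \<partial>m)"
      unfolding set_lebesgue_integral_def
    proof (rule integral_cong_AE)
      show "AE \<xi> in m. indicator {0<..} \<xi> *\<^sub>R (W x - W (x - \<xi>)) = W x - W (x - \<xi>)"
        using S.m_AE by eventually_elim simp
    qed measurable
    then show ?thesis using x by (simp add: k S.k0_def S.D_def)
  qed
  have lap_L: "(LINT x:{0..}|L. exp (- u * x)) = laplace L u" for u
  proof -
    interpret real_distribution L using C.L_nonneg by (rule prob_on_nonneg_real_distribution)
    have "AE x in L. 0 \<le> x" using C.L_nonneg by (simp add: prob_on_nonneg_def)
    then have "AE x in L. indicator {0..} x *\<^sub>R exp (- u * x) = exp (- u * x)" by eventually_elim simp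
    then show ?thesis unfolding set_lebesgue_integral_def laplace_def
      by (intro integral_cong_AE) auto
  qed
  have l_cont: "continuous_on {0..} C.l"
    unfolding C.l_def[abs_def] using laplace_pos[OF C.L_nonneg]
    by (intro continuous_intros continuous_on_laplace C.L_nonneg) (auto simp: less_imp_neq[symmetric])
  have l_0: "C.l 0 = 0" by (simp add: C.l_def laplace_0[OF C.L_nonneg])
  have l_deriv: "(C.l has_real_derivative F u / (- R u)) (at u)" if u: "0 < u" for u
    using C.l_has_derivative[OF u] C.F_eq[OF u] S.R_neg[OF u] by simp
  note LK = S.levy_khintchine_exponent[OF l_cont l_0 l_deriv]
  \<comment> \<open>The Levy measure of \<open>L\<close>; it sits on the positive half line since
    \<open>k0\<close> vanishes elsewhere.\<close>
  define Q where "Q = density lborel (\<lambda>x. ennreal (S.k0 x / x))"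
  have kx: "0 \<le> S.k0 x / x" for x
    using S.k0_nonneg[of x] by (cases "0 < x") (auto simp: S.k0_def)
  have Q_int: "integrable Q (\<lambda>x. 1 - exp (- u * x))" if u: "0 < u" for u
    unfolding Q_def using LK(1)[OF _ u] kx by (subst integrable_real_density) (auto simp: mult.commute)
  have Q_val: "(\<integral>x. 1 - exp (- u * x) \<partial>Q) = (\<integral>x. (1 - exp (- u * x)) * (S.k0 x / x) \<partial>lborel)" for u
    unfolding Q_def using kx by (subst integral_real_density) (auto simp: mult.commute)
  have \<gamma>0: "0 \<le> \<gamma>" using S.b_nonneg by (simp add: \<gamma>)
  have "infinitely_divisible L"
  proof (rule infinitely_divisible_if_levy_khintchine[OF C.L_nonneg _ _ Q_int \<gamma>0])
    have "0 \<le> x" if "0 < S.k0 x / x" for x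
      using that by (cases "0 < x") (auto simp: S.k0_def)
    then show "AE x in Q. 0 \<le> x" unfolding Q_def by (subst AE_density) auto
    show "- ln (laplace L u) = u * \<gamma> + (\<integral>x. 1 - exp (- u * x) \<partial>Q)" if "0 < u" for u
      using LK(2)[OF _ that] unfolding Q_val by (simp add: C.l_def \<gamma>)
  qed (simp_all add: Q_def)
  moreover have "W differentiable (at_right x) \<and> set_integrable m {0<..} (\<lambda>\<xi>. W x - W (x - \<xi>)) \<and> 0 \<le> k x"
    if x: "0 < x" for x
    unfolding set_integrable_def
    using S.W_differentiable_at_right[OF x] S.k0_nonneg[of x] k_eq[OF x]
      integrable_mult_indicator[OF _ S.increment_integrable[OF x], of "{0<..}"] by (simp add: S.m_sets)
  moreover have "set_integrable lborel {0<..} (\<lambda>x. (exp (- x * u) - 1) * (k x / x))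
        \<and> - ln (LINT x:{0..}|L. exp (- u * x))
          = u * \<gamma> - (LINT x:{0<..}|lborel. (exp (- x * u) - 1) * (k x / x))" if u: "0 \<le> u" for u
  proof -
    \<comment> \<open>The sign change passes from \<open>exp (- x * u) - 1\<close> to the
      nonnegative integrand of \<open>LK\<close>, and the indicator disappears because
      \<open>k0\<close> already vanishes off the positive half line.\<close>
    have eq: "indicator {0<..} x *\<^sub>R ((exp (- x * u) - 1) * (k x / x)) = - ((1 - exp (- u * x)) * (S.k0 x / x))" for x
    proof (cases "0 < x")
      case True
      then show ?thesis by (simp add: k_eq mult.commute[of x u] left_diff_distrib diff_divide_distrib)
    qed (simp add: S.k0_def)
    show ?thesis
    proof (cases "u = 0")
      case True
      then show ?thesis
        using laplace_0[OF C.L_nonneg] lap_L[of 0] by (simp add: set_integrable_def set_lebesgue_integral_def)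
    next
      case False
      then have "0 < u" using u by simp
      then show ?thesis
        using LK[OF _ \<open>0 < u\<close>] unfolding set_integrable_def set_lebesgue_integral_def eq lap_L[unfolded set_lebesgue_integral_def]
        by (simp add: C.l_def \<gamma>)
    qed
  qed
  ultimately show ?thesis using \<gamma>0 by blast
qed

end
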